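(* Let $\boldsymbol{d}\in\mathbb{D}$ and let $\boldsymbol{z}^o\in\mathbb{R}^{nN}$ be feasible for $P(\boldsymbol{d};\boldsymbol{G},\boldsymbol{p})$. Then there exist a solution (minimizer) $\boldsymbol{z}^*=(z^*_1,\dots,z^*_N)$ of $P(\boldsymbol{d};\boldsymbol{G},\boldsymbol{p})$ and a projected coarse solution $\boldsymbol{z}'=(z'_1,\dots,z'_N)$ of $P(\widetilde{\boldsymbol{d}};\widetilde{\boldsymbol{G}},\widetilde{\boldsymbol{p}})$ such that for every $i\in\{1,\dots,N\}$ $$\|z^*_i-z'_i\|\le\sum_{j\in\{1,\dots,N\}\setminus\mathbb{S}}\Gamma\,\Delta\,\rho^{(|i-j|-1)_+}.$$
   Context: Problem. Fix a horizon $N\ge 1$, dimensions $n_x,n_u,n_w$, and real matrices $A_i\in\mathbb{R}^{n_x\times n_x}$, $B_i\in\mathbb{R}^{n_x\times n_u}$ ($1\le i\le N-1$), $E_i\in\mathbb{R}^{n_w\times n_x}$, $F_i\in\mathbb{R}^{n_w\times n_u}$ ($1\le i\le N$). Set $n:=n_x+n_u$ and $m:=4n_x+2n_u+2n_w$. For $1\le i\le N$ let $G_{i,i}\in\mathbb{R}^{m\times n}$ be the matrix whose block rows, in order, are $[I_{n_x}\;0]$, $[-I_{n_x}\;0]$, $[E_i\;F_i]$, $[-E_i\;-F_i]$, $[I_{n_x}\;0]$, $[-I_{n_x}\;0]$, $[0\;I_{n_u}]$, $[0\;-I_{n_u}]$. For $2\le i\le N$ let $G_{i,i-1}\in\mathbb{R}^{m\times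 n}$ be the matrix whose first two block rows (each of height $n_x$) are $[-A_{i-1}\;-B_{i-1}]$ and $[A_{i-1}\;B_{i-1}]$ and whose remaining rows are zero. Set $G_{i,j}:=0$ for all other $i,j$ (in particular $G_{1,0}:=0$, and $z_0:=0$). Let $\boldsymbol{G}:=(G_{i,j})_{i,j=1}^N\in\mathbb{R}^{mN\times nN}$, and fix $\boldsymbol{p}\in\mathbb{R}^{nN}$. For any data $(\boldsymbol{d};\boldsymbol{G},\boldsymbol{p})$ of compatible sizes, $P(\boldsymbol{d};\boldsymbol{G},\boldsymbol{p})$ denotes the linear program $\min_{\boldsymbol{z}}\boldsymbol{p}^\top\boldsymbol{z}$ s.t. $\boldsymbol{G}\boldsymbol{z}\ge\boldsymbol{d}$ (componentwise). Write $\boldsymbol{z}=(z_1,\dots,z_N)$, $z_i\in\mathbb{R}^n$, and $\boldsymbol{d}=(d_1,\dots,d_N)$, $d_i\in\mathbb{R}^m$. For the fixed block matrix $\boldsymbol{G}=(G_{i,j})_{i,j=1}^N$ built from $A_i,B_i,E_i,F_i$ and the fixed cost vector $\boldsymbol{p}\in\mathbb{R}^{nN}$, write $P(\boldsymbol{d})$ for $P(\boldsymbol{d};\boldsymbol{G},\boldsymbol{p})$, and let $\mathbb{D}:=\{\boldsymbol{d}\in\mathbb{R}^{mN}:P(\boldsymbol{d})\text{ is feasible}\}$. Constants $\Gamma,\rho$. For $B\subseteq\{1,\dots,mN\}$, $\boldsymbol{G}[B,:]$ is the submatrix of rows indexed by $B$. $B$ is a basis if $\boldsymbol{G}[B,:]$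 is (square and) nonsingular; its basic solution is the $\boldsymbol{z}^B(\boldsymbol{d})$ with $\boldsymbol{G}[B,:]\boldsymbol{z}^B(\boldsymbol{d})=\boldsymbol{d}[B]$; $B$ is optimal for $P(\boldsymbol{d})$ if $\boldsymbol{z}^B(\boldsymbol{d})$ is an optimal solution of $P(\boldsymbol{d})$. $\mathbb{B}$ is the set of bases optimal for $P(\boldsymbol{d})$ for some $\boldsymbol{d}\in\mathbb{D}$. With $\underline{\sigma}:=\min_{B\in\mathbb{B}}\sigma_{\min}(\boldsymbol{G}[B,:])$ and $\overline{\sigma}:=\max_{B\in\mathbb{B}}\sigma_{\max}(\boldsymbol{G}[B,:])$ (smallest/largest singular values), set $\Gamma:=\overline{\sigma}/\underline{\sigma}^2$ and $\rho:=(\overline{\sigma}^2-\underline{\sigma}^2)/(\overline{\sigma}^2+\underline{\sigma}^2)$. Coarse problem. Fix a coarse grid $\{M_1=1<M_2<\cdots<M_K\}\subseteq\{1,\dots,N\}$; put $M_{K+1}:=N+1$, $N_k:=M_{k+1}-1$, $L_k:=N_k-M_k+1$, so the integer intervals $\{M_k,\dots,N_k\}$ partition $\{1,\dots,N\}$. Let $T:=\mathrm{diag}(T_1,\dots,T_K)\in\mathbb{R}^{nN\times nK}$ and $U:=\mathrm{diag}(U_1,\dots,U_K)\in\mathbb{R}^{mN\times mK}$ be block diagonal, where $T_k\in\mathbb{R}^{nL_k\times n}$ is $L_k^{-1/2}$ times $L_k$ stacked copies of $I_n$, and $U_k\in\mathbb{R}^{mL_k\times m}$ is $L_k^{-1/2}$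 times $L_k$ stacked copies of $I_m$. Fix a primal-dual prior guess $(\boldsymbol{z}^o,\boldsymbol{\lambda}^o)\in\mathbb{R}^{nN}\times\mathbb{R}^{mN}$, $\boldsymbol{\lambda}^o=(\lambda^o_1,\dots,\lambda^o_N)$, $\lambda^o_i\in\mathbb{R}^m$. The coarse problem is $P(\widetilde{\boldsymbol{d}};\widetilde{\boldsymbol{G}},\widetilde{\boldsymbol{p}})$ with $\widetilde{\boldsymbol{p}}:=T^\top(\boldsymbol{p}-\boldsymbol{G}^\top\boldsymbol{\lambda}^o)$, $\widetilde{\boldsymbol{d}}:=U^\top(\boldsymbol{d}-\boldsymbol{G}\boldsymbol{z}^o)$, $\widetilde{\boldsymbol{G}}:=U^\top\boldsymbol{G}T$. A projected coarse solution is a vector $\boldsymbol{z}'=\boldsymbol{z}^o+T\widetilde{\boldsymbol{z}}^*$ where $\widetilde{\boldsymbol{z}}^*\in\mathbb{R}^{nK}$ is an optimal solution of the coarse problem. Free indices. $\widetilde{\mathbb{S}}:=\{k\in\{1,\dots,K\}: L_k=1\text{ and }\lambda^o_{M_k}=0\}$ and $\mathbb{S}:=\bigcup_{k\in\widetilde{\mathbb{S}}}\{M_k,\dots,N_k\}\subseteq\{1,\dots,N\}$. Coarsening error. $\Delta:=\max\{\max_{1\le j\le N}\|d_j-G_{j,j-1}z'_{j-1}-G_{j,j}z'_j\|:\boldsymbol{z}'\in\mathbb{P}\}$, where $\mathbb{P}:=\{\boldsymbol{z}^o+T\widetilde{\boldsymbol{z}}:\widetilde{\boldsymbol{G}}\widetilde{\boldsymbol{z}}\ge\widetilde{\boldsymbol{d}}\}$,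 with $G_{1,0}=0$ and $z'_0=0$ (the set $\mathbb{P}$ is compact). Notation. $\|\cdot\|$ is the Euclidean norm and $(a)_+:=\max(0,a)$. *)

theory Defs
  imports "Jordan_Normal_Form.Char_Poly" "Jordan_Normal_Form.DL_Submatrix"
begin

text \<open>
  Stages \<open>1, \<dots>, N\<close> and coarse intervals \<open>1, \<dots>, K\<close> are numbered from 1; the entries of
  vectors and matrices are numbered from 0. A vector in \<open>b N\<close> dimensions consists of \<open>N\<close>
  blocks of length \<open>b\<close>, and block \<open>i\<close> occupies the entries \<open>(i - 1) b, \<dots>, i b - 1\<close>.
\<close>

definition eucl_norm :: "real vec \<Rightarrow> real" where
  "eucl_norm v = sqrt (v \<bullet> v)"

definition append_cols :: "'a::zero mat \<Rightarrow> 'a mat \<Rightarrow> 'a mat" where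
  "append_cols A B = four_block_mat A B (0\<^sub>m 0 (dim_col A)) (0\<^sub>m 0 (dim_col B))"

text \<open>Block \<open>0\<close> is the zero vector; this is the convention \<open>z\<^sub>0 = 0\<close>.\<close>

definition vec_block :: "nat \<Rightarrow> 'a::zero vec \<Rightarrow> nat \<Rightarrow> 'a vec" where
  "vec_block b v i = (if i = 0 then 0\<^sub>v b else vec b (\<lambda>r. v $ ((i - 1) * b + r)))"

definition block_mat ::
  "nat \<Rightarrow> nat \<Rightarrow> nat \<Rightarrow> (nat \<Rightarrow> nat \<Rightarrow> 'a mat) \<Rightarrow> 'a mat" where
  "block_mat N m n Gb =
     mat (m * N) (n * N) (\<lambda>(r, c). Gb (r div m + 1) (c div n + 1) $$ (r mod m, c mod n))"


subsection \<open>Linear programs \<open>min p \<bullet> z\<close> subject to \<open>G z \<ge> d\<close>\<close>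

definition lp_feasible :: "real vec \<Rightarrow> real mat \<Rightarrow> real vec set" where
  "lp_feasible d G = {z \<in> carrier_vec (dim_col G). G *\<^sub>v z \<ge> d}"

definition lp_optimal :: "real vec \<Rightarrow> real mat \<Rightarrow> real vec \<Rightarrow> real vec \<Rightarrow> bool" where
  "lp_optimal d G p z \<longleftrightarrow> z \<in> lp_feasible d G \<and> (\<forall>y \<in> lp_feasible d G. p \<bullet> z \<le> p \<bullet> y)"

definition feasible_data :: "real mat \<Rightarrow> real vec set" where
  "feasible_data G = {d \<in> carrier_vec (dim_row G). lp_feasible d G \<noteq> {}}"


subsection \<open>Bases and the constants \<open>\<Gamma>\<close> and \<open>\<rho>\<close>\<close>

definition subvec :: "'a vec \<Rightarrow> nat set \<Rightarrow> 'a vec" where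
  "subvec v B = vec (card {i. i < dim_vec v \<and> i \<in> B}) (\<lambda>i. v $ pick B i)"

abbreviation row_submatrix :: "'a mat \<Rightarrow> nat set \<Rightarrow> 'a mat" where
  "row_submatrix G B \<equiv> submatrix G B UNIV"

definition is_basis :: "real mat \<Rightarrow> nat set \<Rightarrow> bool" where
  "is_basis G B \<longleftrightarrow> B \<subseteq> {..<dim_row G} \<and> invertible_mat (row_submatrix G B)"

definition basic_solution :: "real mat \<Rightarrow> nat set \<Rightarrow> real vec \<Rightarrow> real vec" where
  "basic_solution G B d =
     (THE z. z \<in> carrier_vec (dim_col G) \<and> row_submatrix G B *\<^sub>v z = subvec d B)"

definition optimal_bases :: "real mat \<Rightarrow> real vec \<Rightarrow> nat set set" where
  "optimal_bases G p =
     {B. is_basis G B \<and> (\<exists>d \<in> feasible_data G. lp_optimal d G p (basic_solution G B d))}"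

definition singular_values :: "real mat \<Rightarrow> real set" where
  "singular_values A = sqrt ` {e. eigenvalue (A\<^sup>T * A) e}"

definition sigma_min :: "real mat \<Rightarrow> real" where
  "sigma_min A = Min (singular_values A)"

definition sigma_max :: "real mat \<Rightarrow> real" where
  "sigma_max A = Max (singular_values A)"

definition sigma_lower :: "real mat \<Rightarrow> real vec \<Rightarrow> real" where
  "sigma_lower G p = Min ((\<lambda>B. sigma_min (row_submatrix G B)) ` optimal_bases G p)"

definition sigma_upper :: "real mat \<Rightarrow> real vec \<Rightarrow> real" where
  "sigma_upper G p = Max ((\<lambda>B. sigma_max (row_submatrix G B)) ` optimal_bases G p)"

definition Gamma_const :: "real mat \<Rightarrow> real vec \<Rightarrow> real" where
  "Gamma_const G p = sigma_upper G p / (sigma_lower G p)\<^sup>2"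

definition rho_const :: "real mat \<Rightarrow> real vec \<Rightarrow> real" where
  "rho_const G p =
     ((sigma_upper G p)\<^sup>2 - (sigma_lower G p)\<^sup>2) / ((sigma_upper G p)\<^sup>2 + (sigma_lower G p)\<^sup>2)"


subsection \<open>The stage blocks \<open>G\<^sub>i\<^sub>,\<^sub>j\<close>\<close>

definition diag_stage :: "nat \<Rightarrow> nat \<Rightarrow> real mat \<Rightarrow> real mat \<Rightarrow> real mat" where
  "diag_stage nx nu E F =
     append_cols (1\<^sub>m nx) (0\<^sub>m nx nu) @\<^sub>r
     append_cols (- 1\<^sub>m nx) (0\<^sub>m nx nu) @\<^sub>r
     append_cols E F @\<^sub>r
     append_cols (- E) (- F) @\<^sub>r
     append_cols (1\<^sub>m nx) (0\<^sub>m nx nu) @\<^sub>r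
     append_cols (- 1\<^sub>m nx) (0\<^sub>m nx nu) @\<^sub>r
     append_cols (0\<^sub>m nu nx) (1\<^sub>m nu) @\<^sub>r
     append_cols (0\<^sub>m nu nx) (- 1\<^sub>m nu)"

definition sub_stage :: "nat \<Rightarrow> nat \<Rightarrow> nat \<Rightarrow> real mat \<Rightarrow> real mat \<Rightarrow> real mat" where
  "sub_stage nx nu nw A B =
     append_cols (- A) (- B) @\<^sub>r
     append_cols A B @\<^sub>r
     0\<^sub>m (2 * nx + 2 * nu + 2 * nw) (nx + nu)"

definition stage_block ::
  "nat \<Rightarrow> nat \<Rightarrow> nat \<Rightarrow> (nat \<Rightarrow> real mat) \<Rightarrow> (nat \<Rightarrow> real mat) \<Rightarrow>
   (nat \<Rightarrow> real mat) \<Rightarrow> (nat \<Rightarrow> real mat) \<Rightarrow> nat \<Rightarrow> nat \<Rightarrow> real mat" where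
  "stage_block nx nu nw A B E F i j =
     (if j = i then diag_stage nx nu (E i) (F i)
      else if 2 \<le> i \<and> j = i - 1 then sub_stage nx nu nw (A (i - 1)) (B (i - 1))
      else 0\<^sub>m (4 * nx + 2 * nu + 2 * nw) (nx + nu))"


subsection \<open>Coarsening\<close>

text \<open>The interval \<open>k\<close> of a grid is \<open>{M k..grid_end M k}\<close>; the last one uses \<open>M (K + 1) = N + 1\<close>.\<close>

definition grid_end :: "(nat \<Rightarrow> nat) \<Rightarrow> nat \<Rightarrow> nat" where
  "grid_end M k = M (k + 1) - 1"

definition grid_len :: "(nat \<Rightarrow> nat) \<Rightarrow> nat \<Rightarrow> nat" where
  "grid_len M k = grid_end M k - M k + 1"

definition coarse_grid :: "nat \<Rightarrow> nat \<Rightarrow> (nat \<Rightarrow> nat) \<Rightarrow> bool" where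
  "coarse_grid N K M \<longleftrightarrow>
     1 \<le> K \<and> M 1 = 1 \<and> strict_mono_on {1..K} M \<and> M ` {1..K} \<subseteq> {1..N} \<and> M (K + 1) = N + 1"

definition stacked_id :: "nat \<Rightarrow> nat \<Rightarrow> real mat" where
  "stacked_id b L = (1 / sqrt (real L)) \<cdot>\<^sub>m mat (b * L) b (\<lambda>(r, c). 1\<^sub>m b $$ (r mod b, c))"

definition coarsening_mat :: "nat \<Rightarrow> nat \<Rightarrow> (nat \<Rightarrow> nat) \<Rightarrow> real mat" where
  "coarsening_mat b K M = diag_block_mat (map (\<lambda>k. stacked_id b (grid_len M k)) [1..<K + 1])"

definition free_coarse_indices ::
  "nat \<Rightarrow> nat \<Rightarrow> (nat \<Rightarrow> nat) \<Rightarrow> real vec \<Rightarrow> nat set" where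
  "free_coarse_indices m K M lo =
     {k \<in> {1..K}. grid_len M k = 1 \<and> vec_block m lo (M k) = 0\<^sub>v m}"

definition free_indices :: "nat \<Rightarrow> nat \<Rightarrow> (nat \<Rightarrow> nat) \<Rightarrow> real vec \<Rightarrow> nat set" where
  "free_indices m K M lo = (\<Union>k \<in> free_coarse_indices m K M lo. {M k..grid_end M k})"

definition stage_residual ::
  "nat \<Rightarrow> nat \<Rightarrow> (nat \<Rightarrow> nat \<Rightarrow> real mat) \<Rightarrow> real vec \<Rightarrow> real vec \<Rightarrow> nat \<Rightarrow> real vec" where
  "stage_residual m n Gb d z j =
     vec_block m d j - Gb j (j - 1) *\<^sub>v vec_block n z (j - 1) - Gb j j *\<^sub>v vec_block n z j"

text \<open>
  The outer maximum ranges over an infinite set \<open>P\<close>, where \<open>Max\<close> is not meaningful. It is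
  written as a supremum, which is attained for nonempty compact \<open>P\<close>.
\<close>

definition coarsening_error ::
  "nat \<Rightarrow> nat \<Rightarrow> nat \<Rightarrow> (nat \<Rightarrow> nat \<Rightarrow> real mat) \<Rightarrow> real vec \<Rightarrow> real vec set \<Rightarrow> real" where
  "coarsening_error N m n Gb d P =
     (SUP z \<in> P. Max ((\<lambda>j. eucl_norm (stage_residual m n Gb d z j)) ` {1..N}))"

end

theory Submission
  imports Defs "HOL-Analysis.L2_Norm"
begin

text \<open>
  Let \<open>v\<close> be an optimal vertex of the coarse problem and \<open>z' = zo + T v\<close> its projection. Two facts
  carry the proof.

  First, \<open>z'\<close> is an exact solution of a fine problem with the same matrix and cost and with
  perturbed data: for the stages \<open>j\<close> outside \<open>S\<close>, replace \<open>d\<^sub>j\<close> by \<open>(G z')\<^sub>j\<close>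
  (\<open>projected_coarse_solution_optimal\<close>). The rows of each stage come in opposite pairs, so
  every direction \<open>h\<close> from \<open>z'\<close> to another feasible point of the perturbed problem satisfies
  \<open>(G h)\<^sub>j = 0\<close> for these \<open>j\<close>. The bound rows then give \<open>h\<^sub>j = 0\<close>, so \<open>h\<close> lives on the free
  stages, where coarsening changes nothing: \<open>h = T w\<close> with \<open>v + w\<close> feasible for the coarse
  problem, and \<open>w\<close> has the same coarse cost as \<open>h\<close> has fine cost, as the dual guess vanishes on
  \<open>S\<close>. Hence optimality passes from \<open>v\<close> to \<open>z'\<close>. The perturbation is the residual of \<open>z'\<close>
  outside \<open>S\<close>, which is at most \<open>\<Delta>\<close> per stage.

  Second, the solution of the linear program reacts to a perturbation of its data with
  exponential decay between stages. Along the segment from the perturbed data to \<open>d\<close>, an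
  optimal vertex can be followed in affine pieces, with a velocity \<open>w\<close> that solves
  \<open>G[B,:] w = \<delta>[B]\<close> for an optimal basis \<open>B\<close>, where \<open>\<delta>\<close> is the change of data
  (\<open>optimal_vertex_path\<close>). For a single basis, Richardson iteration for the normal equations
  contracts with rate \<open>\<rho>\<close>, and because \<open>G\<close> is block bidiagonal, each iteration carries
  information over only one more stage. Hence \<open>\<delta>\<^sub>j\<close> contributes to \<open>w\<^sub>i\<close> at most its norm
  times \<open>\<Gamma>\<close> times a power of \<open>\<rho>\<close> whose exponent is the positive part of \<open>\<bar>i - j\<bar> - 1\<close>
  (\<open>basis_solution_decay\<close>), and integration along the segment gives the same bound for \<open>zs - z'\<close>.
\<close>

section \<open>Vertices of polyhedra\<close>

definition satisfying :: "real mat \<Rightarrow> real vec \<Rightarrow> nat set \<Rightarrow> real vec set" where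
  "satisfying G d I = {z \<in> carrier_vec (dim_col G). \<forall>i\<in>I. d $ i \<le> (G *\<^sub>v z) $ i}"

definition active_rows :: "real mat \<Rightarrow> real vec \<Rightarrow> nat set \<Rightarrow> real vec \<Rightarrow> nat set" where
  "active_rows G d I z = {i \<in> I. (G *\<^sub>v z) $ i = d $ i}"

definition trivial_kernel_on :: "real mat \<Rightarrow> nat set \<Rightarrow> bool" where
  "trivial_kernel_on G I \<longleftrightarrow>
     (\<forall>h \<in> carrier_vec (dim_col G). (\<forall>i\<in>I. (G *\<^sub>v h) $ i = 0) \<longrightarrow> h = 0\<^sub>v (dim_col G))"

lemma mult_mat_vec_line:
  fixes G :: "real mat"
  assumes "x \<in> carrier_vec (dim_col G)" "h \<in> carrier_vec (dim_col G)" "i < dim_row G"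
  shows "(G *\<^sub>v (x + t \<cdot>\<^sub>v h)) $ i = (G *\<^sub>v x) $ i + t * (G *\<^sub>v h) $ i"
proof -
  have "row G i \<in> carrier_vec (dim_col G)" by simp
  then show ?thesis using assms by (simp add: scalar_prod_add_distrib[of _ "dim_col G"])
qed

lemma mult_mat_vec_scaled_diff:
  fixes G :: "real mat"
  assumes "x \<in> carrier_vec (dim_col G)" "h \<in> carrier_vec (dim_col G)" "i < dim_row G"
  shows "(G *\<^sub>v (t \<cdot>\<^sub>v (x - h))) $ i = t * ((G *\<^sub>v x) $ i - (G *\<^sub>v h) $ i)"
proof -
  have "row G i \<in> carrier_vec (dim_col G)" by simp
  then show ?thesis using assms by (simp add: scalar_prod_minus_distrib[of _ "dim_col G"])
qed

lemma scalar_prod_line: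
  fixes p :: "real vec"
  assumes "p \<in> carrier_vec n" "x \<in> carrier_vec n" "h \<in> carrier_vec n"
  shows "p \<bullet> (x + t \<cdot>\<^sub>v h) = p \<bullet> x + t * (p \<bullet> h)"
  using assms by (simp add: scalar_prod_add_distrib[of _ n])

lemma scalar_prod_scaled_diff:
  fixes p :: "real vec"
  assumes "p \<in> carrier_vec n" "x \<in> carrier_vec n" "h \<in> carrier_vec n"
  shows "p \<bullet> (t \<cdot>\<^sub>v (x - h)) = t * (p \<bullet> x - p \<bullet> h)"
  using assms by (simp add: scalar_prod_minus_distrib[of _ n])

text \<open>
  A point at which the active rows leave a free direction is not a vertex. Along such a direction,
  oriented so that the cost does not grow and some row decreases, the first row to become tight
  enlarges the active set. The hypothesis on recession directions rules out a decreasing cost along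
  a direction that no row ever blocks.
\<close>

lemma move_to_next_row:
  fixes G :: "real mat" and d z p :: "real vec"
  assumes I: "I \<subseteq> {..<dim_row G}" and p: "p \<in> carrier_vec (dim_col G)"
    and z: "z \<in> satisfying G d I"
    and ker: "trivial_kernel_on G I"
    and rec: "\<And>h. h \<in> carrier_vec (dim_col G) \<Longrightarrow> (\<forall>i\<in>I. 0 \<le> (G *\<^sub>v h) $ i) \<Longrightarrow> 0 \<le> p \<bullet> h"
    and nv: "\<not> trivial_kernel_on G (active_rows G d I z)"
  shows "\<exists>z' \<in> satisfying G d I. p \<bullet> z' \<le> p \<bullet> z \<and> active_rows G d I z \<subset> active_rows G d I z'"
proof -
  let ?D = "dim_col G" and ?A = "active_rows G d I z"
  have fin: "finite I" using I finite_subset by blast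
  have zc: "z \<in> carrier_vec ?D" and zf: "\<And>i. i \<in> I \<Longrightarrow> d $ i \<le> (G *\<^sub>v z) $ i"
    using z by (auto simp: satisfying_def)
  obtain h0 where h0: "h0 \<in> carrier_vec ?D" "\<And>i. i \<in> ?A \<Longrightarrow> (G *\<^sub>v h0) $ i = 0" "h0 \<noteq> 0\<^sub>v ?D"
    using nv unfolding trivial_kernel_on_def by blast
  obtain i0 where i0: "i0 \<in> I" "(G *\<^sub>v h0) $ i0 \<noteq> 0"
    using ker h0 unfolding trivial_kernel_on_def by blast
  have "\<exists>h. h \<in> carrier_vec ?D \<and> (\<forall>i\<in>?A. (G *\<^sub>v h) $ i = 0) \<and> p \<bullet> h \<le> 0 \<and> (\<exists>i\<in>I. (G *\<^sub>v h) $ i < 0)"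
  proof -
    \<comment> \<open>The sign is chosen so that the cost does not increase; if the cost is constant along the line,
      so that row \<open>i0\<close> decreases.\<close>
    define s :: real where "s = (if p \<bullet> h0 > 0 \<or> (p \<bullet> h0 = 0 \<and> (G *\<^sub>v h0) $ i0 > 0) then -1 else 1)"
    define h where "h = s \<cdot>\<^sub>v h0"
    have hc: "h \<in> carrier_vec ?D" using h0 by (simp add: h_def)
    have Gh: "(G *\<^sub>v h) $ i = s * (G *\<^sub>v h0) $ i" if "i \<in> I" for i
      using that I h0(1) by (auto simp: h_def)
    have ph: "p \<bullet> h = s * (p \<bullet> h0)" using h0(1) p by (simp add: h_def)
    have "\<exists>i\<in>I. (G *\<^sub>v h) $ i < 0"
    proof (cases "p \<bullet> h0 = 0")
      case True
      then have "(G *\<^sub>v h) $ i0 < 0" using i0 Gh[OF i0(1)] by (auto simp: s_def)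
      then show ?thesis using i0 by blast
    next
      case False
      then have "p \<bullet> h < 0" by (auto simp: ph s_def)
      then show ?thesis using rec[OF hc] by force
    qed
    moreover have "p \<bullet> h \<le> 0" by (auto simp: ph s_def)
    moreover have "\<forall>i\<in>?A. (G *\<^sub>v h) $ i = 0" using h0(2) Gh by (auto simp: active_rows_def)
    ultimately show ?thesis using hc by blast
  qed
  then obtain h where hc: "h \<in> carrier_vec ?D" and hA: "\<And>i. i \<in> ?A \<Longrightarrow> (G *\<^sub>v h) $ i = 0"
    and ph: "p \<bullet> h \<le> 0" and hn: "\<exists>i\<in>I. (G *\<^sub>v h) $ i < 0" by blast
  define J where "J = {i\<in>I. (G *\<^sub>v h) $ i < 0}"
  \<comment> \<open>The ratio test of the simplex method: row \<open>i\<close> becomes tight after a step of length \<open>q i\<close>.\<close>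
  define q where "q = (\<lambda>i. ((G *\<^sub>v z) $ i - d $ i) / (- (G *\<^sub>v h) $ i))"
  have J: "finite J" "J \<noteq> {}" using fin hn by (auto simp: J_def)
  obtain k where k: "k \<in> J" "\<And>i. i \<in> J \<Longrightarrow> q k \<le> q i"
    using J by (metis finite_has_minimal arg_min_if_finite(1) arg_min_least)
  define z' where "z' = z + q k \<cdot>\<^sub>v h"
  have Gz': "(G *\<^sub>v z') $ i = (G *\<^sub>v z) $ i + q k * (G *\<^sub>v h) $ i" if "i \<in> I" for i
    unfolding z'_def using that I by (intro mult_mat_vec_line zc hc) auto
  have q0: "q k \<ge> 0" using k(1) zf by (auto simp: q_def J_def intro!: divide_nonneg_neg)
  have feas: "d $ i \<le> (G *\<^sub>v z') $ i" if i: "i \<in> I" for i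
  proof (cases "i \<in> J")
    case True
    then have n: "(G *\<^sub>v h) $ i < 0" by (simp add: J_def)
    have "q k * (- (G *\<^sub>v h) $ i) \<le> q i * (- (G *\<^sub>v h) $ i)"
      using k(2)[OF True] n by (intro mult_right_mono) auto
    also have "\<dots> = (G *\<^sub>v z) $ i - d $ i" using n by (simp add: q_def)
    finally show ?thesis by (simp add: Gz'[OF i])
  next
    case False
    then have "0 \<le> q k * (G *\<^sub>v h) $ i" using i q0 by (auto simp: J_def)
    then show ?thesis using zf[OF i] by (simp add: Gz'[OF i])
  qed
  have kk: "(G *\<^sub>v z') $ k = d $ k"
    using k(1) Gz'[of k] by (simp add: J_def q_def)
  have "?A \<subseteq> active_rows G d I z'"
    using hA Gz' by (auto simp: active_rows_def)
  moreover have "k \<in> active_rows G d I z'" using kk k(1) by (auto simp: active_rows_def J_def)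
  moreover have "k \<notin> ?A" using hA k(1) by (force simp: J_def)
  moreover have "p \<bullet> z' \<le> p \<bullet> z"
    unfolding z'_def scalar_prod_line[OF p zc hc] using q0 ph by (simp add: mult_nonneg_nonpos)
  moreover have "z' \<in> satisfying G d I" using feas zc hc by (auto simp: satisfying_def z'_def)
  ultimately show ?thesis by blast
qed

lemma vertex_below:
  fixes G :: "real mat" and d z p :: "real vec"
  assumes I: "I \<subseteq> {..<dim_row G}" and p: "p \<in> carrier_vec (dim_col G)"
    and ker: "trivial_kernel_on G I"
    and rec: "\<And>h. h \<in> carrier_vec (dim_col G) \<Longrightarrow> (\<forall>i\<in>I. 0 \<le> (G *\<^sub>v h) $ i) \<Longrightarrow> 0 \<le> p \<bullet> h"
    and z: "z \<in> satisfying G d I"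
  shows "\<exists>v \<in> satisfying G d I. p \<bullet> v \<le> p \<bullet> z \<and> trivial_kernel_on G (active_rows G d I v)"
  using z
proof (induction "card (I - active_rows G d I z)" arbitrary: z rule: less_induct)
  case less
  show ?case
  proof (cases "trivial_kernel_on G (active_rows G d I z)")
    case True
    then show ?thesis using less.prems by blast
  next
    case False
    obtain z' where z': "z' \<in> satisfying G d I" "p \<bullet> z' \<le> p \<bullet> z"
      "active_rows G d I z \<subset> active_rows G d I z'"
      using move_to_next_row[OF I p less.prems ker rec False] by blast
    have fin: "finite I" using I finite_subset by blast
    have "active_rows G d I z' \<subseteq> I" by (auto simp: active_rows_def)
    then have "I - active_rows G d I z' \<subset> I - active_rows G d I z" using z'(3) by blast
    then have "card (I - active_rows G d I z') < card (I - active_rows G d I z)"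
      using fin by (intro psubset_card_mono) auto
    from less.hyps[OF this z'(1)] z'(2) show ?thesis by (meson order_trans)
  qed
qed

lemma trivial_kernel_on_unique:
  assumes "trivial_kernel_on G I" "I \<subseteq> {..<dim_row G}"
    and "x \<in> carrier_vec (dim_col G)" "y \<in> carrier_vec (dim_col G)"
    and "\<And>i. i \<in> I \<Longrightarrow> (G *\<^sub>v x) $ i = (G *\<^sub>v y) $ i"
  shows "x = y"
proof -
  have "(G *\<^sub>v (x - y)) $ i = 0" if i: "i \<in> I" for i
  proof -
    have "i < dim_row G" using i assms(2) by auto
    then show ?thesis
      using mult_mat_vec_scaled_diff[OF assms(3,4), of i 1] assms(5)[OF i] by simp
  qed
  moreover have c: "x - y \<in> carrier_vec (dim_col G)" using assms(3,4) by simp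
  ultimately have z: "x - y = 0\<^sub>v (dim_col G)"
    using assms(1) unfolding trivial_kernel_on_def by blast
  show ?thesis
  proof (rule eq_vecI)
    fix i assume "i < dim_vec y"
    then have i: "i < dim_col G" "i < dim_vec y" using assms(4) by auto
    have "(x - y) $ i = 0" using z i(1) by simp
    then show "x $ i = y $ i" using i(2) by simp
  qed (use assms(3,4) in simp)
qed

text \<open>
  A vertex is determined by its set of active rows, so there are finitely many vertices. Every
  feasible point is beaten by one of them, and a best vertex is therefore optimal.
\<close>

lemma optimal_vertex_exists:
  fixes G :: "real mat" and d z p :: "real vec"
  assumes I: "I \<subseteq> {..<dim_row G}" and p: "p \<in> carrier_vec (dim_col G)"
    and ker: "trivial_kernel_on G I"
    and rec: "\<And>h. h \<in> carrier_vec (dim_col G) \<Longrightarrow> (\<forall>i\<in>I. 0 \<le> (G *\<^sub>v h) $ i) \<Longrightarrow> 0 \<le> p \<bullet> h"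
    and ne: "satisfying G d I \<noteq> {}"
  shows "\<exists>v \<in> satisfying G d I. (\<forall>y \<in> satisfying G d I. p \<bullet> v \<le> p \<bullet> y) \<and>
           trivial_kernel_on G (active_rows G d I v)"
proof -
  define V where "V = {v \<in> satisfying G d I. trivial_kernel_on G (active_rows G d I v)}"
  have inj: "inj_on (active_rows G d I) V"
  proof (rule inj_onI)
    fix x y assume xy: "x \<in> V" "y \<in> V" "active_rows G d I x = active_rows G d I y"
    show "x = y"
    proof (rule trivial_kernel_on_unique)
      show "trivial_kernel_on G (active_rows G d I x)" using xy by (simp add: V_def)
      show "active_rows G d I x \<subseteq> {..<dim_row G}" using I by (auto simp: active_rows_def)
      show "x \<in> carrier_vec (dim_col G)" "y \<in> carrier_vec (dim_col G)"
        using xy by (auto simp: V_def satisfying_def)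
      fix i assume i: "i \<in> active_rows G d I x"
      moreover have "i \<in> active_rows G d I y" using xy(3) i by simp
      ultimately show "(G *\<^sub>v x) $ i = (G *\<^sub>v y) $ i"
        unfolding active_rows_def by simp
    qed
  qed
  have "finite I" using I finite_subset by blast
  moreover have "active_rows G d I ` V \<subseteq> Pow I" by (auto simp: active_rows_def)
  ultimately have fin: "finite V" using inj by (meson finite_Pow_iff finite_imageD finite_subset)
  have below: "\<exists>v\<in>V. p \<bullet> v \<le> p \<bullet> y" if "y \<in> satisfying G d I" for y
    using vertex_below[OF I p ker rec that] by (auto simp: V_def)
  then have "V \<noteq> {}" using ne by blast
  then obtain v where v: "v \<in> V" "\<And>y. y \<in> V \<Longrightarrow> p \<bullet> v \<le> p \<bullet> y"
    using fin by (metis arg_min_if_finite(1) arg_min_least)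
  then have "\<forall>y \<in> satisfying G d I. p \<bullet> v \<le> p \<bullet> y" using below by (meson order_trans)
  then show ?thesis using v by (auto simp: V_def)
qed

section \<open>Bases\<close>

lemma row_submatrix_dims:
  assumes "B \<subseteq> {..<dim_row G}"
  shows "dim_row (row_submatrix G B) = card B" "dim_col (row_submatrix G B) = dim_col G"
proof -
  have "{i. i < dim_row G \<and> i \<in> B} = B" using assms by auto
  then show "dim_row (row_submatrix G B) = card B" by (simp add: dim_submatrix)
  show "dim_col (row_submatrix G B) = dim_col G" by (simp add: dim_submatrix)
qed

lemma bij_betw_pick:
  assumes "finite B"
  shows "bij_betw (pick B) {..<card B} B"
proof -
  have inj: "inj_on (pick B) {..<card B}"
    by (rule inj_onI) (metis lessThan_iff linorder_neqE_nat order_less_irrefl pick_mono_le)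
  moreover have "pick B ` {..<card B} \<subseteq> B"
    using pick_in_set_le by auto
  ultimately show ?thesis using assms
    by (metis bij_betw_def card_image card_lessThan card_subset_eq)
qed

lemma row_submatrix_mult_vec:
  assumes "B \<subseteq> {..<dim_row G}" "k < card B"
  shows "(row_submatrix G B *\<^sub>v z) $ k = (G *\<^sub>v z) $ pick B k"
proof -
  have e: "{i. i < dim_row G \<and> i \<in> B} = B" using assms by auto
  have "pick B k \<in> B" using assms pick_in_set_le by blast
  then have p: "pick B k < dim_row G" using assms by auto
  have "row (row_submatrix G B) k = row G (pick B k)"
  proof (rule eq_vecI)
    fix j assume j: "j < dim_vec (row G (pick B k))"
    then have "submatrix G B UNIV $$ (k, j) = G $$ (pick B k, pick UNIV j)"
      using assms e by (intro submatrix_index) auto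
    then show "row (row_submatrix G B) k $ j = row G (pick B k) $ j"
      using j assms p row_submatrix_dims[OF assms(1)] by (simp add: pick_UNIV)
  qed (use row_submatrix_dims[OF assms(1)] in simp)
  then show ?thesis using p assms row_submatrix_dims[OF assms(1)] by simp
qed

lemma row_submatrix_solves_iff:
  assumes B: "B \<subseteq> {..<dim_row G}" and "dim_vec d = dim_row G"
  shows "row_submatrix G B *\<^sub>v z = subvec d B \<longleftrightarrow> (\<forall>i\<in>B. (G *\<^sub>v z) $ i = d $ i)"
proof -
  have e: "{i. i < dim_vec d \<and> i \<in> B} = B" using assms by auto
  have fin: "finite B" using B finite_subset by blast
  have "row_submatrix G B *\<^sub>v z = subvec d B \<longleftrightarrow>
      (\<forall>k<card B. (row_submatrix G B *\<^sub>v z) $ k = subvec d B $ k)"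
    using row_submatrix_dims[OF B] by (auto simp: vec_eq_iff subvec_def e)
  also have "\<dots> \<longleftrightarrow> (\<forall>k<card B. (G *\<^sub>v z) $ pick B k = d $ pick B k)"
    using row_submatrix_mult_vec[OF B] by (simp add: subvec_def e)
  also have "\<dots> \<longleftrightarrow> (\<forall>i \<in> pick B ` {..<card B}. (G *\<^sub>v z) $ i = d $ i)" by auto
  finally show ?thesis unfolding bij_betw_imp_surj_on[OF bij_betw_pick[OF fin]] .
qed

text \<open>
  The traces of \<open>X Y\<close> and \<open>Y X\<close> agree.
\<close>

lemma two_sided_inverse_square:
  fixes X Y :: "real mat"
  assumes X: "X \<in> carrier_mat a b" and Y: "Y \<in> carrier_mat b a"
    and XY: "X * Y = 1\<^sub>m a" and YX: "Y * X = 1\<^sub>m b"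
  shows "a = b"
proof -
  have "real a = (\<Sum>i<a. (X * Y) $$ (i, i))" by (simp add: XY)
  also have "\<dots> = (\<Sum>i<a. \<Sum>k<b. X $$ (i, k) * Y $$ (k, i))"
    using X Y by (simp add: scalar_prod_def lessThan_atLeast0)
  also have "\<dots> = (\<Sum>k<b. \<Sum>i<a. Y $$ (k, i) * X $$ (i, k))"
    by (subst sum.swap) (simp add: mult.commute)
  also have "\<dots> = (\<Sum>k<b. (Y * X) $$ (k, k))"
    using X Y by (simp add: scalar_prod_def lessThan_atLeast0)
  also have "\<dots> = real b" by (simp add: YX)
  finally show ?thesis by simp
qed

lemma basis_inverse:
  assumes "is_basis G B"
  obtains Y where "row_submatrix G B \<in> carrier_mat (card B) (dim_col G)"
    "Y \<in> carrier_mat (dim_col G) (card B)"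
    "row_submatrix G B * Y = 1\<^sub>m (card B)" "Y * row_submatrix G B = 1\<^sub>m (dim_col G)"
proof -
  let ?X = "row_submatrix G B"
  have B: "B \<subseteq> {..<dim_row G}" using assms by (simp add: is_basis_def)
  obtain Y where Y: "inverts_mat ?X Y" "inverts_mat Y ?X"
    using assms by (auto simp: is_basis_def invertible_mat_def)
  have dims: "?X \<in> carrier_mat (card B) (dim_col G)" using row_submatrix_dims[OF B] by auto
  have XY: "?X * Y = 1\<^sub>m (card B)" and YX: "Y * ?X = 1\<^sub>m (dim_row Y)"
    using Y dims by (auto simp: inverts_mat_def)
  have Yc: "Y \<in> carrier_mat (dim_col G) (card B)"
  proof
    show "dim_col Y = card B" using XY by (metis index_mult_mat(3) index_one_mat(3))
    show "dim_row Y = dim_col G" using YX dims by (metis carrier_matD(2) index_mult_mat(3) index_one_mat(3))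
  qed
  then show thesis using that[OF dims Yc XY] YX by simp
qed

lemma basis_solution_exists:
  fixes G :: "real mat" and d :: "real vec"
  assumes "is_basis G B"
  shows "\<exists>w \<in> carrier_vec (dim_col G). \<forall>i\<in>B. (G *\<^sub>v w) $ i = d $ i"
proof -
  let ?X = "row_submatrix G B"
  have B: "B \<subseteq> {..<dim_row G}" using assms by (simp add: is_basis_def)
  obtain Y where dims: "?X \<in> carrier_mat (card B) (dim_col G)" and Yc: "Y \<in> carrier_mat (dim_col G) (card B)"
    and XY: "?X * Y = 1\<^sub>m (card B)" by (rule basis_inverse[OF assms])
  define e where "e = vec (dim_row G) (\<lambda>i. d $ i)"
  have de: "dim_vec e = dim_row G" by (simp add: e_def)
  have "{i. i < dim_vec e \<and> i \<in> B} = B" using B by (auto simp: e_def)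
  then have ec: "subvec e B \<in> carrier_vec (card B)" by (simp add: subvec_def)
  have "?X *\<^sub>v (Y *\<^sub>v subvec e B) = (?X * Y) *\<^sub>v subvec e B"
    using assoc_mult_mat_vec[OF dims Yc ec] by simp
  also have "\<dots> = subvec e B" using XY ec by simp
  finally have "\<forall>i\<in>B. (G *\<^sub>v (Y *\<^sub>v subvec e B)) $ i = e $ i"
    using row_submatrix_solves_iff[OF B de] by simp
  moreover have "e $ i = d $ i" if "i \<in> B" for i using that B by (auto simp: e_def)
  moreover have "Y *\<^sub>v subvec e B \<in> carrier_vec (dim_col G)"
    using mult_mat_vec_carrier[OF Yc ec] .
  ultimately show ?thesis by auto
qed

lemma basis_trivial_kernel:
  fixes G :: "real mat"
  assumes "is_basis G B"
  shows "trivial_kernel_on G B"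
  unfolding trivial_kernel_on_def
proof (intro ballI impI)
  fix h assume h: "h \<in> carrier_vec (dim_col G)" "\<forall>i\<in>B. (G *\<^sub>v h) $ i = 0"
  let ?X = "row_submatrix G B"
  have B: "B \<subseteq> {..<dim_row G}" using assms by (simp add: is_basis_def)
  obtain Y where dims: "?X \<in> carrier_mat (card B) (dim_col G)" and Yc: "Y \<in> carrier_mat (dim_col G) (card B)"
    and YX: "Y * ?X = 1\<^sub>m (dim_col G)" by (rule basis_inverse[OF assms])
  have "pick B k \<in> B" if "k < card B" for k using that pick_in_set_le by blast
  then have "?X *\<^sub>v h = 0\<^sub>v (card B)"
    using dims h(2) row_submatrix_mult_vec[OF B] by (intro eq_vecI) auto
  then have "(Y * ?X) *\<^sub>v h = 0\<^sub>v (dim_col G)"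
    using assoc_mult_mat_vec[OF Yc dims h(1)] Yc by auto
  then show "h = 0\<^sub>v (dim_col G)" using YX Yc h(1) by auto
qed

lemma basis_basic_solution:
  assumes bas: "is_basis G B" and d: "dim_vec d = dim_row G" and z: "z \<in> carrier_vec (dim_col G)"
    and eq: "\<And>i. i \<in> B \<Longrightarrow> (G *\<^sub>v z) $ i = d $ i"
  shows "basic_solution G B d = z"
  unfolding basic_solution_def
proof (rule the_equality)
  have B: "B \<subseteq> {..<dim_row G}" using bas by (simp add: is_basis_def)
  show "z \<in> carrier_vec (dim_col G) \<and> row_submatrix G B *\<^sub>v z = subvec d B"
    using z eq row_submatrix_solves_iff[OF B d] by blast
  fix y assume "y \<in> carrier_vec (dim_col G) \<and> row_submatrix G B *\<^sub>v y = subvec d B"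
  then show "y = z"
    using row_submatrix_solves_iff[OF B d] eq z
    by (intro trivial_kernel_on_unique[OF basis_trivial_kernel[OF bas] B]) auto
qed

text \<open>
  A minimal set of rows with trivial kernel is a basis: by minimality, each of its rows takes
  the value 1 at a vector that all the other rows annihilate. These vectors are the columns of a
  right inverse, which is a left inverse too because the kernel is trivial.
\<close>

lemma basis_in_trivial_kernel:
  fixes G :: "real mat"
  assumes ker: "trivial_kernel_on G I" and I: "I \<subseteq> {..<dim_row G}"
  shows "\<exists>B \<subseteq> I. is_basis G B"
proof -
  have finI: "finite I" using I finite_subset by blast
  have "finite {B. B \<subseteq> I \<and> trivial_kernel_on G B}" using finI by simp
  moreover have "I \<in> {B. B \<subseteq> I \<and> trivial_kernel_on G B}" using ker by simp
  ultimately obtain B where B: "B \<subseteq> I" "trivial_kernel_on G B"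
    and min: "\<And>C. C \<subseteq> B \<Longrightarrow> trivial_kernel_on G C \<Longrightarrow> C = B"
    using finite_has_minimal2[of "{B. B \<subseteq> I \<and> trivial_kernel_on G B}" I] by (metis (no_types, lifting) mem_Collect_eq order_trans)
  have Br: "B \<subseteq> {..<dim_row G}" using B I by auto
  have finB: "finite B" using B finI finite_subset by blast
  let ?X = "row_submatrix G B" and ?D = "dim_col G" and ?b = "card B"
  have dims: "?X \<in> carrier_mat ?b ?D" using row_submatrix_dims[OF Br] by auto
  have ex: "\<exists>h. h \<in> carrier_vec ?D \<and> (\<forall>i\<in>B. (G *\<^sub>v h) $ i = (if i = k then 1 else 0))" if k: "k \<in> B" for k
  proof -
    have "\<not> trivial_kernel_on G (B - {k})" using min[of "B - {k}"] k by blast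
    then obtain h where h: "h \<in> carrier_vec ?D" "h \<noteq> 0\<^sub>v ?D" "\<And>i. i \<in> B \<Longrightarrow> i \<noteq> k \<Longrightarrow> (G *\<^sub>v h) $ i = 0"
      unfolding trivial_kernel_on_def by blast
    have nz: "(G *\<^sub>v h) $ k \<noteq> 0" using B(2) h unfolding trivial_kernel_on_def by metis
    define g where "g = (1 / (G *\<^sub>v h) $ k) \<cdot>\<^sub>v h"
    have "(G *\<^sub>v g) $ i = 1 / (G *\<^sub>v h) $ k * (G *\<^sub>v h) $ i" if "i \<in> B" for i
      using that Br h(1) by (auto simp: g_def)
    then have "\<forall>i\<in>B. (G *\<^sub>v g) $ i = (if i = k then 1 else 0)" using nz h(3) by auto
    then show ?thesis using h(1) by (intro exI[of _ g]) (simp add: g_def)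
  qed
  obtain f where f: "\<And>k. k \<in> B \<Longrightarrow> f k \<in> carrier_vec ?D"
      "\<And>k i. k \<in> B \<Longrightarrow> i \<in> B \<Longrightarrow> (G *\<^sub>v f k) $ i = (if i = k then 1 else 0)"
    using ex by metis
  have pB: "pick B k \<in> B" if "k < ?b" for k using that pick_in_set_le by blast
  have pinj: "pick B i = pick B k \<longleftrightarrow> i = k" if "i < ?b" "k < ?b" for i k
    using bij_betw_pick[OF finB] that by (auto simp: bij_betw_def inj_on_def)
  define Y where "Y = mat ?D ?b (\<lambda>(r, k). f (pick B k) $ r)"
  have Yc: "Y \<in> carrier_mat ?D ?b" by (simp add: Y_def)
  have colY: "col Y k = f (pick B k)" if "k < ?b" for k
    using that f(1)[OF pB[OF that]] by (intro eq_vecI) (auto simp: Y_def)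
  have XY: "?X * Y = 1\<^sub>m ?b"
  proof (rule eq_matI)
    fix i k assume "i < dim_row (1\<^sub>m ?b)" "k < dim_col (1\<^sub>m ?b)"
    then have ik: "i < ?b" "k < ?b" by auto
    have "(?X * Y) $$ (i, k) = (?X *\<^sub>v col Y k) $ i" using ik dims Yc by auto
    also have "\<dots> = (G *\<^sub>v f (pick B k)) $ pick B i"
      using row_submatrix_mult_vec[OF Br ik(1)] colY[OF ik(2)] by simp
    also have "\<dots> = 1\<^sub>m ?b $$ (i, k)" using f(2) pB ik pinj by simp
    finally show "(?X * Y) $$ (i, k) = 1\<^sub>m ?b $$ (i, k)" .
  qed (use dims Yc in auto)
  have Xker: "h = 0\<^sub>v ?D" if h: "h \<in> carrier_vec ?D" "?X *\<^sub>v h = 0\<^sub>v ?b" for h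
  proof -
    have "(G *\<^sub>v h) $ i = 0" if i: "i \<in> B" for i
    proof -
      obtain k where "k < ?b" "i = pick B k"
        using bij_betw_pick[OF finB] i by (auto simp: bij_betw_def image_iff)
      then show ?thesis using row_submatrix_mult_vec[OF Br, of k h] h(2) by simp
    qed
    then show ?thesis using B(2) h(1) unfolding trivial_kernel_on_def by blast
  qed
  have YX: "Y * ?X = 1\<^sub>m ?D"
  proof (rule eq_matI)
    fix i k assume "i < dim_row (1\<^sub>m ?D)" "k < dim_col (1\<^sub>m ?D)"
    then have ik: "i < ?D" "k < ?D" by auto
    let ?e = "unit_vec ?D k :: real vec"
    have ec: "?e \<in> carrier_vec ?D" by simp
    have X1: "?X *\<^sub>v ?e \<in> carrier_vec ?b" using mult_mat_vec_carrier[OF dims ec] .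
    have X2: "Y *\<^sub>v (?X *\<^sub>v ?e) \<in> carrier_vec ?D" using mult_mat_vec_carrier[OF Yc X1] .
    have c: "Y *\<^sub>v (?X *\<^sub>v ?e) - ?e \<in> carrier_vec ?D" using X2 by auto
    have "?X *\<^sub>v (Y *\<^sub>v (?X *\<^sub>v ?e)) = (?X * Y) *\<^sub>v (?X *\<^sub>v ?e)"
      using assoc_mult_mat_vec[OF dims Yc X1] by simp
    also have "\<dots> = ?X *\<^sub>v ?e" using XY X1 by simp
    finally have "?X *\<^sub>v (Y *\<^sub>v (?X *\<^sub>v ?e) - ?e) = 0\<^sub>v ?b"
      using mult_minus_distrib_mat_vec[OF dims X2 ec] X1 by simp
    then have z: "Y *\<^sub>v (?X *\<^sub>v ?e) - ?e = 0\<^sub>v ?D" using Xker c by blast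
    have "(Y *\<^sub>v (?X *\<^sub>v ?e)) $ i - ?e $ i = 0"
      using arg_cong[OF z, of "\<lambda>v. v $ i"] ik by simp
    moreover have "(Y *\<^sub>v (?X *\<^sub>v ?e)) $ i = (Y * ?X) $$ (i, k)"
    proof -
      have "(Y *\<^sub>v (?X *\<^sub>v ?e)) $ i = ((Y * ?X) *\<^sub>v ?e) $ i"
        using assoc_mult_mat_vec[OF Yc dims ec] by simp
      also have "\<dots> = row (Y * ?X) i $ k"
        using ik Yc dims by (subst index_mult_mat_vec) auto
      also have "\<dots> = (Y * ?X) $$ (i, k)" using ik Yc dims by (subst index_row) auto
      finally show ?thesis .
    qed
    ultimately show "(Y * ?X) $$ (i, k) = 1\<^sub>m ?D $$ (i, k)" using ik by auto
  qed (use dims Yc in auto)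
  have "?b = ?D" using two_sided_inverse_square[OF dims Yc XY YX] .
  then have "invertible_mat ?X"
    using dims Yc XY YX unfolding invertible_mat_def inverts_mat_def by auto
  then have "is_basis G B" using Br by (simp add: is_basis_def)
  then show ?thesis using B by blast
qed

section \<open>Symmetric matrices and their eigenvalues\<close>

lemma eucl_norm_L2_set: "eucl_norm v = L2_set (\<lambda>i. v $ i) {..<dim_vec v}"
  by (simp add: eucl_norm_def L2_set_def scalar_prod_def lessThan_atLeast0 power2_eq_square)

lemma eucl_norm_nonneg [simp]: "0 \<le> eucl_norm v"
  by (simp add: eucl_norm_L2_set)

lemma eucl_norm_power2: "(eucl_norm v)\<^sup>2 = v \<bullet> v"
proof -
  have "0 \<le> v \<bullet> v" by (auto simp: scalar_prod_def intro!: sum_nonneg)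
  then show ?thesis by (simp add: eucl_norm_def)
qed

lemma eucl_norm_triangle:
  assumes "u \<in> carrier_vec n" "v \<in> carrier_vec n"
  shows "eucl_norm (u + v) \<le> eucl_norm u + eucl_norm v"
proof -
  have "eucl_norm (u + v) = L2_set (\<lambda>i. u $ i + v $ i) {..<n}"
    using assms by (auto simp: eucl_norm_L2_set intro!: L2_set_cong)
  also have "\<dots> \<le> L2_set (\<lambda>i. u $ i) {..<n} + L2_set (\<lambda>i. v $ i) {..<n}"
    by (rule L2_set_triangle_ineq)
  finally show ?thesis using assms by (simp add: eucl_norm_L2_set)
qed

lemma eucl_norm_smult: "eucl_norm (t \<cdot>\<^sub>v v) = \<bar>t\<bar> * eucl_norm v"
proof -
  have "eucl_norm (t \<cdot>\<^sub>v v) = sqrt (t\<^sup>2 * (v \<bullet> v))"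
    by (simp add: eucl_norm_def power2_eq_square ac_simps)
  then show ?thesis by (simp add: real_sqrt_mult eucl_norm_def)
qed

lemma scalar_prod_le_eucl_norm:
  assumes "u \<in> carrier_vec n" "v \<in> carrier_vec n"
  shows "\<bar>u \<bullet> v\<bar> \<le> eucl_norm u * eucl_norm v"
proof -
  have "\<bar>u \<bullet> v\<bar> \<le> (\<Sum>i<n. \<bar>u $ i\<bar> * \<bar>v $ i\<bar>)"
    using assms sum_abs[of "\<lambda>i. u $ i * v $ i" "{..<n}"]
    by (simp add: scalar_prod_def lessThan_atLeast0 abs_mult)
  also have "\<dots> \<le> L2_set (\<lambda>i. u $ i) {..<n} * L2_set (\<lambda>i. v $ i) {..<n}"
    by (rule L2_set_mult_ineq)
  finally show ?thesis using assms by (simp add: eucl_norm_L2_set)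
qed

lemma eucl_norm_eq_0:
  assumes "v \<in> carrier_vec n"
  shows "eucl_norm v = 0 \<longleftrightarrow> v = 0\<^sub>v n"
  using assms by (auto simp: eucl_norm_L2_set L2_set_eq_0_iff vec_eq_iff)

lemma eucl_norm_le_sum_abs: "eucl_norm v \<le> (\<Sum>i<dim_vec v. \<bar>v $ i\<bar>)"
  unfolding eucl_norm_L2_set by (rule L2_set_le_sum_abs)

lemma mat_bounded:
  fixes M :: "real mat"
  assumes M: "M \<in> carrier_mat a b"
  shows "\<exists>k>0. \<forall>x \<in> carrier_vec b. eucl_norm (M *\<^sub>v x) \<le> k * eucl_norm x"
proof (intro exI conjI ballI)
  let ?k = "1 + (\<Sum>i<a. eucl_norm (row M i))"
  show "0 < ?k" by (simp add: add_pos_nonneg sum_nonneg)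
  fix x :: "real vec" assume x: "x \<in> carrier_vec b"
  have "eucl_norm (M *\<^sub>v x) \<le> (\<Sum>i<a. \<bar>row M i \<bullet> x\<bar>)"
    using eucl_norm_le_sum_abs[of "M *\<^sub>v x"] M by simp
  also have "\<dots> \<le> (\<Sum>i<a. eucl_norm (row M i) * eucl_norm x)"
    using M x by (intro sum_mono scalar_prod_le_eucl_norm) auto
  also have "\<dots> \<le> ?k * eucl_norm x" unfolding distrib_right sum_distrib_right by simp
  finally show "eucl_norm (M *\<^sub>v x) \<le> ?k * eucl_norm x" .
qed

lemma symmetric_scalar_prod:
  fixes R :: "real mat"
  assumes "R \<in> carrier_mat n n" "R\<^sup>T = R" "x \<in> carrier_vec n" "y \<in> carrier_vec n"
  shows "x \<bullet> (R *\<^sub>v y) = (R *\<^sub>v x) \<bullet> y"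
  using transpose_vec_mult_scalar[of R n n y x] assms by simp

lemma transpose_smult_mat: "(c \<cdot>\<^sub>m A)\<^sup>T = c \<cdot>\<^sub>m A\<^sup>T"
  by (intro eq_matI) auto

text \<open>
  If \<open>k\<close> bounds the norm of \<open>Q\<close>, then evaluating the form at \<open>x - Q x / k\<close> gives
  \<open>\<bar>Q x\<bar>\<^sup>2 \<le> k (x \<bullet> Q x)\<close>, and \<open>Q\<close> has a bounded inverse.
\<close>

lemma psd_nonsingular_definite:
  fixes Q :: "real mat"
  assumes Q: "Q \<in> carrier_mat n n" and sym: "Q\<^sup>T = Q"
    and psd: "\<And>x. x \<in> carrier_vec n \<Longrightarrow> 0 \<le> x \<bullet> (Q *\<^sub>v x)"
    and det: "det Q \<noteq> 0"
  shows "\<exists>c>0. \<forall>x \<in> carrier_vec n. c * (x \<bullet> x) \<le> x \<bullet> (Q *\<^sub>v x)"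
proof -
  obtain P where P: "P \<in> carrier_mat n n" and PQ: "P * Q = 1\<^sub>m n"
    using det_non_zero_imp_unit[OF Q det, of "()"] by (auto simp: Units_def ring_mat_def)
  obtain k where k: "k > 0" "\<And>x. x \<in> carrier_vec n \<Longrightarrow> eucl_norm (Q *\<^sub>v x) \<le> k * eucl_norm x"
    using mat_bounded[OF Q] by blast
  obtain l where l: "l > 0" "\<And>x. x \<in> carrier_vec n \<Longrightarrow> eucl_norm (P *\<^sub>v x) \<le> l * eucl_norm x"
    using mat_bounded[OF P] by blast
  have "1 / (l\<^sup>2 * k) * (x \<bullet> x) \<le> x \<bullet> (Q *\<^sub>v x)" if x: "x \<in> carrier_vec n" for x
  proof -
    let ?y = "Q *\<^sub>v x" and ?s = "1 / k"
    have y: "?y \<in> carrier_vec n" using mult_mat_vec_carrier[OF Q x] .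
    have Qy: "Q *\<^sub>v ?y \<in> carrier_vec n" using mult_mat_vec_carrier[OF Q y] .
    have "\<bar>?y \<bullet> (Q *\<^sub>v ?y)\<bar> \<le> eucl_norm ?y * (k * eucl_norm ?y)"
      using scalar_prod_le_eucl_norm[OF y Qy] k(2)[OF y]
      by (meson eucl_norm_nonneg mult_left_mono order_trans)
    then have yQy: "?y \<bullet> (Q *\<^sub>v ?y) \<le> k * (?y \<bullet> ?y)"
      by (simp add: eucl_norm_power2[symmetric] power2_eq_square ac_simps)
    define z where "z = x + (- ?s) \<cdot>\<^sub>v ?y"
    have z: "z \<in> carrier_vec n" using x y by (simp add: z_def)
    have Qz: "Q *\<^sub>v z = ?y + (- ?s) \<cdot>\<^sub>v (Q *\<^sub>v ?y)"
      using Q x y by (simp add: z_def mult_add_distrib_mat_vec[of _ n n] mult_mat_vec[of _ n n])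
    have xQy: "x \<bullet> (Q *\<^sub>v ?y) = ?y \<bullet> ?y" using symmetric_scalar_prod[OF Q sym x y] .
    have "z \<bullet> (Q *\<^sub>v z) = z \<bullet> ?y + (- ?s) * (z \<bullet> (Q *\<^sub>v ?y))"
      unfolding Qz by (rule scalar_prod_line[OF z y Qy])
    also have "z \<bullet> ?y = x \<bullet> ?y + (- ?s) * (?y \<bullet> ?y)"
      using x y by (simp add: z_def add_scalar_prod_distrib[of _ n])
    also have "z \<bullet> (Q *\<^sub>v ?y) = ?y \<bullet> ?y + (- ?s) * (?y \<bullet> (Q *\<^sub>v ?y))"
      using x y Qy xQy by (simp add: z_def add_scalar_prod_distrib[of _ n])
    finally have "z \<bullet> (Q *\<^sub>v z) = x \<bullet> ?y - 2 * ?s * (?y \<bullet> ?y) + ?s * (?s * (?y \<bullet> (Q *\<^sub>v ?y)))"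
      by (simp add: algebra_simps)
    also have "?s * (?s * (?y \<bullet> (Q *\<^sub>v ?y))) \<le> ?s * (?s * (k * (?y \<bullet> ?y)))"
      using yQy k(1) by (intro mult_left_mono) auto
    also have "?s * (?s * (k * (?y \<bullet> ?y))) = ?s * (?y \<bullet> ?y)" using k(1) by simp
    finally have "?s * (?y \<bullet> ?y) \<le> x \<bullet> ?y" using psd[OF z] by simp
    moreover have "x \<bullet> x \<le> l\<^sup>2 * (?y \<bullet> ?y)"
    proof -
      have "P *\<^sub>v ?y = x" using assoc_mult_mat_vec[OF P Q x] PQ x by simp
      then have "eucl_norm x \<le> l * eucl_norm ?y" using l(2)[OF y] by simp
      then have "(eucl_norm x)\<^sup>2 \<le> (l * eucl_norm ?y)\<^sup>2" by (rule power_mono) simp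
      then show ?thesis by (simp add: power_mult_distrib eucl_norm_power2)
    qed
    then have "1 / (l\<^sup>2 * k) * (x \<bullet> x) \<le> ?s * (?y \<bullet> ?y)"
      using k(1) l(1) by (simp add: field_simps)
    ultimately show ?thesis by linarith
  qed
  moreover have "1 / (l\<^sup>2 * k) > 0" using k l by simp
  ultimately show ?thesis by blast
qed

text \<open>
  Let \<open>\<mu>\<close> be the operator norm of \<open>R\<close>. The form of \<open>Q = \<mu>\<^sup>2 - R\<^sup>2\<close> is positive
  semidefinite. If \<open>Q\<close> were nonsingular, it would be positive definite, and \<open>\<mu>\<close> could be
  decreased. So there is \<open>x \<noteq> 0\<close> with \<open>(R - \<mu>) (R + \<mu>) x = 0\<close>, and either \<open>x\<close> or
  \<open>(R + \<mu>) x\<close> is an eigenvector.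
\<close>

lemma symmetric_norm_eigenvalue:
  fixes R :: "real mat"
  assumes R: "R \<in> carrier_mat n n" and sym: "R\<^sup>T = R" and n: "0 < n"
  shows "\<exists>\<mu>\<ge>0. (eigenvalue R \<mu> \<or> eigenvalue R (- \<mu>)) \<and>
           (\<forall>x \<in> carrier_vec n. eucl_norm (R *\<^sub>v x) \<le> \<mu> * eucl_norm x)"
proof -
  define S where "S = {eucl_norm (R *\<^sub>v x) | x. x \<in> carrier_vec n \<and> eucl_norm x = 1}"
  define \<mu> where "\<mu> = Sup S"
  have "unit_vec n 0 \<in> carrier_vec n" "eucl_norm (unit_vec n 0) = 1"
    using n by (auto simp: eucl_norm_def)
  then have ne: "S \<noteq> {}" unfolding S_def by blast
  obtain k where k: "\<And>x. x \<in> carrier_vec n \<Longrightarrow> eucl_norm (R *\<^sub>v x) \<le> k * eucl_norm x"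
    using mat_bounded[OF R] by blast
  have bdd: "bdd_above S" using k by (force simp: S_def intro!: bdd_aboveI[of _ k])
  have norm: "eucl_norm (R *\<^sub>v x) \<le> \<mu> * eucl_norm x" if x: "x \<in> carrier_vec n" for x
  proof (cases "eucl_norm x = 0")
    case True
    then show ?thesis using k[OF x] by simp
  next
    case False
    then have pos: "eucl_norm x > 0" using eucl_norm_nonneg[of x] by linarith
    let ?u = "(1 / eucl_norm x) \<cdot>\<^sub>v x"
    have "eucl_norm (R *\<^sub>v ?u) \<in> S" using x pos by (auto simp: S_def eucl_norm_smult)
    then have "eucl_norm (R *\<^sub>v ?u) \<le> \<mu>" unfolding \<mu>_def by (rule cSup_upper[OF _ bdd])
    moreover have "R *\<^sub>v ?u = (1 / eucl_norm x) \<cdot>\<^sub>v (R *\<^sub>v x)" using R x by (simp add: mult_mat_vec)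
    ultimately show ?thesis using pos by (simp add: eucl_norm_smult field_simps)
  qed
  have \<mu>0: "\<mu> \<ge> 0"
  proof -
    obtain s where s: "s \<in> S" using ne by blast
    have "s \<le> \<mu>" unfolding \<mu>_def by (rule cSup_upper[OF s bdd])
    moreover have "0 \<le> s" using s by (auto simp: S_def)
    ultimately show ?thesis by linarith
  qed
  define Q where "Q = \<mu>\<^sup>2 \<cdot>\<^sub>m 1\<^sub>m n - R * R"
  have Q: "Q \<in> carrier_mat n n"
    using minus_carrier_mat[OF mult_carrier_mat[OF R R]] by (simp add: Q_def)
  have RR: "R * R \<in> carrier_mat n n" using R by simp
  have "(R * R)\<^sup>T = R * R" using transpose_mult[OF R R] sym by simp
  then have Qsym: "Q\<^sup>T = Q"
    using R RR by (simp add: Q_def transpose_minus[of _ n n] transpose_smult_mat)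
  have Qx: "Q *\<^sub>v x = \<mu>\<^sup>2 \<cdot>\<^sub>v x - R *\<^sub>v (R *\<^sub>v x)" if "x \<in> carrier_vec n" for x
  proof -
    have "Q *\<^sub>v x = (\<mu>\<^sup>2 \<cdot>\<^sub>m 1\<^sub>m n) *\<^sub>v x - (R * R) *\<^sub>v x"
      unfolding Q_def using that R by (intro minus_mult_distrib_mat_vec) auto
    also have "(\<mu>\<^sup>2 \<cdot>\<^sub>m 1\<^sub>m n) *\<^sub>v x = \<mu>\<^sup>2 \<cdot>\<^sub>v x" using that by auto
    finally show ?thesis using assoc_mult_mat_vec[OF R R that] by simp
  qed
  have xQx: "x \<bullet> (Q *\<^sub>v x) = \<mu>\<^sup>2 * (x \<bullet> x) - (R *\<^sub>v x) \<bullet> (R *\<^sub>v x)" if x: "x \<in> carrier_vec n" for x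
  proof -
    have y: "R *\<^sub>v x \<in> carrier_vec n" using mult_mat_vec_carrier[OF R x] .
    have "R *\<^sub>v (R *\<^sub>v x) \<in> carrier_vec n" using mult_mat_vec_carrier[OF R y] .
    then show ?thesis
      unfolding Qx[OF x] using x symmetric_scalar_prod[OF R sym x y]
      by (simp add: scalar_prod_minus_distrib[of _ n])
  qed
  have psd: "0 \<le> x \<bullet> (Q *\<^sub>v x)" if x: "x \<in> carrier_vec n" for x
  proof -
    have "(eucl_norm (R *\<^sub>v x))\<^sup>2 \<le> (\<mu> * eucl_norm x)\<^sup>2" by (rule power_mono[OF norm[OF x]]) simp
    then show ?thesis by (simp add: xQx[OF x] power_mult_distrib eucl_norm_power2)
  qed
  have "det Q = 0"
  proof (rule ccontr)
    assume "det Q \<noteq> 0"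
    then obtain c where c: "c > 0" "\<And>x. x \<in> carrier_vec n \<Longrightarrow> c * (x \<bullet> x) \<le> x \<bullet> (Q *\<^sub>v x)"
      using psd_nonsingular_definite[OF Q Qsym psd] by blast
    have s2: "s\<^sup>2 \<le> \<mu>\<^sup>2 - c" if s: "s \<in> S" for s
    proof -
      obtain x where x: "x \<in> carrier_vec n" "eucl_norm x = 1" "s = eucl_norm (R *\<^sub>v x)"
        using s unfolding S_def by blast
      have "x \<bullet> x = 1" using x(2) eucl_norm_power2[of x] by simp
      then show ?thesis using c(2)[OF x(1)] xQx[OF x(1)] by (simp add: x(3) eucl_norm_power2)
    qed
    have "\<mu> \<le> sqrt (\<mu>\<^sup>2 - c)"
      unfolding \<mu>_def by (rule cSup_least[OF ne]) (use s2 in \<open>auto simp: \<mu>_def intro: real_le_rsqrt\<close>)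
    moreover have "0 \<le> \<mu>\<^sup>2 - c" using s2 ne by (metis all_not_in_conv order_trans zero_le_power2)
    ultimately have "\<mu>\<^sup>2 \<le> \<mu>\<^sup>2 - c" using \<mu>0 by (metis power_mono real_sqrt_pow2)
    then show False using c(1) by simp
  qed
  then obtain x where x: "x \<in> carrier_vec n" "x \<noteq> 0\<^sub>v n" "Q *\<^sub>v x = 0\<^sub>v n"
    using det_0_iff_vec_prod_zero[OF Q] by blast
  let ?y = "R *\<^sub>v x"
  have y: "?y \<in> carrier_vec n" using mult_mat_vec_carrier[OF R x(1)] .
  have Ry: "R *\<^sub>v ?y \<in> carrier_vec n" using mult_mat_vec_carrier[OF R y] .
  have RRx: "R *\<^sub>v ?y = \<mu>\<^sup>2 \<cdot>\<^sub>v x"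
  proof (rule eq_vecI)
    fix i assume "i < dim_vec (\<mu>\<^sup>2 \<cdot>\<^sub>v x)"
    then have i: "i < n" using x(1) by simp
    have "(Q *\<^sub>v x) $ i = 0" using x(3) i by simp
    then show "(R *\<^sub>v ?y) $ i = (\<mu>\<^sup>2 \<cdot>\<^sub>v x) $ i"
      unfolding Qx[OF x(1)] using i x(1) Ry
      by (metis carrier_vecD eq_iff_diff_eq_0 index_minus_vec(1))
  qed (use x Ry R in auto)
  have "eigenvalue R \<mu> \<or> eigenvalue R (- \<mu>)"
  proof (cases "?y + \<mu> \<cdot>\<^sub>v x = 0\<^sub>v n")
    case True
    have "?y = (- \<mu>) \<cdot>\<^sub>v x"
    proof (rule eq_vecI)
      fix i assume "i < dim_vec ((- \<mu>) \<cdot>\<^sub>v x)"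
      then have i: "i < n" using x(1) by simp
      have "(?y + \<mu> \<cdot>\<^sub>v x) $ i = 0" using True i by simp
      then have "?y $ i + \<mu> * x $ i = 0" using i x(1) y by (metis carrier_vecD index_add_vec(1) index_smult_vec(1) index_smult_vec(2))
      then show "?y $ i = ((- \<mu>) \<cdot>\<^sub>v x) $ i" using i x(1) by simp
    qed (use x y R in auto)
    then have "eigenvector R x (- \<mu>)" using x R by (auto simp: eigenvector_def)
    then show ?thesis by (auto simp: eigenvalue_def)
  next
    case False
    have "R *\<^sub>v (?y + \<mu> \<cdot>\<^sub>v x) = R *\<^sub>v ?y + \<mu> \<cdot>\<^sub>v ?y"
      using R x(1) y by (simp add: mult_add_distrib_mat_vec[of _ n n] mult_mat_vec[of _ n n])
    also have "\<dots> = \<mu> \<cdot>\<^sub>v (?y + \<mu> \<cdot>\<^sub>v x)"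
    proof -
      have "\<mu>\<^sup>2 \<cdot>\<^sub>v x + \<mu> \<cdot>\<^sub>v u = \<mu> \<cdot>\<^sub>v (u + \<mu> \<cdot>\<^sub>v x)" if "u \<in> carrier_vec n" for u
        using x(1) that by (intro eq_vecI) (auto simp: algebra_simps power2_eq_square)
      from this[OF y] show ?thesis unfolding RRx .
    qed
    finally have "eigenvector R (?y + \<mu> \<cdot>\<^sub>v x) \<mu>"
      using False x(1) y R by (auto simp: eigenvector_def)
    then show ?thesis by (auto simp: eigenvalue_def)
  qed
  then show ?thesis using \<mu>0 norm by blast
qed

lemma finite_eigenvalues:
  fixes H :: "real mat"
  assumes "H \<in> carrier_mat n n"
  shows "finite {e. eigenvalue H e}"
proof -
  have "char_poly H \<noteq> 0" using degree_monic_char_poly[OF assms] by auto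
  then have "finite {e. poly (char_poly H) e = 0}" by (rule poly_roots_finite)
  then show ?thesis using eigenvalue_root_char_poly[OF assms] by simp
qed

section \<open>Singular values of the optimal bases\<close>

definition gram :: "real mat \<Rightarrow> nat set \<Rightarrow> real mat" where
  "gram G B = (row_submatrix G B)\<^sup>T * row_submatrix G B"

lemma row_submatrix_carrier:
  "row_submatrix G B \<in> carrier_mat (dim_row (row_submatrix G B)) (dim_col G)"
  by (rule carrier_matI) (simp_all add: dim_submatrix(2))

lemma gram_carrier [simp]: "gram G B \<in> carrier_mat (dim_col G) (dim_col G)"
  unfolding gram_def
  by (rule mult_carrier_mat[OF transpose_carrier_mat[THEN iffD2] row_submatrix_carrier])
    (rule row_submatrix_carrier)

lemma gram_dims [simp]: "dim_row (gram G B) = dim_col G" "dim_col (gram G B) = dim_col G"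
  using carrier_matD[OF gram_carrier[of G B]] by auto

lemma gram_symmetric: "(gram G B)\<^sup>T = gram G B"
proof -
  let ?X = "row_submatrix G B"
  have X: "?X \<in> carrier_mat (dim_row ?X) (dim_col G)" by (rule row_submatrix_carrier)
  then have Xt: "?X\<^sup>T \<in> carrier_mat (dim_col G) (dim_row ?X)" by (rule transpose_carrier_mat[THEN iffD2])
  show ?thesis unfolding gram_def transpose_mult[OF Xt X] by (simp only: transpose_transpose)
qed

lemma gram_mult_vec:
  assumes B: "B \<subseteq> {..<dim_row G}" and x: "x \<in> carrier_vec (dim_col G)" and c: "c < dim_col G"
  shows "(gram G B *\<^sub>v x) $ c = (\<Sum>i\<in>B. G $$ (i, c) * (G *\<^sub>v x) $ i)"
proof -
  let ?X = "row_submatrix G B"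
  have X: "?X \<in> carrier_mat (card B) (dim_col G)" using row_submatrix_dims[OF B] by auto
  have fin: "finite B" using B finite_subset by blast
  have e: "{i. i < dim_row G \<and> i \<in> B} = B" using B by auto
  have "(gram G B *\<^sub>v x) $ c = (?X\<^sup>T *\<^sub>v (?X *\<^sub>v x)) $ c"
    unfolding gram_def using X x by (subst assoc_mult_mat_vec[of _ "dim_col G" "card B"]) auto
  also have "\<dots> = (\<Sum>k<card B. ?X $$ (k, c) * (?X *\<^sub>v x) $ k)"
    using X c by (simp add: scalar_prod_def lessThan_atLeast0)
  also have "\<dots> = (\<Sum>k<card B. G $$ (pick B k, c) * (G *\<^sub>v x) $ pick B k)"
  proof (rule sum.cong)
    fix k assume k: "k \<in> {..<card B}"
    have "?X $$ (k, c) = G $$ (pick B k, pick UNIV c)"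
      using k c e by (intro submatrix_index) auto
    then show "?X $$ (k, c) * (?X *\<^sub>v x) $ k = G $$ (pick B k, c) * (G *\<^sub>v x) $ pick B k"
      using row_submatrix_mult_vec[OF B] k by (simp add: pick_UNIV)
  qed simp
  also have "\<dots> = (\<Sum>i\<in>B. G $$ (i, c) * (G *\<^sub>v x) $ i)"
    by (rule sum.reindex_bij_betw[OF bij_betw_pick[OF fin]])
  finally show ?thesis .
qed

lemma gram_quadratic_form:
  assumes B: "B \<subseteq> {..<dim_row G}" and x: "x \<in> carrier_vec (dim_col G)"
  shows "x \<bullet> (gram G B *\<^sub>v x) = (\<Sum>i\<in>B. ((G *\<^sub>v x) $ i)\<^sup>2)"
proof -
  have "x \<bullet> (gram G B *\<^sub>v x) = (\<Sum>c<dim_col G. x $ c * (gram G B *\<^sub>v x) $ c)"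
    using carrier_matD[OF gram_carrier[of G B]]
    by (simp add: scalar_prod_def lessThan_atLeast0 del: index_mult_mat_vec)
  also have "\<dots> = (\<Sum>c<dim_col G. \<Sum>i\<in>B. x $ c * (G $$ (i, c) * (G *\<^sub>v x) $ i))"
    by (intro sum.cong refl) (simp add: gram_mult_vec[OF B x] sum_distrib_left del: index_mult_mat_vec)
  also have "\<dots> = (\<Sum>i\<in>B. \<Sum>c<dim_col G. x $ c * (G $$ (i, c) * (G *\<^sub>v x) $ i))"
    by (rule sum.swap)
  also have "\<dots> = (\<Sum>i\<in>B. ((G *\<^sub>v x) $ i)\<^sup>2)"
  proof (rule sum.cong)
    fix i assume "i \<in> B"
    then have i: "i < dim_row G" using B by auto
    have "(\<Sum>c<dim_col G. x $ c * (G $$ (i, c) * (G *\<^sub>v x) $ i)) =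
        (\<Sum>c<dim_col G. G $$ (i, c) * x $ c) * (G *\<^sub>v x) $ i"
      by (simp add: sum_distrib_left ac_simps)
    also have "(\<Sum>c<dim_col G. G $$ (i, c) * x $ c) = (G *\<^sub>v x) $ i"
      using i x by (simp add: scalar_prod_def lessThan_atLeast0)
    finally show "(\<Sum>c<dim_col G. x $ c * (G $$ (i, c) * (G *\<^sub>v x) $ i)) = ((G *\<^sub>v x) $ i)\<^sup>2"
      by (simp add: power2_eq_square)
  qed simp
  finally show ?thesis .
qed

lemma gram_eigenvalue_pos:
  assumes bas: "is_basis G B" and e: "eigenvalue (gram G B) e"
  shows "0 < e"
proof -
  have B: "B \<subseteq> {..<dim_row G}" using bas by (simp add: is_basis_def)
  have fin: "finite B" using B finite_subset by blast
  obtain v where v: "v \<in> carrier_vec (dim_col G)" "v \<noteq> 0\<^sub>v (dim_col G)" "gram G B *\<^sub>v v = e \<cdot>\<^sub>v v"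
    using e gram_carrier[of G B] by (auto simp: eigenvalue_def eigenvector_def)
  have "e * (v \<bullet> v) = (\<Sum>i\<in>B. ((G *\<^sub>v v) $ i)\<^sup>2)"
    using gram_quadratic_form[OF B v(1)] v by simp
  moreover have "\<exists>i\<in>B. (G *\<^sub>v v) $ i \<noteq> 0"
    using basis_trivial_kernel[OF bas] v unfolding trivial_kernel_on_def by blast
  then have "0 < (\<Sum>i\<in>B. ((G *\<^sub>v v) $ i)\<^sup>2)" using fin by (auto intro: sum_pos2)
  moreover have "0 \<le> v \<bullet> v" using eucl_norm_power2[of v] by (metis zero_le_power2)
  ultimately show ?thesis by (metis mult_le_0_iff not_le)
qed

lemma singular_values_basis:
  assumes bas: "is_basis G B" and "0 < dim_col G"
  shows "finite (singular_values (row_submatrix G B))" "singular_values (row_submatrix G B) \<noteq> {}"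
    "\<And>s. s \<in> singular_values (row_submatrix G B) \<Longrightarrow> 0 < s"
proof -
  have eq: "singular_values (row_submatrix G B) = sqrt ` {e. eigenvalue (gram G B) e}"
    by (simp add: singular_values_def gram_def)
  show "finite (singular_values (row_submatrix G B))"
    unfolding eq using finite_eigenvalues[OF gram_carrier] by blast
  show "singular_values (row_submatrix G B) \<noteq> {}"
    unfolding eq using symmetric_norm_eigenvalue[OF gram_carrier gram_symmetric assms(2)] by blast
  show "0 < s" if "s \<in> singular_values (row_submatrix G B)" for s
    using that gram_eigenvalue_pos[OF bas] by (auto simp: eq)
qed

lemma finite_optimal_bases: "finite (optimal_bases G p)"
proof -
  have "optimal_bases G p \<subseteq> Pow {..<dim_row G}" by (auto simp: optimal_bases_def is_basis_def)
  then show ?thesis by (rule finite_subset) simp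
qed

lemma sigma_lower_pos:
  assumes "optimal_bases G p \<noteq> {}" and "0 < dim_col G"
  shows "0 < sigma_lower G p"
proof -
  have "sigma_lower G p \<in> (\<lambda>B. sigma_min (row_submatrix G B)) ` optimal_bases G p"
    unfolding sigma_lower_def using assms finite_optimal_bases by (intro Min_in) auto
  then obtain B where B: "B \<in> optimal_bases G p" "sigma_lower G p = sigma_min (row_submatrix G B)"
    by blast
  then have "is_basis G B" by (simp add: optimal_bases_def)
  note sv = singular_values_basis[OF this assms(2)]
  show ?thesis using sv(3)[OF Min_in[OF sv(1,2)]] by (simp add: B(2) sigma_min_def)
qed

lemma optimal_basis_eigenvalue_bounds:
  assumes B: "B \<in> optimal_bases G p" and D: "0 < dim_col G" and e: "eigenvalue (gram G B) e"
  shows "(sigma_lower G p)\<^sup>2 \<le> e" "e \<le> (sigma_upper G p)\<^sup>2"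
    and "sigma_lower G p \<le> sigma_upper G p"
proof -
  have bas: "is_basis G B" using B by (simp add: optimal_bases_def)
  note sv = singular_values_basis[OF bas D]
  have s: "sqrt e \<in> singular_values (row_submatrix G B)"
    using e by (simp add: singular_values_def gram_def)
  have "sigma_lower G p \<le> sigma_min (row_submatrix G B)"
    unfolding sigma_lower_def using finite_optimal_bases B by (intro Min_le) auto
  also have "\<dots> \<le> sqrt e" unfolding sigma_min_def using sv s by (intro Min_le) auto
  finally have lo: "sigma_lower G p \<le> sqrt e" .
  have "sqrt e \<le> sigma_max (row_submatrix G B)" unfolding sigma_max_def using sv s by (intro Max_ge) auto
  also have "\<dots> \<le> sigma_upper G p"
    unfolding sigma_upper_def using finite_optimal_bases B by (intro Max_ge) auto
  finally have up: "sqrt e \<le> sigma_upper G p" .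
  have e0: "0 < e" using gram_eigenvalue_pos[OF bas e] .
  have l0: "0 < sigma_lower G p" using sigma_lower_pos[OF _ D] B by blast
  show "(sigma_lower G p)\<^sup>2 \<le> e" using power_mono[OF lo, of 2] l0 e0 by simp
  show "e \<le> (sigma_upper G p)\<^sup>2" using power_mono[OF up, of 2] e0 by simp
  show "sigma_lower G p \<le> sigma_upper G p" using lo up by simp
qed

lemma sigma_lower_le_upper:
  assumes ne: "optimal_bases G p \<noteq> {}" and D: "0 < dim_col G"
  shows "sigma_lower G p \<le> sigma_upper G p"
proof -
  obtain B where B: "B \<in> optimal_bases G p" using ne by blast
  obtain e where "eigenvalue (gram G B) e"
    using symmetric_norm_eigenvalue[OF gram_carrier gram_symmetric D] by blast
  then show ?thesis using optimal_basis_eigenvalue_bounds(3)[OF B D] by blast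
qed

lemma rho_const_bounds:
  assumes "optimal_bases G p \<noteq> {}" and "0 < dim_col G"
  shows "0 \<le> rho_const G p" "rho_const G p < 1"
proof -
  have l: "0 < sigma_lower G p" using sigma_lower_pos[OF assms] .
  have "(sigma_lower G p)\<^sup>2 \<le> (sigma_upper G p)\<^sup>2"
    using sigma_lower_le_upper[OF assms] l by (intro power_mono) auto
  moreover have "0 < (sigma_lower G p)\<^sup>2" using l by simp
  ultimately show "0 \<le> rho_const G p" "rho_const G p < 1"
    by (auto simp: rho_const_def add_nonneg_pos divide_less_eq_1_pos)
qed

lemma Gamma_const_ge:
  assumes "optimal_bases G p \<noteq> {}" and "0 < dim_col G"
  shows "1 / sigma_lower G p \<le> Gamma_const G p"
  using sigma_lower_pos[OF assms] sigma_lower_le_upper[OF assms]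
  by (simp add: Gamma_const_def field_simps power2_eq_square)

lemma smult_mat_mult_vec:
  fixes A :: "real mat"
  assumes "A \<in> carrier_mat a b" "x \<in> carrier_vec b"
  shows "(c \<cdot>\<^sub>m A) *\<^sub>v x = c \<cdot>\<^sub>v (A *\<^sub>v x)"
  using assms by (intro eq_vecI) auto

text \<open>
  Let \<open>l\<close> and \<open>u\<close> be the extreme singular values over all optimal bases. The eigenvalues of the
  symmetric matrix \<open>1 - \<alpha> H\<close> are the numbers \<open>1 - \<alpha> e\<close> with \<open>e\<close> an eigenvalue of the Gram
  matrix \<open>H\<close>, and \<open>e\<close> lies between \<open>l\<^sup>2\<close> and \<open>u\<^sup>2\<close>. The step
  \<open>\<alpha> = 2 / (u\<^sup>2 + l\<^sup>2)\<close> balances the two ends of this range: all of these numbers are at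
  most \<open>\<rho>\<close> in absolute value, and the norm of a symmetric matrix is one of these absolute values.
\<close>

lemma richardson_contraction:
  assumes B: "B \<in> optimal_bases G p" and D: "0 < dim_col G" and x: "x \<in> carrier_vec (dim_col G)"
  shows "eucl_norm (x + (- (2 / ((sigma_upper G p)\<^sup>2 + (sigma_lower G p)\<^sup>2))) \<cdot>\<^sub>v (gram G B *\<^sub>v x))
           \<le> rho_const G p * eucl_norm x"
proof -
  let ?D = "dim_col G" and ?H = "gram G B"
  define a where "a = (sigma_lower G p)\<^sup>2"
  define b where "b = (sigma_upper G p)\<^sup>2"
  define \<alpha> where "\<alpha> = 2 / (b + a)"
  define R where "R = 1\<^sub>m ?D + (- \<alpha>) \<cdot>\<^sub>m ?H"
  have ne: "optimal_bases G p \<noteq> {}" using B by blast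
  have a0: "0 < a" using sigma_lower_pos[OF ne D] by (simp add: a_def)
  have b0: "0 \<le> b" by (simp add: b_def)
  have \<alpha>0: "0 < \<alpha>" using a0 b0 by (simp add: \<alpha>_def add_nonneg_pos)
  have Hc: "?H \<in> carrier_mat ?D ?D" by simp
  have R: "R \<in> carrier_mat ?D ?D" using Hc unfolding R_def by auto
  have sym: "R\<^sup>T = R"
    using gram_symmetric[of G B] Hc unfolding R_def
    by (simp add: transpose_add[of _ ?D ?D] transpose_smult_mat)
  have Rx: "R *\<^sub>v y = y + (- \<alpha>) \<cdot>\<^sub>v (?H *\<^sub>v y)" if y: "y \<in> carrier_vec ?D" for y
  proof -
    have "R *\<^sub>v y = 1\<^sub>m ?D *\<^sub>v y + ((- \<alpha>) \<cdot>\<^sub>m ?H) *\<^sub>v y"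
      unfolding R_def using Hc y by (intro add_mult_distrib_mat_vec) auto
    moreover have "((- \<alpha>) \<cdot>\<^sub>m ?H) *\<^sub>v y = (- \<alpha>) \<cdot>\<^sub>v (?H *\<^sub>v y)"
      using smult_mat_mult_vec[OF Hc y] .
    ultimately show ?thesis using y by simp
  qed
  obtain \<mu> where \<mu>: "\<mu> \<ge> 0" "eigenvalue R \<mu> \<or> eigenvalue R (- \<mu>)"
    "\<And>y. y \<in> carrier_vec ?D \<Longrightarrow> eucl_norm (R *\<^sub>v y) \<le> \<mu> * eucl_norm y"
    using symmetric_norm_eigenvalue[OF R sym D] by blast
  then obtain s where s: "eigenvalue R s" "\<bar>s\<bar> = \<mu>" by (metis abs_minus_cancel abs_of_nonneg)
  obtain v where v: "v \<in> carrier_vec ?D" "v \<noteq> 0\<^sub>v ?D" "R *\<^sub>v v = s \<cdot>\<^sub>v v"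
    using s(1) R by (auto simp: eigenvalue_def eigenvector_def)
  have Hv: "?H *\<^sub>v v \<in> carrier_vec ?D" using mult_mat_vec_carrier[OF Hc v(1)] .
  have "?H *\<^sub>v v = ((1 - s) / \<alpha>) \<cdot>\<^sub>v v"
  proof (rule eq_vecI)
    fix i assume "i < dim_vec (((1 - s) / \<alpha>) \<cdot>\<^sub>v v)"
    then have i: "i < ?D" using v(1) by simp
    have "(v + (- \<alpha>) \<cdot>\<^sub>v (?H *\<^sub>v v)) $ i = (s \<cdot>\<^sub>v v) $ i" using v(3) Rx[OF v(1)] by simp
    moreover have "(v + (- \<alpha>) \<cdot>\<^sub>v (?H *\<^sub>v v)) $ i = v $ i + (- \<alpha>) * (?H *\<^sub>v v) $ i"
      using i Hv by (metis carrier_vecD index_add_vec(1) index_smult_vec(1) index_smult_vec(2))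
    ultimately have "v $ i - \<alpha> * (?H *\<^sub>v v) $ i = s * v $ i" using i v(1) by simp
    then have "(?H *\<^sub>v v) $ i = (1 - s) / \<alpha> * v $ i" using \<alpha>0 by (simp add: field_simps)
    then show "(?H *\<^sub>v v) $ i = (((1 - s) / \<alpha>) \<cdot>\<^sub>v v) $ i" using i v(1) by simp
  qed (use v(1) Hv in auto)
  then have "eigenvalue ?H ((1 - s) / \<alpha>)"
    using v Hc unfolding eigenvalue_def eigenvector_def by auto
  from optimal_basis_eigenvalue_bounds(1,2)[OF B D this]
  have "a * \<alpha> \<le> 1 - s" "1 - s \<le> b * \<alpha>" using \<alpha>0 by (auto simp: a_def b_def field_simps)
  moreover have "1 - a * \<alpha> = rho_const G p" "b * \<alpha> - 1 = rho_const G p"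
    using a0 b0 by (auto simp: rho_const_def \<alpha>_def a_def[symmetric] b_def[symmetric] field_simps)
  ultimately have "\<mu> \<le> rho_const G p" using s(2) by linarith
  then have "\<mu> * eucl_norm x \<le> rho_const G p * eucl_norm x" by (intro mult_right_mono) auto
  then have "eucl_norm (R *\<^sub>v x) \<le> rho_const G p * eucl_norm x" using \<mu>(3)[OF x] by linarith
  then show ?thesis using Rx[OF x] by (simp add: \<alpha>_def a_def b_def)
qed

text \<open>
  With \<open>l\<close> the smallest singular value and \<open>\<alpha>\<close> the step length of the contraction,
  \<open>1 - \<rho> = \<alpha> l\<^sup>2\<close>. So the contraction also bounds the Gram form below by \<open>l\<^sup>2\<close>.
\<close>

lemma basis_solution_norm:
  assumes B: "B \<in> optimal_bases G p" and D: "0 < dim_col G" and w: "w \<in> carrier_vec (dim_col G)"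
  shows "eucl_norm w \<le> 1 / sigma_lower G p * sqrt (\<Sum>i\<in>B. ((G *\<^sub>v w) $ i)\<^sup>2)"
proof -
  define a where "a = (sigma_lower G p)\<^sup>2"
  define b where "b = (sigma_upper G p)\<^sup>2"
  define \<alpha> where "\<alpha> = 2 / (b + a)"
  have ne: "optimal_bases G p \<noteq> {}" using B by blast
  have Br: "B \<subseteq> {..<dim_row G}" using B by (simp add: optimal_bases_def is_basis_def)
  have l0: "0 < sigma_lower G p" using sigma_lower_pos[OF ne D] .
  have a0: "0 < a" using l0 by (simp add: a_def)
  have b0: "0 \<le> b" by (simp add: b_def)
  have \<alpha>0: "0 < \<alpha>" using a0 b0 by (simp add: \<alpha>_def add_nonneg_pos)
  have Hw: "gram G B *\<^sub>v w \<in> carrier_vec (dim_col G)" using mult_mat_vec_carrier[OF gram_carrier w] .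
  let ?Rw = "w + (- \<alpha>) \<cdot>\<^sub>v (gram G B *\<^sub>v w)"
  have Rc: "?Rw \<in> carrier_vec (dim_col G)" using w Hw by simp
  have "w \<bullet> w - \<alpha> * (w \<bullet> (gram G B *\<^sub>v w)) = w \<bullet> ?Rw"
    using scalar_prod_line[OF w w Hw, of "- \<alpha>"] by simp
  also have "\<dots> \<le> eucl_norm w * eucl_norm ?Rw" using scalar_prod_le_eucl_norm[OF w Rc] by simp
  also have "\<dots> \<le> eucl_norm w * (rho_const G p * eucl_norm w)"
    using richardson_contraction[OF B D w]
    by (intro mult_left_mono) (auto simp: \<alpha>_def a_def b_def)
  also have "\<dots> = rho_const G p * (w \<bullet> w)"
    by (simp add: eucl_norm_power2[symmetric] power2_eq_square)
  finally have "(1 - rho_const G p) * (w \<bullet> w) \<le> \<alpha> * (w \<bullet> (gram G B *\<^sub>v w))"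
    by (simp add: algebra_simps)
  moreover have "1 - rho_const G p = a * \<alpha>"
    using a0 b0 by (auto simp: rho_const_def \<alpha>_def a_def[symmetric] b_def[symmetric] field_simps)
  ultimately have "\<alpha> * (a * (w \<bullet> w)) \<le> \<alpha> * (w \<bullet> (gram G B *\<^sub>v w))" by (simp add: ac_simps)
  then have "a * (w \<bullet> w) \<le> w \<bullet> (gram G B *\<^sub>v w)" using \<alpha>0 by simp
  then have "(sigma_lower G p * eucl_norm w)\<^sup>2 \<le> (\<Sum>i\<in>B. ((G *\<^sub>v w) $ i)\<^sup>2)"
    by (simp add: gram_quadratic_form[OF Br w] power_mult_distrib a_def eucl_norm_power2)
  then have "sigma_lower G p * eucl_norm w \<le> sqrt (\<Sum>i\<in>B. ((G *\<^sub>v w) $ i)\<^sup>2)"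
    by (rule real_le_rsqrt)
  then show ?thesis using l0 by (simp add: field_simps)
qed

section \<open>Vectors with blocks\<close>

lemma block_index_less:
  fixes b i s N :: nat
  assumes "i \<in> {1..N}" "s < b"
  shows "(i - 1) * b + s < b * N"
proof -
  have "(i - 1) * b + s < i * b" using assms by (cases i) auto
  also have "\<dots> \<le> b * N" using assms(1) by (simp add: mult.commute)
  finally show ?thesis .
qed

lemma sum_blocks:
  fixes f :: "nat \<Rightarrow> 'a::comm_monoid_add"
  shows "(\<Sum>c<b * N. f c) = (\<Sum>i\<in>{1..N}. \<Sum>s<b. f ((i - 1) * b + s))"
proof -
  have "(\<Sum>c<b * N. f c) = (\<Sum>k<N. \<Sum>c\<in>{k * b..<k * b + b}. f c)"
    using sum.nat_group[of f b N] by (simp add: mult.commute)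
  also have "\<dots> = (\<Sum>k<N. \<Sum>s<b. f (k * b + s))"
  proof (rule sum.cong)
    fix k
    show "(\<Sum>c\<in>{k * b..<k * b + b}. f c) = (\<Sum>s<b. f (k * b + s))"
      by (rule sum.reindex_bij_witness[of _ "\<lambda>s. k * b + s" "\<lambda>c. c - k * b"]) auto
  qed simp
  also have "\<dots> = (\<Sum>i\<in>{1..N}. \<Sum>s<b. f ((i - 1) * b + s))"
    by (rule sum.reindex_bij_witness[of _ "\<lambda>j. j - 1" Suc]) auto
  finally show ?thesis .
qed

lemma all_blocks_iff:
  fixes b K :: nat
  assumes "0 < b"
  shows "(\<forall>q<b * K. Q q) \<longleftrightarrow> (\<forall>k\<in>{1..K}. \<forall>s<b. Q ((k - 1) * b + s))"
proof
  assume all: "\<forall>q<b * K. Q q"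
  show "\<forall>k\<in>{1..K}. \<forall>s<b. Q ((k - 1) * b + s)"
    by (intro ballI allI impI all[rule_format]) (rule block_index_less)
next
  assume r: "\<forall>k\<in>{1..K}. \<forall>s<b. Q ((k - 1) * b + s)"
  show "\<forall>q<b * K. Q q"
  proof (intro allI impI)
    fix q assume "q < b * K"
    then have "q div b < K" using assms by (simp add: div_less_iff_less_mult mult.commute)
    then have "q div b + 1 \<in> {1..K}" by simp
    moreover have "q mod b < b" using assms by simp
    ultimately have "Q ((q div b + 1 - 1) * b + q mod b)" using r by blast
    then show "Q q" by simp
  qed
qed

lemma vec_eq_blocks:
  assumes "0 < b" "u \<in> carrier_vec (b * L)" "v \<in> carrier_vec (b * L)"
    and "\<And>k c. k \<in> {1..L} \<Longrightarrow> c < b \<Longrightarrow> u $ ((k - 1) * b + c) = v $ ((k - 1) * b + c)"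
  shows "u = v"
proof -
  have "\<forall>q<b * L. u $ q = v $ q" unfolding all_blocks_iff[OF assms(1)] using assms(4) by blast
  then show ?thesis using assms(2,3) by (intro eq_vecI) auto
qed

lemma vec_block_carrier [simp]: "vec_block b v i \<in> carrier_vec b"
  by (simp add: vec_block_def)

lemma dim_vec_block: "dim_vec (vec_block b v i) = b"
  by (simp add: vec_block_def)

lemma vec_block_norm:
  assumes "1 \<le> i"
  shows "eucl_norm (vec_block b v i) = L2_set (\<lambda>c. v $ c) {(i - 1) * b..<i * b}"
proof -
  have "(\<Sum>c<b. (v $ ((i - 1) * b + c))\<^sup>2) = (\<Sum>c\<in>{(i - 1) * b..<i * b}. (v $ c)\<^sup>2)"
  proof (rule sum.reindex_bij_witness[of _ "\<lambda>c. c - (i - 1) * b" "\<lambda>c. (i - 1) * b + c"])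
    fix c assume "c \<in> {(i - 1) * b..<i * b}"
    moreover have "i * b = (i - 1) * b + b" using assms by (cases i) auto
    ultimately show "c - (i - 1) * b \<in> {..<b}" by auto
  next
    fix c assume "c \<in> {..<b}"
    moreover have "i * b = (i - 1) * b + b" using assms by (cases i) auto
    ultimately show "(i - 1) * b + c \<in> {(i - 1) * b..<i * b}" by auto
  qed auto
  then show ?thesis using assms by (simp add: eucl_norm_L2_set vec_block_def L2_set_def)
qed

lemma vec_block_norm_le:
  assumes "i \<in> {1..N}" "v \<in> carrier_vec (b * N)"
  shows "eucl_norm (vec_block b v i) \<le> eucl_norm v"
proof -
  have "i * b \<le> b * N" using assms(1) by (simp add: mult.commute)
  then have "{..<i * b} \<subseteq> {..<b * N}" by (simp only: lessThan_subset_iff)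
  moreover have "{(i - 1) * b..<i * b} \<subseteq> {..<i * b}" by auto
  ultimately have "{(i - 1) * b..<i * b} \<subseteq> {..<b * N}" by (rule order_trans[rotated])
  then have "(\<Sum>c\<in>{(i - 1) * b..<i * b}. (v $ c)\<^sup>2) \<le> (\<Sum>c<b * N. (v $ c)\<^sup>2)"
    by (intro sum_mono2) auto
  then show ?thesis using assms by (subst vec_block_norm) (auto simp: eucl_norm_L2_set L2_set_def)
qed

lemma block_interval_div:
  fixes b c i :: nat
  assumes "1 \<le> i" "c \<in> {(i - 1) * b..<i * b}"
  shows "c div b = i - 1"
proof (rule div_nat_eqI)
  show "b * (i - 1) \<le> c" using assms by (simp add: mult.commute)
  have "b * Suc (i - 1) = i * b" using assms(1) by (simp add: mult.commute)
  then show "c < b * Suc (i - 1)" using assms(2) by simp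
qed

lemma vec_block_eqI:
  assumes "i \<in> {1..N}" and "\<And>c. c < b * N \<Longrightarrow> c div b = i - 1 \<Longrightarrow> u $ c = v $ c"
  shows "vec_block b u i = vec_block b v i"
proof -
  have "u $ ((i - 1) * b + c) = v $ ((i - 1) * b + c)" if c: "c < b" for c
    using c by (intro assms(2) block_index_less[OF assms(1)]) auto
  then show ?thesis by (intro eq_vecI) (auto simp: vec_block_def)
qed

lemma vec_block_add:
  assumes "i \<in> {1..N}" "u \<in> carrier_vec (b * N)" "v \<in> carrier_vec (b * N)"
  shows "vec_block b (u + t \<cdot>\<^sub>v v) i = vec_block b u i + t \<cdot>\<^sub>v vec_block b v i"
  using assms block_index_less[OF assms(1)] by (intro eq_vecI) (auto simp: vec_block_def)

section \<open>Exponential decay along the stages\<close>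

text \<open>
  Blocks are counted from 0 here: \<open>i div m\<close> is the stage of row \<open>i\<close>, minus one.
\<close>

definition block_bidiagonal :: "nat \<Rightarrow> nat \<Rightarrow> real mat \<Rightarrow> bool" where
  "block_bidiagonal m n G \<longleftrightarrow> (\<forall>i<dim_row G. \<forall>c<dim_col G.
     G $$ (i, c) \<noteq> 0 \<longrightarrow> c div n = i div m \<or> c div n + 1 = i div m)"

abbreviation stage_decay :: "real mat \<Rightarrow> real vec \<Rightarrow> nat \<Rightarrow> nat \<Rightarrow> real" where
  "stage_decay G p i j \<equiv> rho_const G p ^ nat (max 0 (\<bar>int i - int j\<bar> - 1))"

text \<open>
  The Richardson iteration for the normal equations, started at 0, converges to \<open>w\<close> with rate
  \<open>\<rho>\<close>. The Gram matrix couples only neighbouring stages, so after \<open>q\<close> steps the iterate is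
  supported within distance \<open>q\<close> of the stage \<open>j\<close> that carries the data. At stage \<open>i \<noteq> j\<close>,
  with \<open>q = \<bar>i - j\<bar> - 1\<close>, the iterate vanishes and the error is all of \<open>w\<close>; for \<open>i = j\<close> the starting
  point 0 serves.
\<close>

lemma basis_solution_block_decay:
  fixes G :: "real mat"
  assumes B: "B \<in> optimal_bases G p" and G: "G \<in> carrier_mat (m * N) (n * N)" and D: "0 < n * N"
    and band: "block_bidiagonal m n G"
    and v: "v \<in> carrier_vec (m * N)" and supp: "\<And>r. r < m * N \<Longrightarrow> r div m \<noteq> j - 1 \<Longrightarrow> v $ r = 0"
    and w: "w \<in> carrier_vec (n * N)" and Gw: "\<And>r. r \<in> B \<Longrightarrow> (G *\<^sub>v w) $ r = v $ r"
    and i: "i \<in> {1..N}" and j: "1 \<le> j"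
  shows "eucl_norm (vec_block n w i) \<le>
           Gamma_const G p * stage_decay G p i j * eucl_norm v"
proof -
  let ?H = "gram G B" and ?\<rho> = "rho_const G p"
  have dims: "dim_row G = m * N" "dim_col G = n * N" using G by auto
  have D': "0 < dim_col G" using D dims by simp
  have ne: "optimal_bases G p \<noteq> {}" using B by blast
  have Br: "B \<subseteq> {..<m * N}" using B dims by (simp add: optimal_bases_def is_basis_def)
  have Brow: "B \<subseteq> {..<dim_row G}" using Br dims by simp
  have Hc: "?H \<in> carrier_mat (n * N) (n * N)" using gram_carrier[of G B] dims by simp
  define \<alpha> where "\<alpha> = 2 / ((sigma_upper G p)\<^sup>2 + (sigma_lower G p)\<^sup>2)"
  define x where "x = (\<lambda>q. ((\<lambda>y. y + \<alpha> \<cdot>\<^sub>v (?H *\<^sub>v (w - y))) ^^ q) (0\<^sub>v (n * N)))"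
  have x0: "x 0 = 0\<^sub>v (n * N)" and xS: "x (Suc q) = x q + \<alpha> \<cdot>\<^sub>v (?H *\<^sub>v (w - x q))" for q
    by (simp_all add: x_def)
  have xc: "x q \<in> carrier_vec (n * N)" for q
  proof (induction q)
    case (Suc q)
    then have "?H *\<^sub>v (w - x q) \<in> carrier_vec (n * N)"
      using mult_mat_vec_carrier[OF Hc, of "w - x q"] w by simp
    then show ?case using Suc by (simp add: xS)
  qed (simp add: x0)
  have err: "eucl_norm (w - x q) \<le> ?\<rho> ^ q * eucl_norm w" for q
  proof (induction q)
    case 0
    then show ?case using w by (simp add: x0)
  next
    case (Suc q)
    have wc: "w - x q \<in> carrier_vec (n * N)" using w xc by simp
    have hc: "?H *\<^sub>v (w - x q) \<in> carrier_vec (n * N)" using mult_mat_vec_carrier[OF Hc wc] .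
    have "w - x (Suc q) = (w - x q) + (- \<alpha>) \<cdot>\<^sub>v (?H *\<^sub>v (w - x q))"
    proof (rule eq_vecI)
      fix c assume "c < dim_vec ((w - x q) + (- \<alpha>) \<cdot>\<^sub>v (?H *\<^sub>v (w - x q)))"
      then have "c < n * N" using dims by simp
      then have c: "c < dim_vec w" "c < dim_vec (x q)" "c < dim_vec (?H *\<^sub>v (w - x q))"
        using w xc[of q] hc dims by auto
      show "(w - x (Suc q)) $ c = ((w - x q) + (- \<alpha>) \<cdot>\<^sub>v (?H *\<^sub>v (w - x q))) $ c"
        using c by (simp add: xS del: index_mult_mat_vec dim_mult_mat_vec)
    qed (use w xc[of q] hc in \<open>auto simp: xS\<close>)
    then have "eucl_norm (w - x (Suc q)) \<le> ?\<rho> * eucl_norm (w - x q)"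
      using richardson_contraction[OF B D', of "w - x q"] wc by (simp add: \<alpha>_def dims)
    also have "\<dots> \<le> ?\<rho> * (?\<rho> ^ q * eucl_norm w)"
      using Suc rho_const_bounds(1)[OF ne D'] by (intro mult_left_mono)
    finally show ?case by (simp add: ac_simps)
  qed
  have xsupp: "x q $ c = 0" if "c < n * N" "\<bar>int (c div n) - int (j - 1)\<bar> > int q" for q c
    using that
  proof (induction q arbitrary: c)
    case 0
    then show ?case by (simp add: x0)
  next
    case (Suc q)
    have wc: "w - x q \<in> carrier_vec (n * N)" using w xc by simp
    have cG: "c < dim_col G" using Suc.prems dims by simp
    have "G $$ (r, c) * (G *\<^sub>v (w - x q)) $ r = 0" if r: "r \<in> B" for r
    proof (rule ccontr)
      assume nz: "G $$ (r, c) * (G *\<^sub>v (w - x q)) $ r \<noteq> 0"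
      have rr: "r < m * N" using r Br by auto
      have bc: "c div n = r div m \<or> c div n + 1 = r div m"
        using nz band cG rr dims unfolding block_bidiagonal_def by (metis mult_zero_left)
      have "(G *\<^sub>v (w - x q)) $ r = v $ r - (G *\<^sub>v x q) $ r"
        using mult_mat_vec_scaled_diff[of w G "x q" r 1] w xc rr dims Gw[OF r] by simp
      moreover have "v $ r = 0" using supp[OF rr] bc Suc.prems(2) by force
      moreover have "(G *\<^sub>v x q) $ r = (\<Sum>c'<n * N. G $$ (r, c') * x q $ c')"
        using rr dims xc[of q] by (simp add: scalar_prod_def lessThan_atLeast0)
      moreover have "G $$ (r, c') * x q $ c' = 0" if c': "c' < n * N" for c'
      proof (cases "G $$ (r, c') = 0")
        case False
        then have "c' div n = r div m \<or> c' div n + 1 = r div m"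
          using band c' rr dims unfolding block_bidiagonal_def by metis
        then have "\<bar>int (c' div n) - int (j - 1)\<bar> > int q" using bc Suc.prems(2) by linarith
        then show ?thesis using Suc.IH[OF c'] by simp
      qed simp
      ultimately have "(G *\<^sub>v (w - x q)) $ r = 0" by simp
      then show False using nz by simp
    qed
    then have H0: "(?H *\<^sub>v (w - x q)) $ c = 0"
      unfolding gram_mult_vec[OF Brow wc[folded dims(2)] cG] by (intro sum.neutral) blast
    have "c < dim_vec (?H *\<^sub>v (w - x q))" using mult_mat_vec_carrier[OF Hc wc] Suc.prems(1) dims by simp
    then have "x (Suc q) $ c = x q $ c + \<alpha> * (?H *\<^sub>v (w - x q)) $ c"
      by (simp add: xS del: index_mult_mat_vec dim_mult_mat_vec)
    moreover have "x q $ c = 0" using Suc.IH[of c] Suc.prems by simp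
    ultimately show ?case using H0 by simp
  qed
  define q where "q = nat (max 0 (\<bar>int i - int j\<bar> - 1))"
  have "vec_block n (x q) i = 0\<^sub>v n"
  proof (cases "i = j")
    case True
    then have "q = 0" by (simp add: q_def)
    then have "x q $ ((i - 1) * n + c) = 0" if "c < n" for c
      using block_index_less[OF i that] by (simp add: x0)
    then show ?thesis using i by (intro eq_vecI) (auto simp: vec_block_def)
  next
    case False
    then have q: "\<bar>int (i - 1) - int (j - 1)\<bar> > int q" using i j by (auto simp: q_def)
    have "x q $ ((i - 1) * n + c) = 0" if "c < n" for c
    proof (rule xsupp)
      show "(i - 1) * n + c < n * N" by (rule block_index_less[OF i that])
      show "\<bar>int (((i - 1) * n + c) div n) - int (j - 1)\<bar> > int q" using q that by simp
    qed
    then show ?thesis using i by (intro eq_vecI) (auto simp: vec_block_def)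
  qed
  moreover have "vec_block n w i = vec_block n (w - x q) i + 1 \<cdot>\<^sub>v vec_block n (x q) i"
  proof -
    have "w = (w - x q) + 1 \<cdot>\<^sub>v x q" using w xc[of q] by (intro eq_vecI) auto
    then show ?thesis using vec_block_add[OF i _ xc[of q], of "w - x q" 1] w xc[of q] by simp
  qed
  ultimately have "vec_block n w i = vec_block n (w - x q) i" by simp
  then have "eucl_norm (vec_block n w i) \<le> eucl_norm (w - x q)"
    using vec_block_norm_le[OF i, of "w - x q"] w xc by simp
  also have "\<dots> \<le> ?\<rho> ^ q * eucl_norm w" by (rule err)
  also have "\<dots> \<le> ?\<rho> ^ q * (Gamma_const G p * eucl_norm v)"
  proof (intro mult_left_mono)
    have "(\<Sum>r\<in>B. ((G *\<^sub>v w) $ r)\<^sup>2) = (\<Sum>r\<in>B. (v $ r)\<^sup>2)" using Gw by simp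
    also have "\<dots> \<le> (\<Sum>r<m * N. (v $ r)\<^sup>2)" using Br by (intro sum_mono2) auto
    also have "\<dots> = (eucl_norm v)\<^sup>2"
      unfolding eucl_norm_power2 using v
      by (simp add: scalar_prod_def lessThan_atLeast0 power2_eq_square)
    finally have "sqrt (\<Sum>r\<in>B. ((G *\<^sub>v w) $ r)\<^sup>2) \<le> eucl_norm v"
      using real_sqrt_le_mono by fastforce
    moreover have "0 \<le> 1 / sigma_lower G p" using sigma_lower_pos[OF ne D'] by simp
    ultimately have "1 / sigma_lower G p * sqrt (\<Sum>r\<in>B. ((G *\<^sub>v w) $ r)\<^sup>2) \<le> 1 / sigma_lower G p * eucl_norm v"
      by (intro mult_left_mono)
    also have "\<dots> \<le> Gamma_const G p * eucl_norm v"
      using Gamma_const_ge[OF ne D'] by (intro mult_right_mono) auto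
    finally show "eucl_norm w \<le> Gamma_const G p * eucl_norm v"
      using basis_solution_norm[OF B D', of w] w dims by simp
    show "0 \<le> ?\<rho> ^ q" using rho_const_bounds(1)[OF ne D'] by simp
  qed
  finally show ?thesis by (simp add: q_def ac_simps)
qed

text \<open>
  Superposition of the single-stage estimates: the data are split off one stage at a time.
\<close>

lemma basis_solution_decay:
  fixes G :: "real mat"
  assumes B: "B \<in> optimal_bases G p" and G: "G \<in> carrier_mat (m * N) (n * N)" and D: "0 < n * N"
    and m: "0 < m"
    and band: "block_bidiagonal m n G"
    and \<delta>: "\<delta> \<in> carrier_vec (m * N)"
    and w: "w \<in> carrier_vec (n * N)" and Gw: "\<And>r. r \<in> B \<Longrightarrow> (G *\<^sub>v w) $ r = \<delta> $ r"
    and i: "i \<in> {1..N}"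
  shows "eucl_norm (vec_block n w i) \<le>
           (\<Sum>j\<in>{1..N}. Gamma_const G p * eucl_norm (vec_block m \<delta> j) *
              stage_decay G p i j)"
proof -
  let ?b = "\<lambda>\<delta> j. Gamma_const G p * eucl_norm (vec_block m \<delta> j) *
              stage_decay G p i j"
  have dims: "dim_row G = m * N" "dim_col G = n * N" using G by auto
  have bas: "is_basis G B" using B by (simp add: optimal_bases_def)
  have Br: "B \<subseteq> {..<m * N}" using bas dims by (simp add: is_basis_def)
  have "eucl_norm (vec_block n w i) \<le> (\<Sum>j\<in>{1..k}. ?b \<delta> j)"
    if "k \<le> N" "\<delta> \<in> carrier_vec (m * N)" "\<And>r. r < m * N \<Longrightarrow> k \<le> r div m \<Longrightarrow> \<delta> $ r = 0"
      "w \<in> carrier_vec (n * N)" "\<And>r. r \<in> B \<Longrightarrow> (G *\<^sub>v w) $ r = \<delta> $ r" for k \<delta> w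
    using that
  proof (induction k arbitrary: \<delta> w)
    case 0
    then have "(G *\<^sub>v w) $ r = 0" if "r \<in> B" for r using Br that by auto
    then have "w = 0\<^sub>v (n * N)"
      using basis_trivial_kernel[OF bas] 0 dims by (auto simp: trivial_kernel_on_def)
    then have "eucl_norm w = 0" using eucl_norm_eq_0[OF 0(4)] by simp
    then show ?case using vec_block_norm_le[OF i 0(4)] by simp
  next
    case (Suc k)
    define \<delta>' where "\<delta>' = vec (m * N) (\<lambda>r. if r div m = k then 0 else \<delta> $ r)"
    define v where "v = vec (m * N) (\<lambda>r. if r div m = k then \<delta> $ r else 0)"
    obtain w2 where w2: "w2 \<in> carrier_vec (n * N)" "\<And>r. r \<in> B \<Longrightarrow> (G *\<^sub>v w2) $ r = v $ r"
      using basis_solution_exists[OF bas, of v] dims by auto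
    define w1 where "w1 = w - w2"
    have w1: "w1 \<in> carrier_vec (n * N)" using w2 Suc.prems(4) by (simp add: w1_def)
    have "(G *\<^sub>v w1) $ r = \<delta>' $ r" if r: "r \<in> B" for r
    proof -
      have rr: "r < m * N" using r Br by auto
      have "(G *\<^sub>v w1) $ r = (G *\<^sub>v w) $ r - (G *\<^sub>v w2) $ r"
        using mult_mat_vec_scaled_diff[of w G w2 r 1] w2(1) Suc.prems(4) rr dims
        by (simp add: w1_def)
      then show ?thesis using rr by (simp add: w2(2)[OF r] Suc.prems(5)[OF r] v_def \<delta>'_def)
    qed
    moreover have "\<delta>' $ r = 0" if "r < m * N" "k \<le> r div m" for r
      using that Suc.prems(3)[of r] by (auto simp: \<delta>'_def)
    ultimately have n1: "eucl_norm (vec_block n w1 i) \<le> (\<Sum>j\<in>{1..k}. ?b \<delta>' j)"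
      using Suc.prems(1) w1 by (intro Suc.IH) (auto simp: \<delta>'_def)
    have eq1: "vec_block m \<delta>' j = vec_block m \<delta> j" if "j \<in> {1..k}" for j
      using that Suc.prems(1) by (intro vec_block_eqI[where N = N]) (auto simp: \<delta>'_def)
    have n2: "eucl_norm (vec_block n w2 i) \<le>
        Gamma_const G p * stage_decay G p i (Suc k) * eucl_norm v"
      by (rule basis_solution_block_decay[OF B G D band _ _ w2(1) _ i]) (use w2(2) in \<open>auto simp: v_def\<close>)
    have nv: "eucl_norm v = eucl_norm (vec_block m \<delta> (Suc k))"
    proof -
      have sub: "{k * m..<Suc k * m} \<subseteq> {..<m * N}"
        using Suc.prems(1) mult_le_mono1[of "Suc k" N m] by (auto simp: mult.commute)
      have "(\<Sum>r<m * N. (v $ r)\<^sup>2) = (\<Sum>r\<in>{k * m..<Suc k * m}. (v $ r)\<^sup>2)"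
      proof (rule sum.mono_neutral_right[OF _ sub])
        show "\<forall>r\<in>{..<m * N} - {k * m..<Suc k * m}. (v $ r)\<^sup>2 = 0"
        proof
          fix r assume r: "r \<in> {..<m * N} - {k * m..<Suc k * m}"
          then have "r div m \<noteq> k"
            using m div_mult_mod_eq[of r m] mod_less_divisor[OF m, of r]
            by (metis DiffD2 atLeastLessThan_iff dividend_less_times_div le_add1 mult.commute mult_Suc_right)
          then show "(v $ r)\<^sup>2 = 0" using r by (auto simp: v_def)
        qed
      qed simp
      also have "\<dots> = (\<Sum>r\<in>{k * m..<Suc k * m}. (\<delta> $ r)\<^sup>2)"
      proof (rule sum.cong)
        fix r assume r: "r \<in> {k * m..<Suc k * m}"
        then have "r div m = k" using block_interval_div[of "Suc k" r m] by simp
        moreover have "r < m * N" using r sub by blast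
        ultimately show "(v $ r)\<^sup>2 = (\<delta> $ r)\<^sup>2" by (simp add: v_def)
      qed simp
      finally show ?thesis
        by (subst vec_block_norm) (auto simp: eucl_norm_L2_set L2_set_def v_def)
    qed
    have "w = w1 + 1 \<cdot>\<^sub>v w2" using w2(1) Suc.prems(4) by (intro eq_vecI) (auto simp: w1_def)
    then have "vec_block n w i = vec_block n w1 i + 1 \<cdot>\<^sub>v vec_block n w2 i"
      using vec_block_add[OF i w1 w2(1), of 1] by simp
    then have "eucl_norm (vec_block n w i) \<le> eucl_norm (vec_block n w1 i) + eucl_norm (vec_block n w2 i)"
      using eucl_norm_triangle[of "vec_block n w1 i" n "vec_block n w2 i"] by simp
    also have "\<dots> \<le> (\<Sum>j\<in>{1..k}. ?b \<delta> j) + ?b \<delta> (Suc k)"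
      using n1 n2 nv eq1 by (intro add_mono) (auto simp: ac_simps)
    finally show ?case by simp
  qed
  from this[of N, OF _ \<delta> _ w Gw] show ?thesis using m
    by (metis (no_types, lifting) div_less_iff_less_mult le_refl linorder_not_le mult.commute)
qed

section \<open>Sensitivity of the linear program to its right-hand side\<close>

lemma lp_feasible_satisfying:
  assumes "dim_vec d = dim_row G"
  shows "lp_feasible d G = satisfying G d {..<dim_row G}"
  using assms by (auto simp: lp_feasible_def satisfying_def less_eq_vec_def)

lemma lp_optimal_iff:
  assumes "dim_vec d = dim_row G"
  shows "lp_optimal d G p z \<longleftrightarrow> z \<in> satisfying G d {..<dim_row G} \<and>
           (\<forall>y \<in> satisfying G d {..<dim_row G}. p \<bullet> z \<le> p \<bullet> y)"
  using assms by (simp add: lp_optimal_def lp_feasible_satisfying)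

lemma small_step:
  fixes s e :: "'a \<Rightarrow> real"
  assumes "finite X" and s: "\<And>i. i \<in> X \<Longrightarrow> 0 < s i" and "0 < c"
  shows "\<exists>\<epsilon>>0. \<epsilon> \<le> c \<and> (\<forall>i\<in>X. 0 \<le> s i + \<epsilon> * e i)"
proof (intro exI conjI ballI)
  let ?Y = "insert c ((\<lambda>i. s i / (\<bar>e i\<bar> + 1)) ` X)"
  let ?\<epsilon> = "Min ?Y"
  have fin: "finite ?Y" using assms(1) by simp
  show pos: "0 < ?\<epsilon>" using fin assms by (auto intro!: divide_pos_pos simp: add_nonneg_pos)
  show "?\<epsilon> \<le> c" using fin by simp
  fix i assume i: "i \<in> X"
  have "?\<epsilon> \<le> s i / (\<bar>e i\<bar> + 1)" using fin i by (intro Min_le) auto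
  then have "?\<epsilon> * (\<bar>e i\<bar> + 1) \<le> s i" by (simp add: field_simps)
  moreover have "- (?\<epsilon> * \<bar>e i\<bar>) \<le> ?\<epsilon> * e i"
    using mult_left_mono[of "- \<bar>e i\<bar>" "e i" ?\<epsilon>] pos by simp
  moreover have "?\<epsilon> * (\<bar>e i\<bar> + 1) = ?\<epsilon> * \<bar>e i\<bar> + ?\<epsilon>" by (simp add: algebra_simps)
  ultimately show "0 \<le> s i + ?\<epsilon> * e i" using pos by linarith
qed

lemma isCont_nonneg_limit:
  fixes f :: "real \<Rightarrow> real"
  assumes f: "isCont f x" and X: "\<And>\<epsilon>. 0 < \<epsilon> \<Longrightarrow> \<exists>s\<in>X. \<bar>s - x\<bar> < \<epsilon>"
    and nn: "\<And>s. s \<in> X \<Longrightarrow> 0 \<le> f s"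
  shows "0 \<le> f x"
proof (rule ccontr)
  assume "\<not> 0 \<le> f x"
  then have neg: "f x < 0" by simp
  then have "eventually (\<lambda>s. f s < 0) (at x)"
    using f by (intro order_tendstoD(2)[of f "f x"]) (simp_all add: isCont_def)
  then obtain \<epsilon> where e: "\<epsilon> > 0" "\<And>s. s \<noteq> x \<Longrightarrow> dist s x < \<epsilon> \<Longrightarrow> f s < 0"
    unfolding eventually_at by blast
  obtain s where s: "s \<in> X" "\<bar>s - x\<bar> < \<epsilon>" using X[OF e(1)] by blast
  have "f s < 0" using e(2)[of s] s(2) neg by (cases "s = x") (auto simp: dist_real_def)
  then show False using nn[OF s(1)] by simp
qed

lemma isCont_eucl_norm_line:
  assumes "u \<in> carrier_vec n" "v \<in> carrier_vec n"
  shows "isCont (\<lambda>s. eucl_norm (u + s \<cdot>\<^sub>v v)) x"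
proof -
  have "(\<lambda>s. eucl_norm (u + s \<cdot>\<^sub>v v)) = (\<lambda>s. sqrt (\<Sum>c<n. (u $ c + s * v $ c)\<^sup>2))"
    using assms by (auto simp: eucl_norm_L2_set L2_set_def fun_eq_iff)
  then show ?thesis by (simp add: continuous_intros)
qed

lemma optimal_feasible_direction:
  fixes G :: "real mat"
  assumes p: "p \<in> carrier_vec (dim_col G)"
    and z: "z \<in> satisfying G d {..<dim_row G}"
    and opt: "\<And>y. y \<in> satisfying G d {..<dim_row G} \<Longrightarrow> p \<bullet> z \<le> p \<bullet> y"
    and h: "h \<in> carrier_vec (dim_col G)"
    and hI: "\<And>i. i \<in> active_rows G d {..<dim_row G} z \<Longrightarrow> 0 \<le> (G *\<^sub>v h) $ i"
  shows "0 \<le> p \<bullet> h"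
proof -
  let ?I = "active_rows G d {..<dim_row G} z"
  have zc: "z \<in> carrier_vec (dim_col G)" and zf: "\<And>i. i < dim_row G \<Longrightarrow> d $ i \<le> (G *\<^sub>v z) $ i"
    using z by (auto simp: satisfying_def)
  have "0 < (G *\<^sub>v z) $ i - d $ i" if "i \<in> {..<dim_row G} - ?I" for i
    using zf[of i] that by (force simp: active_rows_def)
  then obtain \<epsilon> where e: "\<epsilon> > 0"
    "\<And>i. i \<in> {..<dim_row G} - ?I \<Longrightarrow> 0 \<le> ((G *\<^sub>v z) $ i - d $ i) + \<epsilon> * (G *\<^sub>v h) $ i"
    using small_step[of "{..<dim_row G} - ?I" "\<lambda>i. (G *\<^sub>v z) $ i - d $ i" 1 "\<lambda>i. (G *\<^sub>v h) $ i"]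
    by auto
  have "d $ i \<le> (G *\<^sub>v (z + \<epsilon> \<cdot>\<^sub>v h)) $ i" if i: "i < dim_row G" for i
  proof (cases "i \<in> ?I")
    case True
    then have "0 \<le> \<epsilon> * (G *\<^sub>v h) $ i" using hI e(1) by (intro mult_nonneg_nonneg) auto
    then show ?thesis using zf[OF i] by (simp only: mult_mat_vec_line[OF zc h i])
  next
    case False
    then show ?thesis using e(2)[of i] i by (simp only: mult_mat_vec_line[OF zc h i]) auto
  qed
  then have "z + \<epsilon> \<cdot>\<^sub>v h \<in> satisfying G d {..<dim_row G}" using zc h by (auto simp: satisfying_def)
  from opt[OF this] have "0 \<le> \<epsilon> * (p \<bullet> h)" using scalar_prod_line[OF p zc h] by simp
  then show ?thesis using e(1) by (simp add: zero_le_mult_iff)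
qed

text \<open>
  First-order analysis at an optimal vertex \<open>z\<close> when the right-hand side moves in direction
  \<open>\<delta>\<close>. The velocity \<open>w\<close> of the solution is an optimal vertex of the linear program with
  right-hand side \<open>\<delta>\<close> that keeps only the rows active at \<open>z\<close>. For a short time \<open>z + \<epsilon> w\<close> is
  optimal, and it is the basic solution of a basis inside the active rows. Such a direction
  exists because the data stay feasible up to time \<open>c\<close>.
\<close>

lemma optimal_vertex_step:
  fixes G :: "real mat"
  assumes p: "p \<in> carrier_vec (dim_col G)"
    and d: "dim_vec d = dim_row G" and \<delta>: "dim_vec \<delta> = dim_row G"
    and z: "lp_optimal d G p z"
    and ker: "trivial_kernel_on G (active_rows G d {..<dim_row G} z)"
    and c: "0 < c" and y: "y \<in> lp_feasible (d + c \<cdot>\<^sub>v \<delta>) G"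
  shows "\<exists>w B \<epsilon>. w \<in> carrier_vec (dim_col G) \<and> is_basis G B \<and> 0 < \<epsilon> \<and> \<epsilon> \<le> c \<and>
           lp_optimal (d + \<epsilon> \<cdot>\<^sub>v \<delta>) G p (z + \<epsilon> \<cdot>\<^sub>v w) \<and>
           (\<forall>i\<in>B. (G *\<^sub>v w) $ i = \<delta> $ i \<and> (G *\<^sub>v z) $ i = d $ i)"
proof -
  let ?r = "dim_row G" and ?D = "dim_col G"
  define I where "I = active_rows G d {..<?r} z"
  have I: "I \<subseteq> {..<?r}" by (auto simp: I_def active_rows_def)
  have zI: "(G *\<^sub>v z) $ i = d $ i" if "i \<in> I" for i using that by (simp add: I_def active_rows_def)
  have zs: "z \<in> satisfying G d {..<?r}" and opt: "\<And>y. y \<in> satisfying G d {..<?r} \<Longrightarrow> p \<bullet> z \<le> p \<bullet> y"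
    using z d by (auto simp: lp_optimal_iff)
  have zc: "z \<in> carrier_vec ?D" and zf: "\<And>i. i < ?r \<Longrightarrow> d $ i \<le> (G *\<^sub>v z) $ i"
    using zs by (auto simp: satisfying_def)
  have dd: "dim_vec (d + t \<cdot>\<^sub>v \<delta>) = ?r" for t using \<delta> by simp
  have di: "(d + t \<cdot>\<^sub>v \<delta>) $ i = d $ i + t * \<delta> $ i" if "i < ?r" for t i using that \<delta> d by simp
  have quot: "(1 / t) \<cdot>\<^sub>v (y - z) \<in> satisfying G \<delta> I"
    if t: "0 < t" and y: "y \<in> satisfying G (d + t \<cdot>\<^sub>v \<delta>) {..<?r}" for t y
  proof -
    have yc: "y \<in> carrier_vec ?D" using y by (simp add: satisfying_def)
    have "\<delta> $ i \<le> (G *\<^sub>v ((1 / t) \<cdot>\<^sub>v (y - z))) $ i" if i: "i \<in> I" for i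
    proof -
      have ir: "i < ?r" using i I by auto
      have "(d + t \<cdot>\<^sub>v \<delta>) $ i \<le> (G *\<^sub>v y) $ i" using y ir unfolding satisfying_def by blast
      then have "d $ i + t * \<delta> $ i \<le> (G *\<^sub>v y) $ i" unfolding di[OF ir] .
      then have "\<delta> $ i \<le> 1 / t * ((G *\<^sub>v y) $ i - (G *\<^sub>v z) $ i)"
        using t zI[OF i] by (simp add: field_simps)
      then show ?thesis by (simp only: mult_mat_vec_scaled_diff[OF yc zc ir])
    qed
    then show ?thesis using yc zc by (auto simp: satisfying_def)
  qed
  have ne: "satisfying G \<delta> I \<noteq> {}"
    using quot[OF c] y lp_feasible_satisfying[OF dd, of c] by auto
  obtain w where w: "w \<in> satisfying G \<delta> I" "\<And>y. y \<in> satisfying G \<delta> I \<Longrightarrow> p \<bullet> w \<le> p \<bullet> y"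
    "trivial_kernel_on G (active_rows G \<delta> I w)"
    using optimal_vertex_exists[OF I p ker[folded I_def] _ ne]
      optimal_feasible_direction[OF p zs opt, folded I_def] by blast
  have wc: "w \<in> carrier_vec ?D" and wI: "\<And>i. i \<in> I \<Longrightarrow> \<delta> $ i \<le> (G *\<^sub>v w) $ i"
    using w(1) by (auto simp: satisfying_def)
  obtain B where B: "B \<subseteq> active_rows G \<delta> I w" "is_basis G B"
    using basis_in_trivial_kernel[OF w(3)] I by (auto simp: active_rows_def)
  have "0 < (G *\<^sub>v z) $ i - d $ i" if "i \<in> {..<?r} - I" for i
    using zf[of i] that by (force simp: I_def active_rows_def)
  then obtain \<epsilon> where e: "0 < \<epsilon>" "\<epsilon> \<le> c"
    "\<And>i. i \<in> {..<?r} - I \<Longrightarrow> 0 \<le> ((G *\<^sub>v z) $ i - d $ i) + \<epsilon> * ((G *\<^sub>v w) $ i - \<delta> $ i)"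
    using small_step[of "{..<?r} - I" "\<lambda>i. (G *\<^sub>v z) $ i - d $ i" c "\<lambda>i. (G *\<^sub>v w) $ i - \<delta> $ i"] c
    by auto
  have "(d + \<epsilon> \<cdot>\<^sub>v \<delta>) $ i \<le> (G *\<^sub>v (z + \<epsilon> \<cdot>\<^sub>v w)) $ i" if i: "i < ?r" for i
  proof (cases "i \<in> I")
    case True
    then have "\<epsilon> * \<delta> $ i \<le> \<epsilon> * (G *\<^sub>v w) $ i" using wI e(1) by (intro mult_left_mono) auto
    then show ?thesis using zI[OF True] by (simp only: mult_mat_vec_line[OF zc wc i] di[OF i])
  next
    case False
    then show ?thesis using e(3)[of i] i
      by (simp only: mult_mat_vec_line[OF zc wc i] di[OF i]) (auto simp: algebra_simps)
  qed
  then have feas: "z + \<epsilon> \<cdot>\<^sub>v w \<in> satisfying G (d + \<epsilon> \<cdot>\<^sub>v \<delta>) {..<?r}"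
    using zc wc by (auto simp: satisfying_def)
  have "p \<bullet> (z + \<epsilon> \<cdot>\<^sub>v w) \<le> p \<bullet> y" if y: "y \<in> satisfying G (d + \<epsilon> \<cdot>\<^sub>v \<delta>) {..<?r}" for y
  proof -
    have yc: "y \<in> carrier_vec ?D" using y by (simp add: satisfying_def)
    have "p \<bullet> w \<le> 1 / \<epsilon> * (p \<bullet> y - p \<bullet> z)"
      using w(2)[OF quot[OF e(1) y]] by (simp only: scalar_prod_scaled_diff[OF p yc zc])
    then have "\<epsilon> * (p \<bullet> w) \<le> p \<bullet> y - p \<bullet> z" using e(1) by (simp add: field_simps)
    then show ?thesis by (simp add: scalar_prod_line[OF p zc wc])
  qed
  then have "lp_optimal (d + \<epsilon> \<cdot>\<^sub>v \<delta>) G p (z + \<epsilon> \<cdot>\<^sub>v w)"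
    using feas lp_optimal_iff[OF dd] by blast
  moreover have "\<forall>i\<in>B. (G *\<^sub>v w) $ i = \<delta> $ i \<and> (G *\<^sub>v z) $ i = d $ i"
    using B(1) zI by (auto simp: active_rows_def)
  ultimately show ?thesis using wc B(2) e by blast
qed

lemma optimal_basisI:
  assumes bas: "is_basis G B" and d: "dim_vec d = dim_row G" and opt: "lp_optimal d G p z"
    and eq: "\<And>i. i \<in> B \<Longrightarrow> (G *\<^sub>v z) $ i = d $ i"
  shows "B \<in> optimal_bases G p"
proof -
  have z: "z \<in> lp_feasible d G" using opt by (simp add: lp_optimal_def)
  then have "basic_solution G B d = z"
    using basis_basic_solution[OF bas d _ eq] by (simp add: lp_feasible_def)
  then have "lp_optimal d G p (basic_solution G B d)" using opt by (simp only:)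
  moreover have "d \<in> carrier_vec (dim_row G)" using d by (rule carrier_vecI)
  then have "d \<in> feasible_data G" using z unfolding feasible_data_def by blast
  ultimately show ?thesis using bas unfolding optimal_bases_def by blast
qed

text \<open>
  Continuation along the segment from \<open>d0\<close> to \<open>d1\<close>. The set \<open>R\<close> of reached times \<open>t\<close> consists
  of those at which some basic solution is optimal and has moved by at most \<open>t C\<close>. A step from an
  optimal vertex shows that no \<open>t < 1\<close> is the largest element of \<open>R\<close>. The supremum of \<open>R\<close> is
  attained: one of the finitely many bases serves times arbitrarily close to it, and its basic
  solution depends affinely on \<open>t\<close>, so feasibility, the bound and optimality pass to the limit.
  Working with bases makes this possible although optimal solutions need not be unique.
\<close>

lemma optimal_vertex_path:
  fixes G :: "real mat" and C :: "nat \<Rightarrow> real"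
  assumes G: "G \<in> carrier_mat r (n * N)" and p: "p \<in> carrier_vec (n * N)"
    and d0: "d0 \<in> carrier_vec r" and d1: "d1 \<in> carrier_vec r"
    and z0: "lp_optimal d0 G p z0" and ker: "trivial_kernel_on G (active_rows G d0 {..<r} z0)"
    and feas: "lp_feasible d1 G \<noteq> {}"
    and rate: "\<And>B w i. B \<in> optimal_bases G p \<Longrightarrow> w \<in> carrier_vec (n * N) \<Longrightarrow>
        (\<And>k. k \<in> B \<Longrightarrow> (G *\<^sub>v w) $ k = (d1 - d0) $ k) \<Longrightarrow> i \<in> {1..N} \<Longrightarrow>
        eucl_norm (vec_block n w i) \<le> C i"
  shows "\<exists>z1. lp_optimal d1 G p z1 \<and>
           (\<forall>i\<in>{1..N}. eucl_norm (vec_block n z1 i - vec_block n z0 i) \<le> C i)"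
proof -
  let ?D = "n * N"
  define \<delta> where "\<delta> = d1 - d0"
  define d where "d = (\<lambda>t. d0 + t \<cdot>\<^sub>v \<delta>)"
  have dims: "dim_row G = r" "dim_col G = ?D" using G by auto
  have \<delta>c: "\<delta> \<in> carrier_vec r" using d0 d1 by (simp add: \<delta>_def)
  have dc: "d t \<in> carrier_vec r" for t using d0 \<delta>c by (simp add: d_def)
  have ddim: "dim_vec (d t) = dim_row G" for t using dc[of t] dims by simp
  have di: "d t $ i = d0 $ i + t * \<delta> $ i" if "i < r" for t i using that d0 \<delta>c by (simp add: d_def)
  have d_0: "d 0 = d0" and d_1: "d 1 = d1" using d0 d1 by (auto simp: d_def \<delta>_def intro!: eq_vecI)
  have d_shift: "d (t + e) = d t + e \<cdot>\<^sub>v \<delta>" for t e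
    using d0 \<delta>c by (intro eq_vecI) (auto simp: d_def algebra_simps)
  have "\<forall>B\<in>{B. is_basis G B}. \<exists>w. w \<in> carrier_vec ?D \<and> (\<forall>i\<in>B. (G *\<^sub>v w) $ i = d0 $ i)"
    using basis_solution_exists[of G _ d0] unfolding dims by blast
  from bchoice[OF this] obtain a where
    a: "\<And>B. is_basis G B \<Longrightarrow> a B \<in> carrier_vec ?D \<and> (\<forall>i\<in>B. (G *\<^sub>v a B) $ i = d0 $ i)"
    by auto
  have "\<forall>B\<in>{B. is_basis G B}. \<exists>w. w \<in> carrier_vec ?D \<and> (\<forall>i\<in>B. (G *\<^sub>v w) $ i = \<delta> $ i)"
    using basis_solution_exists[of G _ \<delta>] unfolding dims by blast
  from bchoice[OF this] obtain b where
    b: "\<And>B. is_basis G B \<Longrightarrow> b B \<in> carrier_vec ?D \<and> (\<forall>i\<in>B. (G *\<^sub>v b B) $ i = \<delta> $ i)"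
    by auto
  define z where "z = (\<lambda>B t. a B + t \<cdot>\<^sub>v b B)"
  have Br: "B \<subseteq> {..<r}" if "is_basis G B" for B using that dims by (simp add: is_basis_def)
  have zc: "z B t \<in> carrier_vec ?D" if "is_basis G B" for B t using a[OF that] b[OF that] by (simp add: z_def)
  have Gz: "(G *\<^sub>v z B t) $ i = (G *\<^sub>v a B) $ i + t * (G *\<^sub>v b B) $ i" if "is_basis G B" "i < r" for B t i
    unfolding z_def using a[OF that(1)] b[OF that(1)] that(2) dims by (intro mult_mat_vec_line) auto
  have zB: "(G *\<^sub>v z B t) $ i = d t $ i" if B: "is_basis G B" and i: "i \<in> B" for B t i
  proof -
    have "i < r" using Br[OF B] i by auto
    then show ?thesis using Gz[OF B, of i t] di[of i t] a[OF B] b[OF B] i by simp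
  qed
  have zu: "z B t = y" if B: "is_basis G B" and y: "y \<in> carrier_vec ?D" "\<And>i. i \<in> B \<Longrightarrow> (G *\<^sub>v y) $ i = d t $ i" for B t y
    using trivial_kernel_on_unique[OF basis_trivial_kernel[OF B], of "z B t" y] zB[OF B] zc[OF B] Br[OF B] y dims
    by simp
  define T where "T = (\<lambda>B. {t \<in> {0..1}. lp_optimal (d t) G p (z B t) \<and>
      (\<forall>i\<in>{1..N}. eucl_norm (vec_block n (z B t) i - vec_block n z0 i) \<le> t * C i)})"
  define R where "R = (\<Union>B\<in>{B. is_basis G B}. T B)"
  have finB: "finite {B. is_basis G B}"
    by (rule finite_subset[of _ "Pow {..<r}"]) (use Br in auto)
  have z0c: "z0 \<in> carrier_vec ?D" using z0 dims by (auto simp: lp_optimal_def lp_feasible_def)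
  have zero: "0 \<in> R"
  proof -
    obtain B where B: "B \<subseteq> active_rows G d0 {..<r} z0" "is_basis G B"
      using basis_in_trivial_kernel[OF ker] dims by (auto simp: active_rows_def)
    have "z B 0 = z0"
      by (rule zu[OF B(2) z0c]) (use B(1) d_0 in \<open>auto simp: active_rows_def\<close>)
    then have "0 \<in> T B" using z0 by (simp add: T_def d_0 eucl_norm_L2_set L2_set_def)
    then show ?thesis using B(2) by (auto simp: R_def)
  qed
  have ext: "\<exists>t'\<in>R. t < t'" if t: "t \<in> R" "t < 1" for t
  proof -
    obtain B where B: "is_basis G B" "t \<in> T B" using t by (auto simp: R_def)
    have opt: "lp_optimal (d t) G p (z B t)" and t01: "0 \<le> t"
      and bd: "\<And>i. i \<in> {1..N} \<Longrightarrow> eucl_norm (vec_block n (z B t) i - vec_block n z0 i) \<le> t * C i"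
      using B(2) by (auto simp: T_def)
    have "B \<subseteq> active_rows G (d t) {..<dim_row G} (z B t)"
      using zB[OF B(1)] Br[OF B(1)] dims by (auto simp: active_rows_def)
    then have ker': "trivial_kernel_on G (active_rows G (d t) {..<dim_row G} (z B t))"
      using basis_trivial_kernel[OF B(1)] unfolding trivial_kernel_on_def by blast
    obtain y where y: "y \<in> lp_feasible d1 G" using feas by blast
    have y': "y \<in> lp_feasible (d t + (1 - t) \<cdot>\<^sub>v \<delta>) G" using y d_shift[of t "1 - t"] d_1 by simp
    obtain w B' e where w: "w \<in> carrier_vec ?D" "is_basis G B'" "0 < e" "e \<le> 1 - t"
      "lp_optimal (d t + e \<cdot>\<^sub>v \<delta>) G p (z B t + e \<cdot>\<^sub>v w)"
      "\<And>i. i \<in> B' \<Longrightarrow> (G *\<^sub>v w) $ i = \<delta> $ i" "\<And>i. i \<in> B' \<Longrightarrow> (G *\<^sub>v z B t) $ i = d t $ i"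
      using optimal_vertex_step[OF _ ddim _ opt ker' _ y'] p \<delta>c dims t(2) by auto
    have new: "z B' (t + e) = z B t + e \<cdot>\<^sub>v w"
    proof (rule zu[OF w(2)])
      show "z B t + e \<cdot>\<^sub>v w \<in> carrier_vec ?D" using zc[OF B(1)] w(1) by simp
      fix i assume i: "i \<in> B'"
      then have ir: "i < r" using Br[OF w(2)] by auto
      have "(G *\<^sub>v (z B t + e \<cdot>\<^sub>v w)) $ i = (G *\<^sub>v z B t) $ i + e * (G *\<^sub>v w) $ i"
        using zc[OF B(1)] w(1) ir dims by (intro mult_mat_vec_line) auto
      then show "(G *\<^sub>v (z B t + e \<cdot>\<^sub>v w)) $ i = d (t + e) $ i"
        using w(6,7)[OF i] \<delta>c ir by (simp add: d_shift del: index_mult_mat_vec)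
    qed
    have opt': "lp_optimal (d (t + e)) G p (z B' (t + e))" using w(5) by (simp add: d_shift new)
    have "B' \<in> optimal_bases G p" using optimal_basisI[OF w(2) ddim opt' zB[OF w(2)]] .
    then have wC: "eucl_norm (vec_block n w i) \<le> C i" if "i \<in> {1..N}" for i
      using rate[OF _ w(1) _ that] w(6) by (simp add: \<delta>_def)
    have "eucl_norm (vec_block n (z B' (t + e)) i - vec_block n z0 i) \<le> (t + e) * C i"
      if i: "i \<in> {1..N}" for i
    proof -
      have "vec_block n (z B' (t + e)) i = vec_block n (z B t) i + e \<cdot>\<^sub>v vec_block n w i"
        unfolding new using vec_block_add[OF i zc[OF B(1)] w(1)] .
      then have "vec_block n (z B' (t + e)) i - vec_block n z0 i =
          (vec_block n (z B t) i - vec_block n z0 i) + e \<cdot>\<^sub>v vec_block n w i"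
        by (intro eq_vecI) (auto simp: vec_block_def)
      then have "eucl_norm (vec_block n (z B' (t + e)) i - vec_block n z0 i) \<le>
          eucl_norm (vec_block n (z B t) i - vec_block n z0 i) + eucl_norm (e \<cdot>\<^sub>v vec_block n w i)"
        using eucl_norm_triangle[of "vec_block n (z B t) i - vec_block n z0 i" n "e \<cdot>\<^sub>v vec_block n w i"] by simp
      also have "\<dots> \<le> t * C i + e * C i"
        using bd[OF i] wC[OF i] w(3) by (intro add_mono) (auto simp: eucl_norm_smult)
      finally show ?thesis by (simp add: algebra_simps)
    qed
    then have "t + e \<in> T B'" using opt' t01 w(3,4) by (auto simp: T_def)
    then have "t + e \<in> R" using w(2) unfolding R_def by blast
    then show ?thesis using w(3) by (intro bexI[of _ "t + e"]) auto
  qed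
  have bddR: "bdd_above R" by (rule bdd_aboveI[of _ 1]) (auto simp: R_def T_def)
  define s where "s = Sup R"
  have s0: "0 \<le> s" unfolding s_def by (rule cSup_upper[OF zero bddR])
  have s1: "s \<le> 1" 
  proof -
    have "t \<le> 1" if "t \<in> R" for t using that by (auto simp: R_def T_def)
    moreover have "R \<noteq> {}" using zero by blast
    ultimately show ?thesis unfolding s_def by (intro cSup_least)
  qed
  have sup: "t \<le> s" if "t \<in> R" for t unfolding s_def by (rule cSup_upper[OF that bddR])
  have "s \<in> R"
  proof (cases "s = 0")
    case True
    show ?thesis using zero unfolding True .
  next
    case False
    then have spos: "0 < s" using s0 by simp
    have "\<exists>B. is_basis G B \<and> (\<forall>e>0. \<exists>t\<in>T B. \<bar>t - s\<bar> < e)"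
    proof (rule ccontr)
      assume "\<not> ?thesis"
      then obtain e where e: "\<And>B. is_basis G B \<Longrightarrow> 0 < e B \<and> (\<forall>t\<in>T B. \<not> \<bar>t - s\<bar> < (e B :: real))"
        by metis
      let ?E = "e ` {B. is_basis G B}"
      have neE: "?E \<noteq> {}" using zero by (auto simp: R_def)
      have "0 < Min ?E" using finB neE e by simp
      then obtain t where t: "t \<in> R" "s - Min ?E < t"
        using less_cSupD[of R "s - Min ?E"] zero by (auto simp: s_def)
      obtain B where B: "is_basis G B" "t \<in> T B" using t(1) by (auto simp: R_def)
      have "Min ?E \<le> e B" using finB B(1) by simp
      then have "\<bar>t - s\<bar> < e B" using t(2) sup[OF t(1)] by simp
      then show False using e[OF B(1)] B(2) by blast
    qed
    then obtain B where B: "is_basis G B" and acc: "\<And>e. 0 < e \<Longrightarrow> \<exists>t\<in>T B. \<bar>t - s\<bar> < e" by blast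
    have ts: "t \<le> s" if "t \<in> T B" for t using sup[of t] that B by (auto simp: R_def)
    have feas_s: "d s $ i \<le> (G *\<^sub>v z B s) $ i" if i: "i < r" for i
    proof -
      have "0 \<le> ((G *\<^sub>v a B) $ i + s * (G *\<^sub>v b B) $ i) - (d0 $ i + s * \<delta> $ i)"
      proof (rule isCont_nonneg_limit[where X = "T B" and x = s
        and f = "\<lambda>s. ((G *\<^sub>v a B) $ i + s * (G *\<^sub>v b B) $ i) - (d0 $ i + s * \<delta> $ i)"])
        fix t assume "t \<in> T B"
        then have "z B t \<in> satisfying G (d t) {..<r}"
          using lp_optimal_iff[OF ddim] dims by (auto simp: T_def)
        then have "d t $ i \<le> (G *\<^sub>v z B t) $ i" using i by (auto simp: satisfying_def)
        then show "0 \<le> ((G *\<^sub>v a B) $ i + t * (G *\<^sub>v b B) $ i) - (d0 $ i + t * \<delta> $ i)"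
          by (simp only: di[OF i] Gz[OF B i])
      qed (use acc in \<open>auto intro!: continuous_intros\<close>)
      then show ?thesis by (simp only: di[OF i] Gz[OF B i])
    qed
    have opt_s: "p \<bullet> z B s \<le> p \<bullet> y" if y: "y \<in> satisfying G (d s) {..<r}" for y
    proof -
      have yc: "y \<in> carrier_vec ?D" using y dims by (simp add: satisfying_def)
      have pz: "p \<bullet> z B t = p \<bullet> a B + t * (p \<bullet> b B)" for t
        unfolding z_def using a[OF B] b[OF B] by (intro scalar_prod_line[OF p]) auto
      have "0 \<le> (p \<bullet> z0 + s / s * (p \<bullet> y - p \<bullet> z0)) - (p \<bullet> a B + s * (p \<bullet> b B))"
      proof (rule isCont_nonneg_limit[where X = "T B" and x = s
        and f = "\<lambda>t. (p \<bullet> z0 + t / s * (p \<bullet> y - p \<bullet> z0)) - (p \<bullet> a B + t * (p \<bullet> b B))"])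
        fix t assume t: "t \<in> T B"
        define q where "q = t / s"
        have q: "0 \<le> q" "q \<le> 1" using t ts[OF t] spos by (auto simp: q_def T_def)
        \<comment> \<open>A competitor \<open>y\<close> at time \<open>s\<close> gives a competitor at each earlier time \<open>t\<close> by interpolation
          with \<open>z0\<close>, which is feasible at time 0.\<close>
        define x where "x = z0 + q \<cdot>\<^sub>v (y - z0)"
        have ymz: "y - z0 \<in> carrier_vec ?D" using yc z0c by simp
        have xc: "x \<in> carrier_vec ?D" using z0c ymz by (simp add: x_def)
        have "d t $ i \<le> (G *\<^sub>v x) $ i" if i: "i < r" for i
        proof -
          have "(G *\<^sub>v x) $ i = (G *\<^sub>v z0) $ i + q * (G *\<^sub>v (y - z0)) $ i"
            unfolding x_def using z0c ymz i dims by (intro mult_mat_vec_line) auto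
          also have "(G *\<^sub>v (y - z0)) $ i = (G *\<^sub>v y) $ i - (G *\<^sub>v z0) $ i"
            using mult_mat_vec_scaled_diff[of y G z0 i 1] yc z0c i dims by simp
          finally have eq: "(G *\<^sub>v x) $ i = (1 - q) * (G *\<^sub>v z0) $ i + q * (G *\<^sub>v y) $ i"
            by (simp add: algebra_simps)
          have "d0 $ i \<le> (G *\<^sub>v z0) $ i"
            using z0 lp_optimal_iff[of d0 G p z0] d0 dims i by (auto simp: satisfying_def)
          moreover have "d s $ i \<le> (G *\<^sub>v y) $ i" using y i by (auto simp: satisfying_def)
          ultimately have "(1 - q) * d0 $ i + q * d s $ i \<le> (G *\<^sub>v x) $ i"
            unfolding eq using q by (intro add_mono mult_left_mono) auto
          moreover have "(1 - q) * d0 $ i + q * d s $ i = d t $ i"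
            using spos i by (simp add: di q_def field_simps)
          ultimately show ?thesis by simp
        qed
        then have "x \<in> satisfying G (d t) {..<r}" using xc dims by (auto simp: satisfying_def)
        then have "p \<bullet> z B t \<le> p \<bullet> x"
          using t lp_optimal_iff[OF ddim] dims by (auto simp: T_def)
        also have "p \<bullet> x = p \<bullet> z0 + q * (p \<bullet> (y - z0))"
          unfolding x_def by (rule scalar_prod_line[OF p z0c ymz])
        also have "p \<bullet> (y - z0) = p \<bullet> y - p \<bullet> z0"
          using scalar_prod_minus_distrib[OF p yc z0c] .
        finally show "0 \<le> (p \<bullet> z0 + t / s * (p \<bullet> y - p \<bullet> z0)) - (p \<bullet> a B + t * (p \<bullet> b B))"
          by (simp add: pz q_def)
      qed (use acc spos in \<open>auto intro!: continuous_intros\<close>)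
      then show ?thesis using spos by (simp add: pz)
    qed
    have bd_s: "eucl_norm (vec_block n (z B s) i - vec_block n z0 i) \<le> s * C i" if i: "i \<in> {1..N}" for i
    proof -
      let ?u = "vec_block n (a B) i - vec_block n z0 i" and ?v = "vec_block n (b B) i"
      have eq: "vec_block n (z B t) i - vec_block n z0 i = ?u + t \<cdot>\<^sub>v ?v" for t
      proof -
        have "vec_block n (z B t) i = vec_block n (a B) i + t \<cdot>\<^sub>v vec_block n (b B) i"
          unfolding z_def using a[OF B] b[OF B] by (intro vec_block_add[OF i]) auto
        then show ?thesis by (intro eq_vecI) (auto simp: vec_block_def)
      qed
      have "0 \<le> s * C i - eucl_norm (?u + s \<cdot>\<^sub>v ?v)"
      proof (rule isCont_nonneg_limit[where X = "T B" and x = s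
        and f = "\<lambda>t. t * C i - eucl_norm (?u + t \<cdot>\<^sub>v ?v)"])
        show "isCont (\<lambda>t. t * C i - eucl_norm (?u + t \<cdot>\<^sub>v ?v)) s"
          by (intro continuous_intros isCont_eucl_norm_line[of _ n]) auto
        show "0 \<le> t * C i - eucl_norm (?u + t \<cdot>\<^sub>v ?v)" if "t \<in> T B" for t
        proof -
          have "eucl_norm (vec_block n (z B t) i - vec_block n z0 i) \<le> t * C i"
            using that i unfolding T_def by blast
          then show ?thesis unfolding eq by simp
        qed
      qed (use acc in auto)
      then show ?thesis by (simp add: eq)
    qed
    have "z B s \<in> satisfying G (d s) {..<r}" using feas_s zc[OF B] dims by (auto simp: satisfying_def)
    then have "lp_optimal (d s) G p (z B s)" using opt_s lp_optimal_iff[OF ddim] dims by simp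
    then have "s \<in> T B" using bd_s s0 s1 by (simp add: T_def)
    then show ?thesis using B by (auto simp: R_def)
  qed
  then have "s = 1" using ext[of s] sup s1 by force
  then have "1 \<in> R" using \<open>s \<in> R\<close> by simp
  then obtain B where "1 \<in> T B" by (auto simp: R_def)
  then show ?thesis by (intro exI[of _ "z B 1"]) (auto simp: T_def d_1)
qed

section \<open>The stage matrices\<close>

lemma index_append_rows:
  assumes "i < dim_row A + dim_row B" "j < dim_col A"
  shows "(A @\<^sub>r B) $$ (i, j) = (if i < dim_row A then A $$ (i, j) else B $$ (i - dim_row A, j))"
  using assms by (simp add: append_rows_def)

lemma dim_append_rows [simp]:
  "dim_row (A @\<^sub>r B) = dim_row A + dim_row B" "dim_col (A @\<^sub>r B) = dim_col A"
  by (simp_all add: append_rows_def)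

lemma index_append_cols:
  assumes "i < dim_row A" "j < dim_col A + dim_col B"
  shows "append_cols A B $$ (i, j) = (if j < dim_col A then A $$ (i, j) else B $$ (i, j - dim_col A))"
  using assms by (simp add: append_cols_def)

lemma dim_append_cols [simp]:
  "dim_row (append_cols A B) = dim_row A" "dim_col (append_cols A B) = dim_col A + dim_col B"
  by (simp_all add: append_cols_def)

text \<open>
  Writing the row number as an offset plus \<open>t\<close>, with the offset associated to the right as the
  block rows are, lets rewriting select the block row without case distinctions.
\<close>

lemma diag_stage_index:
  assumes E: "E \<in> carrier_mat nw nx" and F: "F \<in> carrier_mat nw nu" and c: "c < nx + nu"
  shows "t < nx \<Longrightarrow> diag_stage nx nu E F $$ (t, c) = (if c = t then 1 else 0)"
    and "t < nx \<Longrightarrow> diag_stage nx nu E F $$ (nx + t, c) = (if c = t then -1 else 0)"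
    and "t < nw \<Longrightarrow> diag_stage nx nu E F $$ (nx + (nx + t), c) = append_cols E F $$ (t, c)"
    and "t < nw \<Longrightarrow> diag_stage nx nu E F $$ (nx + (nx + (nw + t)), c) = - append_cols E F $$ (t, c)"
    and "t < nx \<Longrightarrow> diag_stage nx nu E F $$ (nx + (nx + (nw + (nw + t))), c) = (if c = t then 1 else 0)"
    and "t < nx \<Longrightarrow> diag_stage nx nu E F $$ (nx + (nx + (nw + (nw + (nx + t)))), c) = (if c = t then -1 else 0)"
    and "t < nu \<Longrightarrow> diag_stage nx nu E F $$ (nx + (nx + (nw + (nw + (nx + (nx + t))))), c) = (if c = nx + t then 1 else 0)"
    and "t < nu \<Longrightarrow> diag_stage nx nu E F $$ (nx + (nx + (nw + (nw + (nx + (nx + (nu + t)))))), c) = (if c = nx + t then -1 else 0)"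
  using assms by (auto simp: diag_stage_def index_append_rows index_append_cols)

lemma stage_row_cases:
  fixes s nx nu nw :: nat
  assumes "s < 4 * nx + 2 * nu + 2 * nw"
  obtains t where "s = t" "t < nx"
    | t where "s = nx + t" "t < nx"
    | t where "s = nx + (nx + t)" "t < nw"
    | t where "s = nx + (nx + (nw + t))" "t < nw"
    | t where "s = nx + (nx + (nw + (nw + t)))" "t < nx"
    | t where "s = nx + (nx + (nw + (nw + (nx + t))))" "t < nx"
    | t where "s = nx + (nx + (nw + (nw + (nx + (nx + t)))))" "t < nu"
    | t where "s = nx + (nx + (nw + (nw + (nx + (nx + (nu + t))))))" "t < nu"
proof -
  consider "s < nx" | "nx \<le> s" "s < 2 * nx" | "2 * nx \<le> s" "s < 2 * nx + nw"
    | "2 * nx + nw \<le> s" "s < 2 * nx + 2 * nw" | "2 * nx + 2 * nw \<le> s" "s < 3 * nx + 2 * nw"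
    | "3 * nx + 2 * nw \<le> s" "s < 4 * nx + 2 * nw" | "4 * nx + 2 * nw \<le> s" "s < 4 * nx + 2 * nw + nu"
    | "4 * nx + 2 * nw + nu \<le> s" by linarith
  then show thesis
  proof cases
    case 1
    show thesis by (rule that(1)[of "s - 0"]) (use 1 assms in linarith)+
  next
    case 2
    show thesis by (rule that(2)[of "s - nx"]) (use 2 assms in linarith)+
  next
    case 3
    show thesis by (rule that(3)[of "s - 2 * nx"]) (use 3 assms in linarith)+
  next
    case 4
    show thesis by (rule that(4)[of "s - (2 * nx + nw)"]) (use 4 assms in linarith)+
  next
    case 5
    show thesis by (rule that(5)[of "s - (2 * nx + 2 * nw)"]) (use 5 assms in linarith)+
  next
    case 6
    show thesis by (rule that(6)[of "s - (3 * nx + 2 * nw)"]) (use 6 assms in linarith)+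
  next
    case 7
    show thesis by (rule that(7)[of "s - (4 * nx + 2 * nw)"]) (use 7 assms in linarith)+
  next
    case 8
    show thesis by (rule that(8)[of "s - (4 * nx + 2 * nw + nu)"]) (use 8 assms in linarith)+
  qed
qed

lemma sub_stage_index:
  assumes A: "A \<in> carrier_mat nx nx" and B: "B \<in> carrier_mat nx nu" and c: "c < nx + nu"
  shows "t < nx \<Longrightarrow> sub_stage nx nu nw A B $$ (t, c) = - append_cols A B $$ (t, c)"
    and "t < nx \<Longrightarrow> sub_stage nx nu nw A B $$ (nx + t, c) = append_cols A B $$ (t, c)"
    and "t < 2 * nx + 2 * nu + 2 * nw \<Longrightarrow> sub_stage nx nu nw A B $$ (nx + (nx + t), c) = 0"
  using assms
  by (simp_all add: sub_stage_def index_append_rows index_append_cols)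

lemma dim_diag_stage:
  assumes "E \<in> carrier_mat nw nx" "F \<in> carrier_mat nw nu"
  shows "diag_stage nx nu E F \<in> carrier_mat (4 * nx + 2 * nu + 2 * nw) (nx + nu)"
  using assms unfolding diag_stage_def by (intro carrier_matI) auto

lemma dim_sub_stage:
  assumes "A \<in> carrier_mat nx nx" "B \<in> carrier_mat nx nu"
  shows "sub_stage nx nu nw A B \<in> carrier_mat (4 * nx + 2 * nu + 2 * nw) (nx + nu)"
  using assms unfolding sub_stage_def by (intro carrier_matI) auto

text \<open>
  The block rows of a stage form four pairs, each consisting of a block and its negative. Row
  \<open>opposite_row s\<close> is the negative of row \<open>s\<close>, simultaneously in the diagonal and
  in the subdiagonal stage block.
\<close>

definition opposite_row :: "nat \<Rightarrow> nat \<Rightarrow> nat \<Rightarrow> nat \<Rightarrow> nat" where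
  "opposite_row nx nu nw s =
     (if s < nx then s + nx
      else if s < 2 * nx then s - nx
      else if s < 2 * nx + nw then s + nw
      else if s < 2 * nx + 2 * nw then s - nw
      else if s < 3 * nx + 2 * nw then s + nx
      else if s < 4 * nx + 2 * nw then s - nx
      else if s < 4 * nx + 2 * nw + nu then s + nu
      else s - nu)"

lemma opposite_row_less:
  "s < 4 * nx + 2 * nu + 2 * nw \<Longrightarrow> opposite_row nx nu nw s < 4 * nx + 2 * nu + 2 * nw"
  by (auto simp: opposite_row_def)

lemma opposite_row_offsets:
  shows "t < nx \<Longrightarrow> opposite_row nx nu nw (t) = nx + t"
    and "t < nx \<Longrightarrow> opposite_row nx nu nw (nx + t) = t"
    and "t < nw \<Longrightarrow> opposite_row nx nu nw (nx + (nx + t)) = nx + (nx + (nw + t))"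
    and "t < nw \<Longrightarrow> opposite_row nx nu nw (nx + (nx + (nw + t))) = nx + (nx + t)"
    and "t < nx \<Longrightarrow> opposite_row nx nu nw (nx + (nx + (nw + (nw + t)))) = nx + (nx + (nw + (nw + (nx + t))))"
    and "t < nx \<Longrightarrow> opposite_row nx nu nw (nx + (nx + (nw + (nw + (nx + t))))) = nx + (nx + (nw + (nw + t)))"
    and "t < nu \<Longrightarrow> opposite_row nx nu nw (nx + (nx + (nw + (nw + (nx + (nx + t)))))) = nx + (nx + (nw + (nw + (nx + (nx + (nu + t))))))"
    and "t < nu \<Longrightarrow> opposite_row nx nu nw (nx + (nx + (nw + (nw + (nx + (nx + (nu + t))))))) = nx + (nx + (nw + (nw + (nx + (nx + t)))))"
  by (simp_all add: opposite_row_def)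

lemma diag_stage_opposite:
  assumes E: "E \<in> carrier_mat nw nx" and F: "F \<in> carrier_mat nw nu"
    and s: "s < 4 * nx + 2 * nu + 2 * nw" and c: "c < nx + nu"
  shows "diag_stage nx nu E F $$ (opposite_row nx nu nw s, c) = - diag_stage nx nu E F $$ (s, c)"
  by (cases rule: stage_row_cases[OF s])
    (simp_all add: opposite_row_offsets diag_stage_index[OF E F c])

lemma sub_stage_opposite:
  assumes A: "A \<in> carrier_mat nx nx" and B: "B \<in> carrier_mat nx nu"
    and s: "s < 4 * nx + 2 * nu + 2 * nw" and c: "c < nx + nu"
  shows "sub_stage nx nu nw A B $$ (opposite_row nx nu nw s, c) = - sub_stage nx nu nw A B $$ (s, c)"
  by (cases rule: stage_row_cases[OF s])
    (simp_all add: opposite_row_offsets sub_stage_index[OF A B c])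

text \<open>
  The row of a stage that states the lower bound of variable \<open>c\<close>; the states occupy the fifth block
  row and the controls the seventh, which explains the different offsets.
\<close>

definition bound_row :: "nat \<Rightarrow> nat \<Rightarrow> nat \<Rightarrow> nat" where
  "bound_row nx nw c = (if c < nx then 2 * nx + 2 * nw + c else 3 * nx + 2 * nw + c)"

lemma bound_row_less: "c < nx + nu \<Longrightarrow> bound_row nx nw c < 4 * nx + 2 * nu + 2 * nw"
  by (auto simp: bound_row_def)

context
  fixes nx nu nw N n m :: nat and A B E F :: "nat \<Rightarrow> real mat"
  assumes m: "m = 4 * nx + 2 * nu + 2 * nw" and n: "n = nx + nu"
    and A: "\<And>i. i \<in> {1..N - 1} \<Longrightarrow> A i \<in> carrier_mat nx nx"
    and B: "\<And>i. i \<in> {1..N - 1} \<Longrightarrow> B i \<in> carrier_mat nx nu"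
    and E: "\<And>i. i \<in> {1..N} \<Longrightarrow> E i \<in> carrier_mat nw nx"
    and F: "\<And>i. i \<in> {1..N} \<Longrightarrow> F i \<in> carrier_mat nw nu"
begin

lemma stage_block_carrier:
  assumes i: "i \<in> {1..N}"
  shows "stage_block nx nu nw A B E F i j \<in> carrier_mat m n"
proof -
  have "2 \<le> i \<Longrightarrow> i - 1 \<in> {1..N - 1}" using i by auto
  then show ?thesis
    using dim_diag_stage[OF E[OF i] F[OF i]] dim_sub_stage[OF A B, of "i - 1" "i - 1"]
    unfolding stage_block_def m n by auto
qed

lemma stage_block_opposite:
  assumes i: "i \<in> {1..N}" and s: "s < m" and c: "c < n"
  shows "stage_block nx nu nw A B E F i j $$ (opposite_row nx nu nw s, c) =
    - stage_block nx nu nw A B E F i j $$ (s, c)"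
proof -
  have i1: "2 \<le> i \<Longrightarrow> i - 1 \<in> {1..N - 1}" using i by auto
  have s': "s < 4 * nx + 2 * nu + 2 * nw" and c': "c < nx + nu" using s c m n by auto
  note o = opposite_row_less[OF s']
  consider "j = i" | "j \<noteq> i" "2 \<le> i" "j = i - 1" | "j \<noteq> i" "\<not> (2 \<le> i \<and> j = i - 1)" by blast
  then show ?thesis
  proof cases
    case 1
    then show ?thesis using diag_stage_opposite[OF E[OF i] F[OF i] s' c'] by (simp add: stage_block_def)
  next
    case 2
    then show ?thesis using sub_stage_opposite[OF A B s' c', of "i - 1" "i - 1"] i1
      by (simp add: stage_block_def)
  next
    case 3
    then have "stage_block nx nu nw A B E F i j = 0\<^sub>m (4 * nx + 2 * nu + 2 * nw) (nx + nu)"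
      by (auto simp: stage_block_def)
    then show ?thesis using s' c' o by simp
  qed
qed

lemma stage_block_bound_row:
  assumes i: "i \<in> {1..N}" and b: "b < n" and c: "c < n"
  shows "stage_block nx nu nw A B E F i j $$ (bound_row nx nw b, c) = (if j = i \<and> c = b then 1 else 0)"
proof -
  have i1: "2 \<le> i \<Longrightarrow> i - 1 \<in> {1..N - 1}" using i by auto
  have c': "c < nx + nu" and b': "b < nx + nu" using b c n by auto
  note s' = bound_row_less[OF b', of nw]
  consider "j = i" | "j \<noteq> i" "2 \<le> i" "j = i - 1" | "j \<noteq> i" "\<not> (2 \<le> i \<and> j = i - 1)" by blast
  then show ?thesis
  proof cases
    case 1
    note idx = diag_stage_index[OF E[OF i] F[OF i] c']
    have "diag_stage nx nu (E i) (F i) $$ (bound_row nx nw b, c) = (if c = b then 1 else 0)"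
    proof (cases "b < nx")
      case True
      then have "bound_row nx nw b = nx + (nx + (nw + (nw + b)))" by (simp add: bound_row_def)
      then show ?thesis using True by (simp add: idx)
    next
      case False
      then have br: "bound_row nx nw b = nx + (nx + (nw + (nw + (nx + (nx + (b - nx))))))"
        by (simp add: bound_row_def)
      have "b - nx < nu" using False b' by simp
      from idx(7)[OF this] show ?thesis unfolding br using False by simp
    qed
    then show ?thesis using 1 by (simp add: stage_block_def)
  next
    case 2
    have "sub_stage nx nu nw (A (i - 1)) (B (i - 1)) $$ (bound_row nx nw b, c) = 0"
    proof -
      have "bound_row nx nw b = nx + (nx + (bound_row nx nw b - 2 * nx))" by (simp add: bound_row_def)
      then show ?thesis using sub_stage_index(3)[OF A[OF i1[OF 2(2)]] B[OF i1[OF 2(2)]] c', of "bound_row nx nw b - 2 * nx"]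
        using s' by simp
    qed
    then show ?thesis using 2 by (simp add: stage_block_def)
  next
    case 3
    then have "stage_block nx nu nw A B E F i j = 0\<^sub>m (4 * nx + 2 * nu + 2 * nw) (nx + nu)"
      by (auto simp: stage_block_def)
    then show ?thesis using s' c' 3 by simp
  qed
qed

end

lemma block_mat_mult_vec:
  fixes Gb :: "nat \<Rightarrow> nat \<Rightarrow> real mat"
  assumes Gb: "\<And>j. Gb i j \<in> carrier_mat m n"
    and i: "i \<in> {1..N}" and s: "s < m" and z: "z \<in> carrier_vec (n * N)"
  shows "(block_mat N m n Gb *\<^sub>v z) $ ((i - 1) * m + s) =
           (\<Sum>j\<in>{1..N}. (Gb i j *\<^sub>v vec_block n z j) $ s)"
proof -
  have r: "(i - 1) * m + s < m * N" by (rule block_index_less[OF i s])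
  have rdiv: "((i - 1) * m + s) div m + 1 = i" "((i - 1) * m + s) mod m = s" using i s by auto
  have "(block_mat N m n Gb *\<^sub>v z) $ ((i - 1) * m + s) =
      (\<Sum>c<n * N. Gb i (c div n + 1) $$ (s, c mod n) * z $ c)"
    using r z rdiv by (simp add: block_mat_def scalar_prod_def lessThan_atLeast0)
  also have "\<dots> = (\<Sum>j\<in>{1..N}. \<Sum>c<n. Gb i j $$ (s, c) * z $ ((j - 1) * n + c))"
    unfolding sum_blocks by (intro sum.cong refl) auto
  also have "\<dots> = (\<Sum>j\<in>{1..N}. (Gb i j *\<^sub>v vec_block n z j) $ s)"
  proof (rule sum.cong)
    fix j assume "j \<in> {1..N}"
    then show "(\<Sum>c<n. Gb i j $$ (s, c) * z $ ((j - 1) * n + c)) = (Gb i j *\<^sub>v vec_block n z j) $ s"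
      using Gb[of j] s by (simp add: vec_block_def scalar_prod_def lessThan_atLeast0)
  qed simp
  finally show ?thesis .
qed

lemma stage_residual_eq_vec_block:
  assumes Gb: "\<And>i j. i \<in> {1..N} \<Longrightarrow> Gb i j \<in> carrier_mat m n"
    and zero: "\<And>i j. i \<in> {1..N} \<Longrightarrow> j \<noteq> i \<Longrightarrow> j + 1 \<noteq> i \<Longrightarrow> Gb i j = 0\<^sub>m m n"
    and i: "i \<in> {1..N}" and d: "d \<in> carrier_vec (m * N)" and z: "z \<in> carrier_vec (n * N)"
  shows "stage_residual m n Gb d z i = vec_block m (d - block_mat N m n Gb *\<^sub>v z) i"
proof (rule eq_vecI)
  have dims: "dim_row (Gb i j) = m" for j using Gb[OF i] by auto
  show "dim_vec (stage_residual m n Gb d z i) = dim_vec (vec_block m (d - block_mat N m n Gb *\<^sub>v z) i)"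
    using i dims by (simp add: stage_residual_def vec_block_def)
  fix s assume "s < dim_vec (vec_block m (d - block_mat N m n Gb *\<^sub>v z) i)"
  then have s: "s < m" by (simp add: vec_block_def split: if_splits)
  let ?f = "\<lambda>j. (Gb i j *\<^sub>v vec_block n z j) $ s"
  have r: "(i - 1) * m + s < m * N" by (rule block_index_less[OF i s])
  have f0: "?f j = 0" if "j \<noteq> i" "j + 1 \<noteq> i" for j
    using zero[OF i that] s by (simp add: vec_block_def scalar_prod_def)
  have g0: "?f 0 = 0" using Gb[OF i, of 0] s by (simp add: vec_block_def scalar_prod_def)
  have "(\<Sum>j\<in>{1..N}. ?f j) = (\<Sum>j\<in>{i - 1, i}. ?f j)"
  proof (rule sum.mono_neutral_cong)
    fix j assume "j \<in> {1..N} - {i - 1, i}"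
    then show "?f j = 0" using f0[of j] by auto
  next
    fix j assume "j \<in> {i - 1, i} - {1..N}"
    then have "j = 0" using i by auto
    then show "?f j = 0" using g0 by simp
  qed auto
  also have "\<dots> = ?f (i - 1) + ?f i" using i by auto
  finally have "(block_mat N m n Gb *\<^sub>v z) $ ((i - 1) * m + s) = ?f (i - 1) + ?f i"
    unfolding block_mat_mult_vec[where Gb = Gb and i = i, OF Gb[OF i] i s z] .
  moreover have "vec_block m (d - block_mat N m n Gb *\<^sub>v z) i $ s =
      d $ ((i - 1) * m + s) - (block_mat N m n Gb *\<^sub>v z) $ ((i - 1) * m + s)"
    using i s r d by (simp add: vec_block_def block_mat_def del: index_mult_mat_vec)
  moreover have "stage_residual m n Gb d z i $ s = d $ ((i - 1) * m + s) - ?f (i - 1) - ?f i"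
    using i s dims by (simp add: stage_residual_def vec_block_def del: index_mult_mat_vec)
  ultimately show "stage_residual m n Gb d z i $ s = vec_block m (d - block_mat N m n Gb *\<^sub>v z) i $ s"
    by simp
qed

section \<open>Coarse grids and the coarsening matrices\<close>

lemma coarse_grid_step:
  assumes g: "coarse_grid N K M" and k: "k \<in> {1..K}"
  shows "M k < M (k + 1)"
proof (cases "k = K")
  case True
  have "M k \<in> {1..N}" using g k unfolding coarse_grid_def by blast
  then show ?thesis using g True by (simp add: coarse_grid_def)
next
  case False
  then show ?thesis using g k by (auto simp: coarse_grid_def strict_mono_on_def)
qed

lemma coarse_grid_mono:
  assumes g: "coarse_grid N K M" and "1 \<le> k" "k \<le> l" "l \<le> K + 1"
  shows "M k \<le> M l"
  using assms(3,4)
proof (induction l rule: dec_induct)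
  case (step l)
  then have "M l < M (l + 1)" using coarse_grid_step[OF g, of l] assms(2) by auto
  then show ?case using step by simp
qed simp

lemma coarse_grid_disjoint:
  assumes g: "coarse_grid N K M" and "k \<in> {1..K}" "l \<in> {1..K}"
    and "i \<in> {M k..<M (k + 1)}" "i \<in> {M l..<M (l + 1)}"
  shows "k = l"
proof (rule ccontr)
  assume "k \<noteq> l"
  then consider "k + 1 \<le> l" | "l + 1 \<le> k" by linarith
  then show False
  proof cases
    case 1
    then have "M (k + 1) \<le> M l" using coarse_grid_mono[OF g, of "k + 1" l] assms(3) by auto
    then show False using assms(4,5) by simp
  next
    case 2
    then have "M (l + 1) \<le> M k" using coarse_grid_mono[OF g, of "l + 1" k] assms(2) by auto
    then show False using assms(4,5) by simp
  qed
qed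

lemma coarse_grid_interval_subset:
  assumes g: "coarse_grid N K M" and k: "k \<in> {1..K}"
  shows "{M k..<M (k + 1)} \<subseteq> {1..N}"
proof -
  have "M 1 \<le> M k" "M (k + 1) \<le> M (K + 1)"
    using coarse_grid_mono[OF g, of 1 k] coarse_grid_mono[OF g, of "k + 1" "K + 1"] k by auto
  then show ?thesis using g by (auto simp: coarse_grid_def)
qed

lemma coarse_grid_cover:
  assumes g: "coarse_grid N K M" and i: "i \<in> {1..N}"
  obtains k where "k \<in> {1..K}" "i \<in> {M k..<M (k + 1)}"
proof -
  have "l \<le> K \<Longrightarrow> i < M (l + 1) \<Longrightarrow> \<exists>k\<in>{1..K}. i \<in> {M k..<M (k + 1)}" for l
  proof (induction l)
    case 0
    then show ?case using g i by (simp add: coarse_grid_def)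
  next
    case (Suc l)
    show ?case
    proof (cases "i < M (l + 1)")
      case True
      then show ?thesis using Suc by simp
    next
      case False
      then show ?thesis using Suc.prems by (intro bexI[of _ "Suc l"]) auto
    qed
  qed
  from this[of K] show thesis using that g i by (auto simp: coarse_grid_def)
qed

lemma grid_len_pos: "0 < grid_len M k" by (simp add: grid_len_def)

lemma grid_len_card:
  assumes "M k < M (k + 1)"
  shows "grid_len M k = M (k + 1) - M k" "{M k..grid_end M k} = {M k..<M (k + 1)}"
  using assms by (auto simp: grid_len_def grid_end_def)

lemma stacked_id_index:
  assumes "r < b * L" "c < b"
  shows "stacked_id b L $$ (r, c) = (if r mod b = c then 1 / sqrt (real L) else 0)"
  using assms by (simp add: stacked_id_def)

text \<open>
  Induction on the number of intervals. The intervals before \<open>k + 1\<close> cover exactly the stages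
  below \<open>M (k + 1)\<close>, which gives the number of rows of the leading part.
\<close>

lemma coarsening_mat_index_aux:
  assumes g: "coarse_grid N K M" and b: "0 < b" and "k \<le> K"
  shows "diag_block_mat (map (\<lambda>k. stacked_id b (grid_len M k)) [1..<k + 1]) =
    mat (b * (M (k + 1) - 1)) (b * k) (\<lambda>(r, c).
      if M (c div b + 1) \<le> r div b + 1 \<and> r div b + 1 < M (c div b + 2) \<and> r mod b = c mod b
      then 1 / sqrt (real (grid_len M (c div b + 1))) else 0)"
    (is "?D k = ?X k")
  using assms(3)
proof (induction k)
  case 0
  have "M 1 = 1" using g by (simp add: coarse_grid_def)
  then show ?case by (intro eq_matI) auto
next
  case (Suc k)
  then have IH: "?D k = ?X k" by simp
  let ?l = "grid_len M (Suc k)" and ?o = "M (k + 1) - 1"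
  have kK: "Suc k \<in> {1..K}" using Suc.prems by simp
  have step: "M (k + 1) < M (k + 2)" using coarse_grid_step[OF g kK] by simp
  have len: "?l = M (k + 2) - M (k + 1)" using grid_len_card(1)[of M "Suc k"] step by simp
  have M1: "1 \<le> M (k + 1)" using coarse_grid_interval_subset[OF g kK] step by auto
  have rows: "b * ?o + b * ?l = b * (M (k + 2) - 1)"
    using step M1 by (simp add: len flip: distrib_left)
  have "?D (Suc k) = four_block_mat (?X k) (0\<^sub>m (b * ?o) b) (0\<^sub>m (b * ?l) (b * k)) (stacked_id b ?l)"
    using diag_block_mat_last[of "map (\<lambda>k. stacked_id b (grid_len M k)) [1..<k + 1]" "stacked_id b ?l"]
    unfolding IH by (simp add: Let_def stacked_id_def)
  also have "\<dots> = ?X (Suc k)"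
  proof (rule eq_matI)
    fix r c assume "r < dim_row (?X (Suc k))" "c < dim_col (?X (Suc k))"
    then have r: "r < b * ?o + b * ?l" and c: "c < b * k + b" using rows by (simp_all add: algebra_simps)
    consider "r < b * ?o" "c < b * k" | "r < b * ?o" "b * k \<le> c"
      | "b * ?o \<le> r" "c < b * k" | "b * ?o \<le> r" "b * k \<le> c" by linarith
    then show "four_block_mat (?X k) (0\<^sub>m (b * ?o) b) (0\<^sub>m (b * ?l) (b * k)) (stacked_id b ?l) $$ (r, c)
        = ?X (Suc k) $$ (r, c)"
    proof cases
      case 1
      then show ?thesis using r c rows by (simp add: stacked_id_def)
    next
      case 2
      have "r div b < ?o" using 2 b by (simp add: div_less_iff_less_mult mult.commute)
      then have "\<not> M (k + 1) \<le> r div b + 1" by linarith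
      moreover have "c div b = k" using 2 c by (intro div_nat_eqI) auto
      ultimately show ?thesis using 2 r c rows by (simp add: stacked_id_def)
    next
      case 3
      have "?o \<le> r div b" using 3 b by (simp add: less_eq_div_iff_mult_less_eq mult.commute)
      moreover have "c div b < k" using 3 b by (simp add: div_less_iff_less_mult mult.commute)
      then have "M (c div b + 2) \<le> M (k + 1)"
        using coarse_grid_mono[OF g, of "c div b + 2" "k + 1"] kK by auto
      ultimately have "\<not> r div b + 1 < M (c div b + 2)" using M1 by linarith
      then show ?thesis using 3 r c rows by (simp add: stacked_id_def)
    next
      case 4
      have cd: "c div b = k" using 4 c by (intro div_nat_eqI) auto
      have cm: "c - b * k = c mod b" using minus_mult_div_eq_mod[of c b] cd by simp
      have "?o \<le> r div b" using 4 b by (simp add: less_eq_div_iff_mult_less_eq mult.commute)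
      moreover have "r div b < M (k + 2) - 1"
        using r rows b by (simp add: div_less_iff_less_mult mult.commute)
      moreover have "(r - b * ?o) mod b = r mod b"
        using 4(1) by (metis le_add_diff_inverse mod_mult_self4)
      moreover have "stacked_id b ?l $$ (r - b * ?o, c mod b) =
          (if (r - b * ?o) mod b = c mod b then 1 / sqrt (real ?l) else 0)"
        using 4 r b by (intro stacked_id_index) auto
      ultimately have "M (k + 1) \<le> r div b + 1" "r div b + 1 < M (k + 2)"
        and "stacked_id b ?l $$ (r - b * ?o, c mod b) =
          (if r mod b = c mod b then 1 / sqrt (real ?l) else 0)"
        using M1 by auto
      then have st: "stacked_id b ?l $$ (r - b * ?o, c - b * k) = ?X (Suc k) $$ (r, c)"
        using r c rows cd cm M1 by simp
      have "four_block_mat (?X k) (0\<^sub>m (b * ?o) b) (0\<^sub>m (b * ?l) (b * k)) (stacked_id b ?l) $$ (r, c)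
          = stacked_id b ?l $$ (r - b * ?o, c - b * k)"
        using 4 r c by (simp add: stacked_id_def)
      then show ?thesis using st by (rule trans)
    qed
  qed (use rows in \<open>simp_all add: stacked_id_def algebra_simps\<close>)
  finally show ?case .
qed

lemma coarsening_mat_carrier:
  assumes "coarse_grid N K M" "0 < b"
  shows "coarsening_mat b K M \<in> carrier_mat (b * N) (b * K)"
  using coarsening_mat_index_aux[OF assms, of K] assms
  by (simp add: coarsening_mat_def coarse_grid_def)

lemma coarsening_mat_index:
  assumes g: "coarse_grid N K M" and k: "k \<in> {1..K}" and i: "i \<in> {1..N}" and "s < b" "t < b"
  shows "coarsening_mat b K M $$ ((i - 1) * b + s, (k - 1) * b + t) =
    (if i \<in> {M k..<M (k + 1)} \<and> s = t then 1 / sqrt (real (grid_len M k)) else 0)"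
proof -
  have b: "0 < b" using assms(4) by simp
  have "M (K + 1) = N + 1" using g by (simp add: coarse_grid_def)
  moreover have "(i - 1) * b + s < b * N" "(k - 1) * b + t < b * K"
    using block_index_less[OF i] block_index_less[OF k] assms by auto
  moreover have "((i - 1) * b + s) div b + 1 = i" "((k - 1) * b + t) div b + 1 = k"
      "((k - 1) * b + t) div b + 2 = k + 1"
    using assms by auto
  ultimately show ?thesis using coarsening_mat_index_aux[OF g b, of K] assms
    by (simp add: coarsening_mat_def)
qed

lemma coarsening_mat_mult_vec:
  assumes g: "coarse_grid N K M" and k: "k \<in> {1..K}" and i: "i \<in> {M k..<M (k + 1)}"
    and s: "s < b" and v: "v \<in> carrier_vec (b * K)"
  shows "(coarsening_mat b K M *\<^sub>v v) $ ((i - 1) * b + s) =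
    v $ ((k - 1) * b + s) / sqrt (real (grid_len M k))"
proof -
  let ?T = "coarsening_mat b K M" and ?r = "(i - 1) * b + s"
  have b: "0 < b" using s by simp
  have iN: "i \<in> {1..N}" using coarse_grid_interval_subset[OF g k] i by blast
  have T: "?T \<in> carrier_mat (b * N) (b * K)" using coarsening_mat_carrier[OF g b] .
  have "(?T *\<^sub>v v) $ ?r = (\<Sum>c<b * K. ?T $$ (?r, c) * v $ c)"
    using T v block_index_less[OF iN s] by (simp add: scalar_prod_def lessThan_atLeast0)
  also have "\<dots> = (\<Sum>l\<in>{1..K}. \<Sum>t<b. ?T $$ (?r, (l - 1) * b + t) * v $ ((l - 1) * b + t))"
    by (rule sum_blocks)
  also have "\<dots> = (\<Sum>l\<in>{1..K}. \<Sum>t<b. if l = k \<and> t = s then v $ ((k - 1) * b + s) / sqrt (real (grid_len M k)) else 0)"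
  proof (intro sum.cong refl)
    fix l t assume l: "l \<in> {1..K}" and t: "t \<in> {..<b}"
    have "i \<in> {M l..<M (l + 1)} \<longleftrightarrow> l = k" using coarse_grid_disjoint[OF g l k] i by blast
    then show "?T $$ (?r, (l - 1) * b + t) * v $ ((l - 1) * b + t) =
        (if l = k \<and> t = s then v $ ((k - 1) * b + s) / sqrt (real (grid_len M k)) else 0)"
      using coarsening_mat_index[OF g l iN s, of t] t by auto
  qed
  also have "\<dots> = (\<Sum>l\<in>{1..K}. if l = k then v $ ((k - 1) * b + s) / sqrt (real (grid_len M k)) else 0)"
    using s by (intro sum.cong refl) auto
  also have "\<dots> = v $ ((k - 1) * b + s) / sqrt (real (grid_len M k))" using k by simp
  finally show ?thesis .
qed

lemma coarsening_mat_transpose_mult_vec: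
  assumes g: "coarse_grid N K M" and k: "k \<in> {1..K}" and s: "s < b" and x: "x \<in> carrier_vec (b * N)"
  shows "((coarsening_mat b K M)\<^sup>T *\<^sub>v x) $ ((k - 1) * b + s) =
    (\<Sum>i\<in>{M k..<M (k + 1)}. x $ ((i - 1) * b + s)) / sqrt (real (grid_len M k))"
proof -
  let ?U = "coarsening_mat b K M" and ?q = "(k - 1) * b + s"
  have b: "0 < b" using s by simp
  have U: "?U \<in> carrier_mat (b * N) (b * K)" using coarsening_mat_carrier[OF g b] .
  have "(?U\<^sup>T *\<^sub>v x) $ ?q = (\<Sum>r<b * N. ?U $$ (r, ?q) * x $ r)"
    using U x block_index_less[OF k s] by (simp add: scalar_prod_def lessThan_atLeast0)
  also have "\<dots> = (\<Sum>i\<in>{1..N}. \<Sum>t<b. ?U $$ ((i - 1) * b + t, ?q) * x $ ((i - 1) * b + t))"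
    by (rule sum_blocks)
  also have "\<dots> = (\<Sum>i\<in>{1..N}. \<Sum>t<b. if t = s then
      (if i \<in> {M k..<M (k + 1)} then x $ ((i - 1) * b + s) / sqrt (real (grid_len M k)) else 0) else 0)"
    using coarsening_mat_index[OF g k _ _ s] by (intro sum.cong refl) auto
  also have "\<dots> = (\<Sum>i\<in>{1..N}. if i \<in> {M k..<M (k + 1)} then x $ ((i - 1) * b + s) / sqrt (real (grid_len M k)) else 0)"
    using s by (intro sum.cong refl) simp
  also have "\<dots> = (\<Sum>i\<in>{1..N} \<inter> {M k..<M (k + 1)}. x $ ((i - 1) * b + s) / sqrt (real (grid_len M k)))"
    by (rule sum.inter_restrict[symmetric]) simp
  also have "{1..N} \<inter> {M k..<M (k + 1)} = {M k..<M (k + 1)}"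
    using coarse_grid_interval_subset[OF g k] by blast
  finally show ?thesis by (simp add: sum_divide_distrib)
qed

section \<open>The coarse problem\<close>

text \<open>
  All that the comparison of fine and coarse problem needs from the constraint matrix: row
  \<open>opp s\<close> of a stage is the negative of row \<open>s\<close>, and row \<open>bnd c\<close> reads off the variable \<open>c\<close>
  of that stage. Both functions are the same for all stages, and therefore survive the aggregation
  of the stages in an interval.
\<close>

locale coarsened_program =
  fixes N K n m :: nat and M :: "nat \<Rightarrow> nat" and G :: "real mat" and d p zo lo :: "real vec"
    and opp bnd :: "nat \<Rightarrow> nat"
  assumes n_pos: "0 < n" and m_pos: "0 < m" and N_pos: "0 < N"
    and grid: "coarse_grid N K M"
    and G_carrier: "G \<in> carrier_mat (m * N) (n * N)"
    and p_carrier: "p \<in> carrier_vec (n * N)" and d_carrier: "d \<in> carrier_vec (m * N)" and lo_carrier: "lo \<in> carrier_vec (m * N)"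
    and zo_feasible: "zo \<in> lp_feasible d G"
    and opp_less: "\<And>s. s < m \<Longrightarrow> opp s < m"
    and opposite: "\<And>i s x. i \<in> {1..N} \<Longrightarrow> s < m \<Longrightarrow> x \<in> carrier_vec (n * N) \<Longrightarrow>
      (G *\<^sub>v x) $ ((i - 1) * m + opp s) = - (G *\<^sub>v x) $ ((i - 1) * m + s)"
    and bnd_less: "\<And>c. c < n \<Longrightarrow> bnd c < m"
    and bound: "\<And>i c x. i \<in> {1..N} \<Longrightarrow> c < n \<Longrightarrow> x \<in> carrier_vec (n * N) \<Longrightarrow>
      (G *\<^sub>v x) $ ((i - 1) * m + bnd c) = x $ ((i - 1) * n + c)"
begin

abbreviation "T \<equiv> coarsening_mat n K M"
abbreviation "U \<equiv> coarsening_mat m K M"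
abbreviation "Gc \<equiv> U\<^sup>T * G * T"
abbreviation "dc \<equiv> U\<^sup>T *\<^sub>v (d - G *\<^sub>v zo)"
abbreviation "pc \<equiv> T\<^sup>T *\<^sub>v (p - G\<^sup>T *\<^sub>v lo)"
abbreviation "Sc \<equiv> free_coarse_indices m K M lo"
abbreviation "S \<equiv> free_indices m K M lo"
abbreviation "G_row x i s \<equiv> (G *\<^sub>v x) $ ((i - 1) * m + s)"
abbreviation "d_row i s \<equiv> d $ ((i - 1) * m + s)"
abbreviation "interval k \<equiv> {M k..<M (k + 1)}"

lemma T_carrier: "T \<in> carrier_mat (n * N) (n * K)" using coarsening_mat_carrier[OF grid n_pos] .
lemma U_carrier: "U \<in> carrier_mat (m * N) (m * K)" using coarsening_mat_carrier[OF grid m_pos] .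

lemma dims: "dim_row G = m * N" "dim_col G = n * N" using G_carrier by auto

lemma zo_carrier: "zo \<in> carrier_vec (n * N)" using zo_feasible dims by (simp add: lp_feasible_def)

lemma Gc_carrier: "Gc \<in> carrier_mat (m * K) (n * K)"
  using mult_carrier_mat[OF mult_carrier_mat[OF _ G_carrier] T_carrier] U_carrier by simp

lemma Gc_dims: "dim_row Gc = m * K" "dim_col Gc = n * K" using carrier_matD[OF Gc_carrier] by auto

lemma T_mult: "v \<in> carrier_vec (n * K) \<Longrightarrow> T *\<^sub>v v \<in> carrier_vec (n * N)"
  using mult_mat_vec_carrier[OF T_carrier] .

lemma G_mult: "x \<in> carrier_vec (n * N) \<Longrightarrow> G *\<^sub>v x \<in> carrier_vec (m * N)"
  using mult_mat_vec_carrier[OF G_carrier] .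

lemma dc_carrier: "dc \<in> carrier_vec (m * K)"
proof -
  have "U\<^sup>T \<in> carrier_mat (m * K) (m * N)" using U_carrier by simp
  from mult_mat_vec_carrier[OF this] show ?thesis using d_carrier G_mult[OF zo_carrier] by simp
qed

lemma cost_carrier: "p - G\<^sup>T *\<^sub>v lo \<in> carrier_vec (n * N)"
proof -
  have "G\<^sup>T \<in> carrier_mat (n * N) (m * N)" using G_carrier by simp
  from mult_mat_vec_carrier[OF this lo_carrier] show ?thesis using p_carrier by simp
qed

lemma pc_carrier: "pc \<in> carrier_vec (n * K)"
proof -
  have "T\<^sup>T \<in> carrier_mat (n * K) (n * N)" using T_carrier by simp
  from mult_mat_vec_carrier[OF this cost_carrier] show ?thesis .
qed

lemma coarse_row:
  assumes k: "k \<in> {1..K}" and s: "s < m" and v: "v \<in> carrier_vec (n * K)"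
  shows "(Gc *\<^sub>v v) $ ((k - 1) * m + s) =
    (\<Sum>i\<in>interval k. G_row (T *\<^sub>v v) i s) / sqrt (real (grid_len M k))"
proof -
  have Ut: "U\<^sup>T \<in> carrier_mat (m * K) (m * N)" using U_carrier by simp
  have "Gc *\<^sub>v v = (U\<^sup>T * G) *\<^sub>v (T *\<^sub>v v)"
    using assoc_mult_mat_vec[OF mult_carrier_mat[OF Ut G_carrier] T_carrier v] .
  also have "\<dots> = U\<^sup>T *\<^sub>v (G *\<^sub>v (T *\<^sub>v v))" using assoc_mult_mat_vec[OF Ut G_carrier T_mult[OF v]] .
  finally show ?thesis
    using coarsening_mat_transpose_mult_vec[OF grid k s G_mult[OF T_mult[OF v]]] by (simp only:)
qed

lemma projected_row:
  assumes i: "i \<in> {1..N}" and s: "s < m" and v: "v \<in> carrier_vec (n * K)"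
  shows "G_row (zo + T *\<^sub>v v) i s =
    G_row zo i s + G_row (T *\<^sub>v v) i s"
  using mult_mat_vec_line[of zo G "T *\<^sub>v v" "(i - 1) * m + s" 1] zo_carrier T_mult[OF v]
    block_index_less[OF i s] dims by simp

lemma coarse_slack:
  assumes k: "k \<in> {1..K}" and s: "s < m" and v: "v \<in> carrier_vec (n * K)"
  shows "(Gc *\<^sub>v v) $ ((k - 1) * m + s) - dc $ ((k - 1) * m + s) =
    (\<Sum>i\<in>interval k. G_row (zo + T *\<^sub>v v) i s - d_row i s)
      / sqrt (real (grid_len M k))"
proof -
  have c: "d - G *\<^sub>v zo \<in> carrier_vec (m * N)" using d_carrier G_mult[OF zo_carrier] by simp
  have "(\<Sum>i\<in>interval k. G_row (zo + T *\<^sub>v v) i s - d_row i s) =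
    (\<Sum>i\<in>interval k. G_row (T *\<^sub>v v) i s - (d - G *\<^sub>v zo) $ ((i - 1) * m + s))"
  proof (rule sum.cong)
    fix i assume "i \<in> interval k"
    then have i: "i \<in> {1..N}" using coarse_grid_interval_subset[OF grid k] by blast
    have "(d - G *\<^sub>v zo) $ ((i - 1) * m + s) = d_row i s - G_row zo i s"
      using dims block_index_less[OF i s] by (intro index_minus_vec) auto
    then show "G_row (zo + T *\<^sub>v v) i s - d_row i s =
      G_row (T *\<^sub>v v) i s - (d - G *\<^sub>v zo) $ ((i - 1) * m + s)"
      unfolding projected_row[OF i s v] by linarith
  qed simp
  then show ?thesis
    unfolding coarse_row[OF k s v] coarsening_mat_transpose_mult_vec[OF grid k s c]
    by (simp only: sum_subtractf diff_divide_distrib)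
qed

lemma coarse_feasible_iff:
  assumes v: "v \<in> carrier_vec (n * K)"
  shows "v \<in> lp_feasible dc Gc \<longleftrightarrow> (\<forall>k\<in>{1..K}. \<forall>s<m.
    0 \<le> (\<Sum>i\<in>interval k. G_row (zo + T *\<^sub>v v) i s - d_row i s))"
proof -
  have "v \<in> lp_feasible dc Gc \<longleftrightarrow> (\<forall>q<m * K. 0 \<le> (Gc *\<^sub>v v) $ q - dc $ q)"
    using v lp_feasible_satisfying[of dc Gc] carrier_vecD[OF dc_carrier] Gc_dims
    by (auto simp: satisfying_def simp del: index_mult_mat_vec)
  also have "\<dots> \<longleftrightarrow> (\<forall>k\<in>{1..K}. \<forall>s<m. 0 \<le> (Gc *\<^sub>v v) $ ((k - 1) * m + s) - dc $ ((k - 1) * m + s))"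
    by (rule all_blocks_iff[OF m_pos])
  also have "\<dots> \<longleftrightarrow> (\<forall>k\<in>{1..K}. \<forall>s<m.
    0 \<le> (\<Sum>i\<in>interval k. G_row (zo + T *\<^sub>v v) i s - d_row i s))"
  proof (intro ball_cong refl all_cong1 imp_cong)
    fix k s assume "k \<in> {1..K}" "s < m"
    then show "0 \<le> (Gc *\<^sub>v v) $ ((k - 1) * m + s) - dc $ ((k - 1) * m + s) \<longleftrightarrow>
      0 \<le> (\<Sum>i\<in>interval k. G_row (zo + T *\<^sub>v v) i s - d_row i s)"
      using grid_len_pos[of M k] by (simp only: coarse_slack[OF _ _ v]) (simp add: zero_le_divide_iff)
  qed
  finally show ?thesis .
qed

lemma coarse_bound_row:
  assumes k: "k \<in> {1..K}" and c: "c < n" and v: "v \<in> carrier_vec (n * K)"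
  shows "(Gc *\<^sub>v v) $ ((k - 1) * m + bnd c) = v $ ((k - 1) * n + c)"
proof -
  have L: "real (grid_len M k) = real (card (interval k))" "0 < real (grid_len M k)"
    using grid_len_card(1)[OF coarse_grid_step[OF grid k]] grid_len_pos[of M k] by auto
  have "(\<Sum>i\<in>interval k. G_row (T *\<^sub>v v) i (bnd c)) =
      (\<Sum>i\<in>interval k. v $ ((k - 1) * n + c) / sqrt (real (grid_len M k)))"
  proof (rule sum.cong)
    fix i assume i: "i \<in> interval k"
    then have "i \<in> {1..N}" using coarse_grid_interval_subset[OF grid k] by blast
    then show "G_row (T *\<^sub>v v) i (bnd c) = v $ ((k - 1) * n + c) / sqrt (real (grid_len M k))"
      using bound[OF _ c T_mult[OF v]] coarsening_mat_mult_vec[OF grid k i c v] by (simp only:)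
  qed simp
  also have "\<dots> = real (grid_len M k) * (v $ ((k - 1) * n + c) / sqrt (real (grid_len M k)))"
    unfolding sum_constant L(1) by simp
  finally show ?thesis
    unfolding coarse_row[OF k bnd_less[OF c] v] using L(2) by (simp add: real_div_sqrt)
qed

lemma coarse_opposite_row:
  assumes k: "k \<in> {1..K}" and s: "s < m" and v: "v \<in> carrier_vec (n * K)"
  shows "(Gc *\<^sub>v v) $ ((k - 1) * m + opp s) = - (Gc *\<^sub>v v) $ ((k - 1) * m + s)"
proof -
  have "(\<Sum>i\<in>interval k. G_row (T *\<^sub>v v) i (opp s)) =
      (\<Sum>i\<in>interval k. - G_row (T *\<^sub>v v) i s)"
    using coarse_grid_interval_subset[OF grid k] opposite[OF _ s T_mult[OF v]] by (intro sum.cong) auto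
  then show ?thesis
    unfolding coarse_row[OF k s v] coarse_row[OF k opp_less[OF s] v] by (simp add: sum_negf)
qed

text \<open>
  The bound rows and their opposites survive coarsening, so the coarse feasible set has no
  nonzero recession direction.
\<close>

lemma coarse_recession_zero:
  assumes h: "h \<in> carrier_vec (n * K)" and nn: "\<And>q. q < m * K \<Longrightarrow> 0 \<le> (Gc *\<^sub>v h) $ q"
  shows "h = 0\<^sub>v (n * K)"
proof (rule vec_eq_blocks[OF n_pos h])
  fix k c assume kc: "k \<in> {1..K}" "c < n"
  have "0 \<le> (Gc *\<^sub>v h) $ ((k - 1) * m + bnd c)"
    using nn[OF block_index_less[OF kc(1) bnd_less[OF kc(2)]]] .
  moreover have "0 \<le> (Gc *\<^sub>v h) $ ((k - 1) * m + opp (bnd c))"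
    using nn[OF block_index_less[OF kc(1) opp_less[OF bnd_less[OF kc(2)]]]] .
  ultimately have "h $ ((k - 1) * n + c) = 0"
    unfolding coarse_opposite_row[OF kc(1) bnd_less[OF kc(2)] h] coarse_bound_row[OF kc h] by simp
  then show "h $ ((k - 1) * n + c) = 0\<^sub>v (n * K) $ ((k - 1) * n + c)"
    using block_index_less[OF kc] by simp
qed simp

lemma coarse_optimal_vertex:
  "\<exists>v. lp_optimal dc Gc pc v \<and> trivial_kernel_on Gc (active_rows Gc dc {..<m * K} v)"
proof -
  have z: "0\<^sub>v (n * K) \<in> carrier_vec (n * K)" by simp
  have T0: "T *\<^sub>v 0\<^sub>v (n * K) = 0\<^sub>v (n * N)" using T_carrier by (intro eq_vecI) auto
  have "0\<^sub>v (n * K) \<in> lp_feasible dc Gc"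
    unfolding coarse_feasible_iff[OF z] T0
  proof (intro ballI allI impI sum_nonneg)
    fix k s i assume k: "k \<in> {1..K}" and s: "s < m" and "i \<in> interval k"
    then have "i \<in> {1..N}" using coarse_grid_interval_subset[OF grid k] by blast
    from block_index_less[OF this s] zo_feasible
    show "0 \<le> G_row (zo + 0\<^sub>v (n * N)) i s - d_row i s"
      using zo_carrier dims d_carrier by (simp add: lp_feasible_def less_eq_vec_def)
  qed
  then have ne: "satisfying Gc dc {..<m * K} \<noteq> {}"
    using lp_feasible_satisfying[of dc Gc] carrier_vecD[OF dc_carrier] Gc_dims by auto
  have ker: "trivial_kernel_on Gc {..<m * K}"
    unfolding trivial_kernel_on_def Gc_dims
  proof (intro ballI impI)
    fix h assume h: "h \<in> carrier_vec (n * K)" "\<forall>i\<in>{..<m * K}. (Gc *\<^sub>v h) $ i = 0"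
    show "h = 0\<^sub>v (n * K)"
    proof (rule coarse_recession_zero[OF h(1)])
      fix q assume "q < m * K"
      then have "(Gc *\<^sub>v h) $ q = 0" using h(2) by blast
      then show "0 \<le> (Gc *\<^sub>v h) $ q" by linarith
    qed
  qed
  have rec: "0 \<le> pc \<bullet> h" if h: "h \<in> carrier_vec (dim_col Gc)" "\<forall>i\<in>{..<m * K}. 0 \<le> (Gc *\<^sub>v h) $ i" for h
  proof -
    have hc: "h \<in> carrier_vec (n * K)" using h(1) unfolding Gc_dims .
    have "h = 0\<^sub>v (n * K)" by (rule coarse_recession_zero[OF hc]) (use h(2) in blast)
    then show ?thesis using scalar_prod_right_zero[OF pc_carrier] by (simp only:)
  qed
  have "{..<m * K} \<subseteq> {..<dim_row Gc}" unfolding Gc_dims by (rule order_refl)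
  moreover have "pc \<in> carrier_vec (dim_col Gc)" using pc_carrier unfolding Gc_dims .
  ultimately obtain v where "v \<in> satisfying Gc dc {..<m * K}" "\<forall>y\<in>satisfying Gc dc {..<m * K}. pc \<bullet> v \<le> pc \<bullet> y"
      "trivial_kernel_on Gc (active_rows Gc dc {..<m * K} v)"
    using optimal_vertex_exists[OF _ _ ker rec ne] by blast
  moreover have "dim_vec dc = dim_row Gc" using carrier_vecD[OF dc_carrier] unfolding Gc_dims .
  ultimately show ?thesis using lp_optimal_iff[of dc Gc pc] unfolding Gc_dims by blast
qed

lemma coarse_feasible_bounded:
  "\<exists>R. \<forall>v\<in>lp_feasible dc Gc. eucl_norm v \<le> R"
proof (intro exI ballI)
  let ?b = "\<Sum>q<m * K. \<bar>dc $ q\<bar>"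
  fix v assume v: "v \<in> lp_feasible dc Gc"
  then have vc: "v \<in> carrier_vec (n * K)" unfolding lp_feasible_def Gc_dims by blast
  have f: "- ?b \<le> (Gc *\<^sub>v v) $ q" if q: "q < m * K" for q
  proof -
    have "v \<in> satisfying Gc dc {..<m * K}"
      using v lp_feasible_satisfying[of dc Gc] carrier_vecD[OF dc_carrier] unfolding Gc_dims by blast
    then have "dc $ q \<le> (Gc *\<^sub>v v) $ q" using q unfolding satisfying_def by blast
    moreover have "\<bar>dc $ q\<bar> \<le> ?b" using q by (intro member_le_sum) auto
    ultimately show ?thesis by linarith
  qed
  have "\<forall>c<n * K. \<bar>v $ c\<bar> \<le> ?b"
    unfolding all_blocks_iff[OF n_pos]
  proof (intro ballI allI impI)
    fix k c assume kc: "k \<in> {1..K}" "c < n"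
    note f[OF block_index_less[OF kc(1) bnd_less[OF kc(2)]]]
      f[OF block_index_less[OF kc(1) opp_less[OF bnd_less[OF kc(2)]]]]
    then show "\<bar>v $ ((k - 1) * n + c)\<bar> \<le> ?b"
      unfolding coarse_opposite_row[OF kc(1) bnd_less[OF kc(2)] vc] coarse_bound_row[OF kc vc] by linarith
  qed
  then have "(\<Sum>c<n * K. \<bar>v $ c\<bar>) \<le> (\<Sum>c<n * K. ?b)" by (intro sum_mono) auto
  then show "eucl_norm v \<le> (\<Sum>c<n * K. ?b)"
    using eucl_norm_le_sum_abs[of v] carrier_vecD[OF vc] by simp
qed

text \<open>
  This makes the supremum that defines the coarsening error finite.
\<close>

lemma coarse_residual_bounded:
  "\<exists>R. \<forall>v\<in>lp_feasible dc Gc. eucl_norm (d - G *\<^sub>v (zo + T *\<^sub>v v)) \<le> R"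
proof -
  obtain R where R: "\<And>v. v \<in> lp_feasible dc Gc \<Longrightarrow> eucl_norm v \<le> R" using coarse_feasible_bounded by blast
  have GT: "G * T \<in> carrier_mat (m * N) (n * K)" using mult_carrier_mat[OF G_carrier T_carrier] .
  obtain k where k: "0 < k" "\<And>x. x \<in> carrier_vec (n * K) \<Longrightarrow> eucl_norm ((G * T) *\<^sub>v x) \<le> k * eucl_norm x"
    using mat_bounded[OF GT] by blast
  have "eucl_norm (d - G *\<^sub>v (zo + T *\<^sub>v v)) \<le> eucl_norm (d - G *\<^sub>v zo) + k * R"
    if v: "v \<in> lp_feasible dc Gc" for v
  proof -
    have vc: "v \<in> carrier_vec (n * K)" using v unfolding lp_feasible_def Gc_dims by blast
    have GTv: "(G * T) *\<^sub>v v = G *\<^sub>v (T *\<^sub>v v)" using assoc_mult_mat_vec[OF G_carrier T_carrier vc] .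
    have g: "G *\<^sub>v zo \<in> carrier_vec (m * N)" "G *\<^sub>v (T *\<^sub>v v) \<in> carrier_vec (m * N)"
      using G_mult zo_carrier T_mult[OF vc] by auto
    have "d - (u + w) = (d - u) + (- 1) \<cdot>\<^sub>v w"
      if "u \<in> carrier_vec (m * N)" "w \<in> carrier_vec (m * N)" for u w :: "real vec"
      using d_carrier that by (intro eq_vecI) auto
    then have "d - G *\<^sub>v (zo + T *\<^sub>v v) = (d - G *\<^sub>v zo) + (- 1) \<cdot>\<^sub>v (G *\<^sub>v (T *\<^sub>v v))"
      using mult_add_distrib_mat_vec[OF G_carrier zo_carrier T_mult[OF vc]] g by (simp only:)
    then have "eucl_norm (d - G *\<^sub>v (zo + T *\<^sub>v v)) \<le>
        eucl_norm (d - G *\<^sub>v zo) + eucl_norm ((- 1) \<cdot>\<^sub>v (G *\<^sub>v (T *\<^sub>v v)))"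
      using eucl_norm_triangle[of "d - G *\<^sub>v zo" "m * N" "(- 1) \<cdot>\<^sub>v (G *\<^sub>v (T *\<^sub>v v))"] d_carrier g
      by (simp only: minus_carrier_vec smult_carrier_vec)
    also have "eucl_norm ((- 1) \<cdot>\<^sub>v (G *\<^sub>v (T *\<^sub>v v))) = eucl_norm ((G * T) *\<^sub>v v)"
      unfolding GTv eucl_norm_smult by simp
    also have "\<dots> \<le> k * eucl_norm v" using k(2)[OF vc] .
    also have "\<dots> \<le> k * R" using R[OF v] k(1) by simp
    finally show ?thesis by simp
  qed
  then show ?thesis by blast
qed

lemma free_interval:
  assumes "k \<in> Sc"
  shows "k \<in> {1..K}" "interval k = {M k}" "grid_len M k = 1" "M k \<in> S" "M k \<in> {1..N}"
    "vec_block m lo (M k) = 0\<^sub>v m"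
proof -
  show k: "k \<in> {1..K}" and L: "grid_len M k = 1" and "vec_block m lo (M k) = 0\<^sub>v m"
    using assms by (auto simp: free_coarse_indices_def)
  have "M (k + 1) = M k + 1"
    using grid_len_card(1)[OF coarse_grid_step[OF grid k]] coarse_grid_step[OF grid k] L by linarith
  then show I: "interval k = {M k}" by auto
  show "M k \<in> {1..N}" using coarse_grid_interval_subset[OF grid k] I by blast
  have "{M k..grid_end M k} = {M k}" unfolding grid_len_card(2)[OF coarse_grid_step[OF grid k]] by (rule I)
  then show "M k \<in> S" using assms unfolding free_indices_def by blast
qed

lemma free_index_cases:
  assumes "i \<in> S"
  obtains k where "k \<in> Sc" "i = M k"
proof -
  obtain k where k: "k \<in> Sc" "i \<in> {M k..grid_end M k}" using assms unfolding free_indices_def by blast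
  have "{M k..grid_end M k} = {M k}"
    unfolding grid_len_card(2)[OF coarse_grid_step[OF grid free_interval(1)[OF k(1)]]]
    by (rule free_interval(2)[OF k(1)])
  then show thesis using k that by blast
qed

lemma not_free_interval:
  assumes k: "k \<in> {1..K}" "k \<notin> Sc" and i: "i \<in> interval k"
  shows "i \<notin> S"
proof
  assume "i \<in> S"
  then obtain l where l: "l \<in> Sc" "i = M l" by (rule free_index_cases)
  have "i \<in> interval l" using free_interval(2)[OF l(1)] l(2) by blast
  then have "l = k" using coarse_grid_disjoint[OF grid free_interval(1)[OF l(1)] k(1)] i by blast
  then show False using l k by blast
qed

lemma direction_vanishes_off_free:
  assumes h: "h \<in> carrier_vec (n * N)"
    and nn: "\<And>i s. i \<in> {1..N} - S \<Longrightarrow> s < m \<Longrightarrow> 0 \<le> G_row h i s"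
    and i: "i \<in> {1..N} - S" and s: "s < m"
  shows "G_row h i s = 0"
proof -
  have "i \<in> {1..N}" using i by blast
  from opposite[OF this s h] show ?thesis using nn[OF i s] nn[OF i opp_less[OF s]] by linarith
qed

text \<open>
  The bound rows force \<open>h\<close> to vanish off the free stages, and a free stage is an interval of its
  own, on which \<open>T\<close> acts as the identity.
\<close>

lemma direction_is_coarse:
  assumes h: "h \<in> carrier_vec (n * N)"
    and z: "\<And>i s. i \<in> {1..N} - S \<Longrightarrow> s < m \<Longrightarrow> G_row h i s = 0"
  shows "\<exists>v \<in> carrier_vec (n * K). h = T *\<^sub>v v"
proof
  define v where "v = vec (n * K) (\<lambda>q. if q div n + 1 \<in> Sc then h $ ((M (q div n + 1) - 1) * n + q mod n) else 0)"
  show v: "v \<in> carrier_vec (n * K)" by (simp add: v_def)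
  show "h = T *\<^sub>v v"
  proof (rule vec_eq_blocks[OF n_pos h T_mult[OF v]])
    fix i c assume i: "i \<in> {1..N}" and c: "c < n"
    obtain k where k: "k \<in> {1..K}" "i \<in> interval k" using coarse_grid_cover[OF grid i] .
    have vk: "v $ ((k - 1) * n + c) = (if k \<in> Sc then h $ ((M k - 1) * n + c) else 0)"
    proof -
      have "((k - 1) * n + c) div n + 1 = k" "((k - 1) * n + c) mod n = c" using c k(1) by auto
      then show ?thesis using block_index_less[OF k(1) c] by (simp add: v_def)
    qed
    have "(T *\<^sub>v v) $ ((i - 1) * n + c) = v $ ((k - 1) * n + c) / sqrt (real (grid_len M k))"
      using coarsening_mat_mult_vec[OF grid k c v] .
    also have "\<dots> = h $ ((i - 1) * n + c)"
    proof (cases "k \<in> Sc")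
      case True
      then have "i = M k" using k(2) free_interval(2) by blast
      then show ?thesis using True vk free_interval(3) by simp
    next
      case False
      then have "i \<in> {1..N} - S" using not_free_interval k i by blast
      then have "h $ ((i - 1) * n + c) = 0" using z[OF _ bnd_less[OF c]] bound[OF i c h] by simp
      then show ?thesis using False vk by simp
    qed
    finally show "h $ ((i - 1) * n + c) = (T *\<^sub>v v) $ ((i - 1) * n + c)" by simp
  qed
qed

text \<open>
  The two costs differ by \<open>lo \<bullet> G h\<close> with \<open>h = T v\<close>. The dual guess vanishes on the free stages and
  \<open>G h\<close> vanishes on the others.
\<close>

lemma coarse_cost:
  assumes v: "v \<in> carrier_vec (n * K)"
    and z: "\<And>i s. i \<in> {1..N} - S \<Longrightarrow> s < m \<Longrightarrow> G_row (T *\<^sub>v v) i s = 0"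
  shows "pc \<bullet> v = p \<bullet> (T *\<^sub>v v)"
proof -
  let ?h = "T *\<^sub>v v"
  have h: "?h \<in> carrier_vec (n * N)" using T_mult[OF v] .
  have Gh: "G *\<^sub>v ?h \<in> carrier_vec (m * N)" using G_mult[OF h] .
  have Gt: "G\<^sup>T *\<^sub>v lo \<in> carrier_vec (n * N)"
    using mult_mat_vec_carrier[of "G\<^sup>T" "n * N" "m * N" lo] G_carrier lo_carrier by simp
  have "lo \<bullet> (G *\<^sub>v ?h) = (\<Sum>r<m * N. lo $ r * (G *\<^sub>v ?h) $ r)"
    using carrier_vecD[OF Gh] by (simp only: scalar_prod_def lessThan_atLeast0)
  also have "\<dots> = (\<Sum>i\<in>{1..N}. \<Sum>s<m. lo $ ((i - 1) * m + s) * G_row ?h i s)"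
    by (rule sum_blocks)
  also have "\<dots> = 0"
  proof (intro sum.neutral ballI)
    fix i s assume i: "i \<in> {1..N}" and s: "s \<in> {..<m}"
    show "lo $ ((i - 1) * m + s) * G_row ?h i s = 0"
    proof (cases "i \<in> S")
      case True
      then obtain k where k: "k \<in> Sc" "i = M k" by (rule free_index_cases)
      have "vec_block m lo i $ s = 0" using free_interval(6)[OF k(1)] k(2) s by simp
      then have "lo $ ((i - 1) * m + s) = 0" using i s by (simp add: vec_block_def)
      then show ?thesis by simp
    next
      case False
      then show ?thesis using z[of i s] i s by simp
    qed
  qed
  finally have lo0: "lo \<bullet> (G *\<^sub>v ?h) = 0" .
  have "pc \<bullet> v = (p - G\<^sup>T *\<^sub>v lo) \<bullet> ?h" using transpose_vec_mult_scalar[OF T_carrier v cost_carrier] .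
  also have "\<dots> = p \<bullet> ?h - (G\<^sup>T *\<^sub>v lo) \<bullet> ?h" using minus_scalar_prod_distrib[OF p_carrier Gt h] .
  also have "(G\<^sup>T *\<^sub>v lo) \<bullet> ?h = lo \<bullet> (G *\<^sub>v ?h)" using transpose_vec_mult_scalar[OF G_carrier h lo_carrier] .
  finally show ?thesis using lo0 by simp
qed

text \<open>
  The right-hand side for which the projected coarse solution \<open>z\<close> is a solution of the fine problem:
  the data are kept on the free stages, and all constraints of the other stages are made tight at \<open>z\<close>.
\<close>

definition shifted_rhs :: "real vec \<Rightarrow> real vec" where
  "shifted_rhs z = vec (m * N) (\<lambda>r. if r div m + 1 \<in> S then d $ r else (G *\<^sub>v z) $ r)"

lemma shifted_rhs_index:
  assumes "i \<in> {1..N}" "s < m"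
  shows "shifted_rhs z $ ((i - 1) * m + s) =
    (if i \<in> S then d_row i s else G_row z i s)"
proof -
  have "((i - 1) * m + s) div m + 1 = i" using assms by auto
  then show ?thesis using block_index_less[OF assms]
    by (simp add: shifted_rhs_def del: index_mult_mat_vec)
qed

lemma shifted_rhs_carrier: "shifted_rhs z \<in> carrier_vec (m * N)"
  by (simp add: shifted_rhs_def)

lemma satisfying_blocks:
  "y \<in> satisfying G e {..<m * N} \<longleftrightarrow> y \<in> carrier_vec (n * N) \<and>
    (\<forall>i\<in>{1..N}. \<forall>s<m. e $ ((i - 1) * m + s) \<le> G_row y i s)"
  using all_blocks_iff[OF m_pos, of N "\<lambda>r. e $ r \<le> (G *\<^sub>v y) $ r"] unfolding satisfying_def dims by blast

text \<open>
  Let \<open>y\<close> be another feasible point for the shifted data and \<open>h\<close> its difference to the projected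
  solution. Off the free stages \<open>G h \<ge> 0\<close>, and since rows come in opposite pairs, \<open>G h = 0\<close>
  there. So \<open>h\<close> is the image of a coarse direction, along which the coarse problem remains feasible,
  and by \<open>coarse_cost\<close> its cost is that of \<open>h\<close>, so optimality of the coarse solution carries over.
\<close>

lemma projected_coarse_solution_optimal:
  assumes v: "lp_optimal dc Gc pc v"
  shows "lp_optimal (shifted_rhs (zo + T *\<^sub>v v)) G p (zo + T *\<^sub>v v)"
proof -
  let ?z = "zo + T *\<^sub>v v"
  let ?e = "shifted_rhs ?z"
  have vf: "v \<in> lp_feasible dc Gc" using v by (simp only: lp_optimal_def)
  then have vc: "v \<in> carrier_vec (n * K)" unfolding lp_feasible_def Gc_dims by blast
  have zc: "?z \<in> carrier_vec (n * N)" using zo_carrier T_mult[OF vc] by simp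
  have slack: "0 \<le> (\<Sum>i\<in>interval k. G_row ?z i s - d_row i s)"
    if "k \<in> {1..K}" "s < m" for k s using vf that unfolding coarse_feasible_iff[OF vc] by blast
  have "?z \<in> satisfying G ?e {..<m * N}"
    unfolding satisfying_blocks
  proof (intro conjI ballI allI impI zc)
    fix i s assume i: "i \<in> {1..N}" and s: "s < m"
    show "?e $ ((i - 1) * m + s) \<le> G_row ?z i s"
    proof (cases "i \<in> S")
      case True
      then obtain k where k: "k \<in> Sc" "i = M k" by (rule free_index_cases)
      have "0 \<le> G_row ?z i s - d_row i s"
        using slack[OF free_interval(1)[OF k(1)] s] unfolding free_interval(2)[OF k(1)] k(2) by simp
      then show ?thesis unfolding shifted_rhs_index[OF i s] using True by simp
    next
      case False
      then show ?thesis unfolding shifted_rhs_index[OF i s] by simp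
    qed
  qed
  moreover have "p \<bullet> ?z \<le> p \<bullet> y" if y: "y \<in> satisfying G ?e {..<m * N}" for y
  proof -
    have yc: "y \<in> carrier_vec (n * N)"
      and ye: "\<And>i s. i \<in> {1..N} \<Longrightarrow> s < m \<Longrightarrow> ?e $ ((i - 1) * m + s) \<le> G_row y i s"
      using y unfolding satisfying_blocks by auto
    define h where "h = y - ?z"
    have h: "h \<in> carrier_vec (n * N)" using yc zc by (simp add: h_def)
    have Gh: "G_row h i s = G_row y i s - G_row ?z i s"
      if "i \<in> {1..N}" "s < m" for i s
      using mult_mat_vec_scaled_diff[of y G ?z "(i - 1) * m + s" 1] yc zc block_index_less[OF that] dims
      by (simp add: h_def)
    have nn: "0 \<le> G_row h i s" if "i \<in> {1..N} - S" "s < m" for i s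
    proof -
      have i: "i \<in> {1..N}" "i \<notin> S" using that by auto
      show ?thesis using ye[OF i(1) that(2)] i(2)
        unfolding Gh[OF i(1) that(2)] shifted_rhs_index[OF i(1) that(2)] by simp
    qed
    have h0: "G_row h i s = 0" if "i \<in> {1..N} - S" "s < m" for i s
      by (rule direction_vanishes_off_free[OF h _ that]) (rule nn)
    obtain w where w: "w \<in> carrier_vec (n * K)" "h = T *\<^sub>v w" using direction_is_coarse[OF h h0] by blast
    have yw: "zo + T *\<^sub>v (v + w) = y"
    proof -
      have "T *\<^sub>v (v + w) = T *\<^sub>v v + h" using mult_add_distrib_mat_vec[OF T_carrier vc w(1)] w(2) by simp
      moreover have "zo + (u + (y - (zo + u))) = y" if "u \<in> carrier_vec (n * N)" for u
        using zo_carrier yc that by (intro eq_vecI) auto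
      ultimately show ?thesis using T_mult[OF vc] unfolding h_def by simp
    qed
    have vw: "v + w \<in> carrier_vec (n * K)" using vc w(1) by simp
    have "v + w \<in> lp_feasible dc Gc"
      unfolding coarse_feasible_iff[OF vw] yw
    proof (intro ballI allI impI)
      fix k s assume k: "k \<in> {1..K}" and s: "s < m"
      show "0 \<le> (\<Sum>i\<in>interval k. G_row y i s - d_row i s)"
      proof (cases "k \<in> Sc")
        case True
        note fi = free_interval[OF True]
        show ?thesis using ye[OF fi(5) s] fi(4) unfolding fi(2) shifted_rhs_index[OF fi(5) s] by simp
      next
        case False
        have "(\<Sum>i\<in>interval k. G_row y i s - d_row i s) =
          (\<Sum>i\<in>interval k. G_row ?z i s - d_row i s)"
        proof (rule sum.cong)
          fix i assume i: "i \<in> interval k"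
          then have iN: "i \<in> {1..N}" using coarse_grid_interval_subset[OF grid k] by blast
          then have "i \<in> {1..N} - S" using not_free_interval[OF k False i] by blast
          from h0[OF this s] show "G_row y i s - d_row i s =
              G_row ?z i s - d_row i s"
            unfolding Gh[OF iN s] by simp
        qed simp
        then show ?thesis using slack[OF k s] by linarith
      qed
    qed
    then have "pc \<bullet> v \<le> pc \<bullet> (v + w)" using v unfolding lp_optimal_def by blast
    also have "pc \<bullet> (v + w) = pc \<bullet> v + pc \<bullet> w" using scalar_prod_add_distrib[OF pc_carrier vc w(1)] .
    finally have "0 \<le> pc \<bullet> w" by simp
    also have "pc \<bullet> w = p \<bullet> h" using coarse_cost[OF w(1)] h0 unfolding w(2) by blast
    also have "p \<bullet> h = p \<bullet> y - p \<bullet> ?z" unfolding h_def using scalar_prod_minus_distrib[OF p_carrier yc zc] .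
    finally show ?thesis by simp
  qed
  ultimately show ?thesis
    using lp_optimal_iff[of ?e G p ?z] carrier_vecD[OF shifted_rhs_carrier] unfolding dims by blast
qed

text \<open>
  A direction annihilated by the active rows is again the image of a coarse direction, and this
  one is annihilated by the active coarse rows.
\<close>

lemma projected_coarse_solution_vertex:
  assumes vc: "v \<in> carrier_vec (n * K)"
    and ker: "trivial_kernel_on Gc (active_rows Gc dc {..<m * K} v)"
  shows "trivial_kernel_on G (active_rows G (shifted_rhs (zo + T *\<^sub>v v)) {..<m * N} (zo + T *\<^sub>v v))"
    (is "trivial_kernel_on G ?A")
  unfolding trivial_kernel_on_def dims
proof (intro ballI impI)
  let ?z = "zo + T *\<^sub>v v"
  fix h assume h: "h \<in> carrier_vec (n * N)" and hA: "\<forall>i\<in>?A. (G *\<^sub>v h) $ i = 0"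
  have act: "G_row h i s = 0"
    if "i \<in> {1..N}" "s < m" "G_row ?z i s = shifted_rhs ?z $ ((i - 1) * m + s)" for i s
    using hA that(3) block_index_less[OF that(1,2)] unfolding active_rows_def by blast
  have h0: "G_row h i s = 0" if "i \<in> {1..N} - S" "s < m" for i s
  proof -
    have i: "i \<in> {1..N}" "i \<notin> S" using that by auto
    show ?thesis by (rule act[OF i(1) that(2)]) (use i(2) in \<open>simp only: shifted_rhs_index[OF i(1) that(2)] if_False\<close>)
  qed
  obtain w where w: "w \<in> carrier_vec (n * K)" "h = T *\<^sub>v w" using direction_is_coarse[OF h h0] by blast
  have all: "\<forall>q<m * K. q \<in> active_rows Gc dc {..<m * K} v \<longrightarrow> (Gc *\<^sub>v w) $ q = 0"
    unfolding all_blocks_iff[OF m_pos]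
  proof (intro ballI allI impI)
    fix k s assume k: "k \<in> {1..K}" and s: "s < m"
      and a: "(k - 1) * m + s \<in> active_rows Gc dc {..<m * K} v"
    have "G_row h i s = 0" if i: "i \<in> interval k" for i
    proof (cases "k \<in> Sc")
      case True
      note fi = free_interval[OF True]
      have eq: "i = M k" using i fi(2) by blast
      have "(Gc *\<^sub>v v) $ ((k - 1) * m + s) - dc $ ((k - 1) * m + s) = 0"
        using a unfolding active_rows_def by simp
      then have "G_row ?z i s = d_row i s"
        unfolding coarse_slack[OF k s vc] fi(2) fi(3) eq by simp
      then show ?thesis
        using act[OF fi(5) s] fi(4) unfolding shifted_rhs_index[OF fi(5) s] eq by simp
    next
      case False
      have "i \<in> {1..N} - S" using not_free_interval[OF k False i] coarse_grid_interval_subset[OF grid k] i by blast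
      then show ?thesis using h0 s by blast
    qed
    then show "(Gc *\<^sub>v w) $ ((k - 1) * m + s) = 0"
      unfolding coarse_row[OF k s w(1)] w(2)[symmetric] by simp
  qed
  then have "\<forall>i\<in>active_rows Gc dc {..<m * K} v. (Gc *\<^sub>v w) $ i = 0"
    unfolding active_rows_def by blast
  then have "w = 0\<^sub>v (n * K)" using ker w(1) unfolding trivial_kernel_on_def Gc_dims by blast
  then show "h = 0\<^sub>v (n * N)" unfolding w(2) using T_carrier by (intro eq_vecI) auto
qed

text \<open>
  An optimal vertex \<open>v\<close> of the coarse problem is used because the continuation argument has to start
  at a vertex. The path of data leads from the shifted right-hand side to \<open>d\<close>; the two differ
  only off the free stages, by the residual of the projected solution.
\<close>

lemma coarse_solution_error:
  assumes band: "block_bidiagonal m n G"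
  shows "\<exists>zs v. lp_optimal d G p zs \<and> lp_optimal dc Gc pc v \<and> optimal_bases G p \<noteq> {} \<and>
    (\<forall>i\<in>{1..N}. eucl_norm (vec_block n zs i - vec_block n (zo + T *\<^sub>v v) i) \<le>
      (\<Sum>j\<in>{1..N} - S. Gamma_const G p * eucl_norm (vec_block m (d - G *\<^sub>v (zo + T *\<^sub>v v)) j) *
         stage_decay G p i j))"
proof -
  obtain v where v: "lp_optimal dc Gc pc v" and ker: "trivial_kernel_on Gc (active_rows Gc dc {..<m * K} v)"
    using coarse_optimal_vertex by blast
  have vc: "v \<in> carrier_vec (n * K)" using v unfolding lp_optimal_def lp_feasible_def Gc_dims by blast
  let ?z = "zo + T *\<^sub>v v"
  let ?e = "shifted_rhs ?z"
  have zc: "?z \<in> carrier_vec (n * N)" using zo_carrier T_mult[OF vc] by simp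
  note opt = projected_coarse_solution_optimal[OF v]
  note vert = projected_coarse_solution_vertex[OF vc ker]
  let ?C = "\<lambda>i. \<Sum>j\<in>{1..N}. Gamma_const G p * eucl_norm (vec_block m (d - ?e) j) *
      stage_decay G p i j"
  have D: "0 < n * N" using n_pos N_pos by simp
  have e: "d - ?e \<in> carrier_vec (m * N)" using d_carrier shifted_rhs_carrier by simp
  have "\<exists>z1. lp_optimal d G p z1 \<and>
      (\<forall>i\<in>{1..N}. eucl_norm (vec_block n z1 i - vec_block n ?z i) \<le> ?C i)"
  proof (rule optimal_vertex_path[OF G_carrier p_carrier shifted_rhs_carrier d_carrier opt vert])
    show "lp_feasible d G \<noteq> {}" using zo_feasible by blast
    show "eucl_norm (vec_block n w i) \<le> ?C i"
      if "B \<in> optimal_bases G p" "w \<in> carrier_vec (n * N)"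
        "\<And>k. k \<in> B \<Longrightarrow> (G *\<^sub>v w) $ k = (d - ?e) $ k" "i \<in> {1..N}" for B w i
      using basis_solution_decay[OF that(1) G_carrier D m_pos band e that(2,3,4)] .
  qed
  then obtain zs where zs: "lp_optimal d G p zs"
    "\<And>i. i \<in> {1..N} \<Longrightarrow> eucl_norm (vec_block n zs i - vec_block n ?z i) \<le> ?C i" by blast
  have C: "?C i = (\<Sum>j\<in>{1..N} - S. Gamma_const G p * eucl_norm (vec_block m (d - G *\<^sub>v ?z) j) *
      stage_decay G p i j)" for i
  proof (rule sum.mono_neutral_cong_right)
    show "\<forall>j\<in>{1..N} - ({1..N} - S). Gamma_const G p * eucl_norm (vec_block m (d - ?e) j) *
      stage_decay G p i j = 0"
    proof
      fix j assume j: "j \<in> {1..N} - ({1..N} - S)"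
      then have jN: "j \<in> {1..N}" and jS: "j \<in> S" by auto
      have "vec_block m (d - ?e) j = vec_block m (0\<^sub>v (m * N)) j"
        by (rule vec_block_eqI[OF jN]) (use jN jS in \<open>simp add: shifted_rhs_def\<close>)
      also have "\<dots> = 0\<^sub>v m" using block_index_less[OF jN] by (intro eq_vecI) (auto simp: vec_block_def)
      finally have "vec_block m (d - ?e) j = 0\<^sub>v m" .
      then have "eucl_norm (vec_block m (d - ?e) j) = 0" by (simp add: eucl_norm_eq_0[of _ m])
      then show "Gamma_const G p * eucl_norm (vec_block m (d - ?e) j) *
          stage_decay G p i j = 0" by simp
    qed
  next
    fix j assume "j \<in> {1..N} - S"
    then have jN: "j \<in> {1..N}" and jS: "j \<notin> S" by auto
    have "vec_block m (d - ?e) j = vec_block m (d - G *\<^sub>v ?z) j"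
      by (rule vec_block_eqI[OF jN])
        (use jN jS dims in \<open>simp add: shifted_rhs_def del: index_mult_mat_vec\<close>)
    then show "Gamma_const G p * eucl_norm (vec_block m (d - ?e) j) *
        stage_decay G p i j =
      Gamma_const G p * eucl_norm (vec_block m (d - G *\<^sub>v ?z) j) *
        stage_decay G p i j" by (simp only:)
  qed auto
  have "optimal_bases G p \<noteq> {}"
  proof -
    have sub: "active_rows G ?e {..<m * N} ?z \<subseteq> {..<dim_row G}" unfolding active_rows_def dims by blast
    obtain B where B: "B \<subseteq> active_rows G ?e {..<m * N} ?z" "is_basis G B"
      using basis_in_trivial_kernel[OF vert sub] by blast
    have "dim_vec ?e = dim_row G" using carrier_vecD[OF shifted_rhs_carrier] unfolding dims .
    then have "B \<in> optimal_bases G p"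
      by (rule optimal_basisI[OF B(2) _ opt]) (use B(1) in \<open>auto simp only: active_rows_def\<close>)
    then show ?thesis by blast
  qed
  then show ?thesis using zs v unfolding C by blast
qed

end

theorem theorem4:
  fixes N K nx nu nw n m :: nat
    and A B E F :: "nat \<Rightarrow> real mat"
    and Gb :: "nat \<Rightarrow> nat \<Rightarrow> real mat"
    and G T U Gc :: "real mat"
    and p d zo lo pc dc :: "real vec"
    and M :: "nat \<Rightarrow> nat"
    and P :: "real vec set"
    and S :: "nat set"
    and \<Gamma> \<rho> \<Delta> :: real
  assumes "1 \<le> N"
    and n: "n = nx + nu" and "0 < n"
    and m: "m = 4 * nx + 2 * nu + 2 * nw"
    and "\<And>i. i \<in> {1..N - 1} \<Longrightarrow> A i \<in> carrier_mat nx nx"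
    and "\<And>i. i \<in> {1..N - 1} \<Longrightarrow> B i \<in> carrier_mat nx nu"
    and "\<And>i. i \<in> {1..N} \<Longrightarrow> E i \<in> carrier_mat nw nx"
    and "\<And>i. i \<in> {1..N} \<Longrightarrow> F i \<in> carrier_mat nw nu"
    and Gb: "Gb = stage_block nx nu nw A B E F"
    and G: "G = block_mat N m n Gb"
    and "p \<in> carrier_vec (n * N)"
    and \<Gamma>: "\<Gamma> = Gamma_const G p"
    and \<rho>: "\<rho> = rho_const G p"
    and "coarse_grid N K M"
    and T: "T = coarsening_mat n K M"
    and U: "U = coarsening_mat m K M"
    and "lo \<in> carrier_vec (m * N)"
    and pc: "pc = T\<^sup>T *\<^sub>v (p - G\<^sup>T *\<^sub>v lo)"
    and dc: "dc = U\<^sup>T *\<^sub>v (d - G *\<^sub>v zo)"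
    and Gc: "Gc = U\<^sup>T * G * T"
    and S: "S = free_indices m K M lo"
    and P: "P = {zo + T *\<^sub>v zt | zt. zt \<in> lp_feasible dc Gc}"
    and \<Delta>: "\<Delta> = coarsening_error N m n Gb d P"
    and "d \<in> feasible_data G"
    and "zo \<in> lp_feasible d G"
  shows "\<exists>zs z'. lp_optimal d G p zs \<and>
           (\<exists>zt. lp_optimal dc Gc pc zt \<and> z' = zo + T *\<^sub>v zt) \<and>
           (\<forall>i \<in> {1..N}. eucl_norm (vec_block n zs i - vec_block n z' i)
              \<le> (\<Sum>j \<in> {1..N} - S.
                    \<Gamma> * \<Delta> * \<rho> ^ nat (max 0 (\<bar>int i - int j\<bar> - 1))))"
proof -
  note stage = \<open>m = 4 * nx + 2 * nu + 2 * nw\<close> \<open>n = nx + nu\<close> assms(5,6,7,8)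
  have m0: "0 < m" using \<open>0 < n\<close> m n by simp
  have Gbc: "Gb i j \<in> carrier_mat m n" if "i \<in> {1..N}" for i j
    unfolding Gb by (rule stage_block_carrier[OF stage that])
  have Gb0: "Gb i j = 0\<^sub>m m n" if "i \<in> {1..N}" "j \<noteq> i" "j + 1 \<noteq> i" for i j
    using that unfolding Gb stage_block_def m n by auto
  have Gcar: "G \<in> carrier_mat (m * N) (n * N)" by (simp add: G block_mat_def)
  have dcar: "d \<in> carrier_vec (m * N)" using \<open>d \<in> feasible_data G\<close> Gcar by (simp add: feasible_data_def)
  have band: "block_bidiagonal m n G"
    unfolding block_bidiagonal_def
  proof (intro allI impI)
    fix r c assume rc: "r < dim_row G" "c < dim_col G" and nz: "G $$ (r, c) \<noteq> 0"
    have r: "r < m * N" and c: "c < n * N" using rc Gcar by auto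
    have "r div m < N" using r m0 by (simp add: div_less_iff_less_mult mult.commute)
    then have i: "r div m + 1 \<in> {1..N}" by simp
    have G: "G $$ (r, c) = Gb (r div m + 1) (c div n + 1) $$ (r mod m, c mod n)"
      using r c by (simp add: G block_mat_def)
    show "c div n = r div m \<or> c div n + 1 = r div m"
    proof (rule ccontr)
      assume "\<not> ?thesis"
      then have "Gb (r div m + 1) (c div n + 1) = 0\<^sub>m m n" by (intro Gb0[OF i]) auto
      then show False using nz m0 \<open>0 < n\<close> by (simp add: G)
    qed
  qed
  interpret cp: coarsened_program N K n m M G d p zo lo "opposite_row nx nu nw" "bound_row nx nw"
  proof
    show "0 < n" "0 < m" "0 < N" using \<open>0 < n\<close> m0 \<open>1 \<le> N\<close> by auto
    show "opposite_row nx nu nw s < m" if "s < m" for s using opposite_row_less that unfolding m .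
    show "bound_row nx nw c < m" if "c < n" for c using bound_row_less that unfolding m n .
    fix i :: nat and x :: "real vec" assume i: "i \<in> {1..N}" and x: "x \<in> carrier_vec (n * N)"
    show "(G *\<^sub>v x) $ ((i - 1) * m + opposite_row nx nu nw s) = - (G *\<^sub>v x) $ ((i - 1) * m + s)"
      if s: "s < m" for s
    proof -
      have s': "opposite_row nx nu nw s < m" using opposite_row_less s unfolding m .
      have "(Gb i j *\<^sub>v vec_block n x j) $ opposite_row nx nu nw s = - (Gb i j *\<^sub>v vec_block n x j) $ s" for j
      proof -
        have dim: "dim_row (Gb i j) = m" "dim_col (Gb i j) = n" using Gbc[OF i, of j] by auto
        have "Gb i j $$ (opposite_row nx nu nw s, c) = - Gb i j $$ (s, c)" if "c < n" for c
          unfolding Gb by (rule stage_block_opposite[OF stage i s that])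
        then show ?thesis using s s' dim
          by (simp add: scalar_prod_def dim_vec_block sum_negf[symmetric])
      qed
      then show ?thesis
        unfolding G block_mat_mult_vec[where Gb = Gb and i = i, OF Gbc[OF i] i s x]
          block_mat_mult_vec[where Gb = Gb and i = i, OF Gbc[OF i] i s' x]
        by (simp add: sum_negf del: index_mult_mat_vec)
    qed
    show "(G *\<^sub>v x) $ ((i - 1) * m + bound_row nx nw c) = x $ ((i - 1) * n + c)" if c: "c < n" for c
    proof -
      have s: "bound_row nx nw c < m" using bound_row_less c unfolding m n .
      have "(Gb i j *\<^sub>v vec_block n x j) $ bound_row nx nw c = (if j = i then x $ ((i - 1) * n + c) else 0)" for j
      proof -
        have dim: "dim_row (Gb i j) = m" "dim_col (Gb i j) = n" using Gbc[OF i, of j] by auto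
        have entry: "Gb i j $$ (bound_row nx nw c, b) = (if j = i \<and> b = c then 1 else 0)" if "b < n" for b
          unfolding Gb by (rule stage_block_bound_row[OF stage i c that])
        have "(Gb i j *\<^sub>v vec_block n x j) $ bound_row nx nw c =
            (\<Sum>b\<in>{0..<n}. Gb i j $$ (bound_row nx nw c, b) * vec_block n x j $ b)"
          using s dim by (simp add: scalar_prod_def dim_vec_block)
        also have "\<dots> = (\<Sum>b\<in>{0..<n}. if b = c then (if j = i then vec_block n x j $ c else 0) else 0)"
          by (intro sum.cong refl) (auto simp: entry)
        finally show ?thesis using c i by (auto simp: vec_block_def)
      qed
      then show ?thesis
        unfolding G block_mat_mult_vec[where Gb = Gb and i = i, OF Gbc[OF i] i s x]
        using i by (simp del: index_mult_mat_vec)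
    qed
  qed (use assms dcar Gcar in auto)
  obtain zs v where zs: "lp_optimal d G p zs" and v: "lp_optimal dc Gc pc v"
    and ne: "optimal_bases G p \<noteq> {}"
    and bd: "\<And>i. i \<in> {1..N} \<Longrightarrow> eucl_norm (vec_block n zs i - vec_block n (zo + T *\<^sub>v v) i) \<le>
      (\<Sum>j\<in>{1..N} - S. \<Gamma> * eucl_norm (vec_block m (d - G *\<^sub>v (zo + T *\<^sub>v v)) j) *
         \<rho> ^ nat (max 0 (\<bar>int i - int j\<bar> - 1)))"
    using cp.coarse_solution_error[OF band] unfolding T U pc dc Gc S \<Gamma> \<rho> by blast
  have proj: "zo + T *\<^sub>v u \<in> carrier_vec (n * N)" if "u \<in> lp_feasible dc Gc" for u
  proof -
    have "u \<in> carrier_vec (n * K)" using that unfolding lp_feasible_def Gc U T cp.Gc_dims by blast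
    then show ?thesis using cp.zo_carrier cp.T_mult unfolding T by simp
  qed
  have res: "stage_residual m n Gb d (zo + T *\<^sub>v u) j = vec_block m (d - G *\<^sub>v (zo + T *\<^sub>v u)) j"
    if "u \<in> lp_feasible dc Gc" "j \<in> {1..N}" for u j
    unfolding G by (intro stage_residual_eq_vec_block Gbc Gb0 that(2) dcar proj[OF that(1)])
  let ?f = "\<lambda>z. Max ((\<lambda>j. eucl_norm (stage_residual m n Gb d z j)) ` {1..N})"
  obtain R where R: "\<And>u. u \<in> lp_feasible dc Gc \<Longrightarrow> eucl_norm (d - G *\<^sub>v (zo + T *\<^sub>v u)) \<le> R"
    using cp.coarse_residual_bounded unfolding T U dc Gc by blast
  have "?f z \<le> R" if z: "z \<in> P" for z
  proof -
    obtain u where u: "u \<in> lp_feasible dc Gc" "z = zo + T *\<^sub>v u" using z unfolding P by blast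
    have "eucl_norm (stage_residual m n Gb d z j) \<le> R" if j: "j \<in> {1..N}" for j
    proof -
      have "d - G *\<^sub>v (zo + T *\<^sub>v u) \<in> carrier_vec (m * N)"
        using dcar cp.G_mult[OF proj[OF u(1)]] by simp
      from vec_block_norm_le[OF j this] R[OF u(1)] show ?thesis unfolding u(2) res[OF u(1) j] by linarith
    qed
    then show ?thesis using \<open>1 \<le> N\<close> by (intro Max.boundedI) auto
  qed
  then have bdd: "bdd_above (?f ` P)" by (intro bdd_aboveI2)
  have vf: "v \<in> lp_feasible dc Gc" using v by (simp only: lp_optimal_def)
  have le\<Delta>: "eucl_norm (vec_block m (d - G *\<^sub>v (zo + T *\<^sub>v v)) j) \<le> \<Delta>" if j: "j \<in> {1..N}" for j
  proof -
    have "zo + T *\<^sub>v v \<in> P" using vf unfolding P by blast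
    then have "?f (zo + T *\<^sub>v v) \<le> \<Delta>" unfolding \<Delta> coarsening_error_def by (rule cSUP_upper[OF _ bdd])
    moreover have "eucl_norm (stage_residual m n Gb d (zo + T *\<^sub>v v) j) \<le> ?f (zo + T *\<^sub>v v)"
      using j by (intro Max_ge) auto
    ultimately show ?thesis unfolding res[OF vf j] by linarith
  qed
  have D: "0 < dim_col G" using Gcar \<open>0 < n\<close> \<open>1 \<le> N\<close> by simp
  have \<rho>0: "0 \<le> \<rho>" unfolding \<rho> by (rule rho_const_bounds(1)[OF ne D])
  have "0 < 1 / sigma_lower G p" using sigma_lower_pos[OF ne D] by simp
  then have \<Gamma>0: "0 \<le> \<Gamma>" unfolding \<Gamma> using Gamma_const_ge[OF ne D] by linarith
  have "eucl_norm (vec_block n zs i - vec_block n (zo + T *\<^sub>v v) i) \<le>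
      (\<Sum>j\<in>{1..N} - S. \<Gamma> * \<Delta> * \<rho> ^ nat (max 0 (\<bar>int i - int j\<bar> - 1)))" if i: "i \<in> {1..N}" for i
  proof (rule order_trans[OF bd[OF i]])
    show "(\<Sum>j\<in>{1..N} - S. \<Gamma> * eucl_norm (vec_block m (d - G *\<^sub>v (zo + T *\<^sub>v v)) j) *
         \<rho> ^ nat (max 0 (\<bar>int i - int j\<bar> - 1))) \<le>
      (\<Sum>j\<in>{1..N} - S. \<Gamma> * \<Delta> * \<rho> ^ nat (max 0 (\<bar>int i - int j\<bar> - 1)))"
      using \<Gamma>0 \<rho>0 le\<Delta> by (intro sum_mono mult_right_mono mult_left_mono) auto
  qed
  then show ?thesis using zs v by blast
qed

end
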